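(* Consider a random unitary $W$ on $\mathbb C^N$ such that $W$ has the same distribution as $UD_1U^\dagger\cdot VD_2V^\dagger$, where $U$ and $V$ are independent Haar random unitaries in $\mathrm U(N)$, and $D_1,D_2$ are random unitary matrices (independent of $U,V$) such that for each instance of $D_i$, $i=1,2$, $$\sum_{k=1}^p\big|\overline{\mathrm{tr}}(D_i^k)\big|\le\frac14 .$$ Then, for dimension $N>\frac{97}{2}p^{7/2}$, the expectation of the $p$-th normalized trace moment satisfies $$\Big|\mathbb E_W\,\overline{\mathrm{tr}}(W^p)\Big|\le O\Big(\frac{p^{15/4}}{\sqrt N}\Big)+p\;\mathbb E_{D_1,D_2}\Big(|\overline{\mathrm{tr}}D_1|+|\overline{\mathrm{tr}}D_2|+|\overline{\mathrm{tr}}D_1|\,|\overline{\mathrm{tr}}D_2|\Big).$$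
   Context: $\overline{\mathrm{tr}}(A)=\frac1N\mathrm{tr}(A)$ is the normalized trace on $N\times N$ matrices; $p\ge1$ is an integer. The implied constant in $O(\cdot)$ is absolute (independent of $p$, $N$ and the distributions of $D_1,D_2$). *)

theory Defs
  imports "HOL-Probability.Probability" "Jordan_Normal_Form.Schur_Decomposition"
begin

definition unitary_group :: "nat \<Rightarrow> complex mat set" where
  "unitary_group N = {A \<in> carrier_mat N N. A * mat_adjoint A = 1\<^sub>m N \<and> mat_adjoint A * A = 1\<^sub>m N}"

definition norm_trace :: "complex mat \<Rightarrow> complex" where
  "norm_trace A = (\<Sum>i<dim_row A. A $$ (i, i)) / of_nat (dim_row A)"

text \<open>The type of matrices carries no topology. The Borel sigma-algebra of the unitary group is
  induced from the Borel sigma-algebra of the space of \<open>N * N\<close> complex coordinates; see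
  \<open>measurable_unitary_borel_iff\<close>.\<close>

definition mat_coords :: "nat \<Rightarrow> complex mat \<Rightarrow> nat \<times> nat \<Rightarrow> complex" where
  "mat_coords N A = (\<lambda>ij\<in>{..<N} \<times> {..<N}. A $$ ij)"

definition unitary_borel :: "nat \<Rightarrow> complex mat measure" where
  "unitary_borel N =
     vimage_algebra (unitary_group N) (mat_coords N) (PiM ({..<N} \<times> {..<N}) (\<lambda>_. borel))"

text \<open>Left invariance and total mass one determine the measure uniquely.\<close>

definition haar_unitary :: "nat \<Rightarrow> complex mat measure \<Rightarrow> bool" where
  "haar_unitary N H \<longleftrightarrow>
     prob_space H \<and> sets H = sets (unitary_borel N) \<and>
     (\<forall>G \<in> unitary_group N. distr H (unitary_borel N) (\<lambda>A. G * A) = H)"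

text \<open>A law on pairs: the two random unitaries may be dependent on each other.\<close>

definition unitary_pair_law :: "nat \<Rightarrow> (complex mat \<times> complex mat) measure \<Rightarrow> bool" where
  "unitary_pair_law N \<mu> \<longleftrightarrow>
     prob_space \<mu> \<and> sets \<mu> = sets (unitary_borel N \<Otimes>\<^sub>M unitary_borel N)"

text \<open>The product measure on the left expresses that \<open>U\<close>, \<open>V\<close> and the pair \<open>(D1, D2)\<close> are
  independent, with \<open>U\<close> and \<open>V\<close> distributed as \<open>H\<close> and \<open>(D1, D2)\<close> as \<open>\<mu>\<close>.\<close>

definition rotated_product_law ::
    "nat \<Rightarrow> complex mat measure \<Rightarrow> (complex mat \<times> complex mat) measure \<Rightarrow> complex mat measure" where
  "rotated_product_law N H \<mu> =
     distr ((H \<Otimes>\<^sub>M H) \<Otimes>\<^sub>M \<mu>) (unitary_borel N)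
       (\<lambda>((U, V), (D1, D2)). (U * D1 * mat_adjoint U) * (V * D2 * mat_adjoint V))"

lemma space_unitary_borel [simp]: "space (unitary_borel N) = unitary_group N"
  by (simp add: unitary_borel_def)

lemma measurable_unitary_borel_iff:
  "f \<in> measurable M (unitary_borel N) \<longleftrightarrow>
     f \<in> space M \<rightarrow> unitary_group N \<and>
     (\<forall>i<N. \<forall>j<N. (\<lambda>x. f x $$ (i, j)) \<in> borel_measurable M)"
proof
  assume f: "f \<in> measurable M (unitary_borel N)"
  have "mat_coords N \<in> measurable (unitary_borel N) (PiM ({..<N} \<times> {..<N}) (\<lambda>_. borel))"
    unfolding unitary_borel_def
    by (rule measurable_vimage_algebra1) (auto simp: mat_coords_def space_PiM)
  from measurable_compose[OF f this]
  have c: "(\<lambda>x. mat_coords N (f x)) \<in> measurable M (PiM ({..<N} \<times> {..<N}) (\<lambda>_. borel))" .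
  have "(\<lambda>x. f x $$ (i, j)) \<in> borel_measurable M" if "i < N" "j < N" for i j
  proof -
    have "(\<lambda>x. mat_coords N (f x) (i, j)) \<in> borel_measurable M"
      using measurable_compose[OF c measurable_component_singleton] that by auto
    then show ?thesis using that by (simp add: mat_coords_def)
  qed
  with measurable_space[OF f] show "f \<in> space M \<rightarrow> unitary_group N \<and>
     (\<forall>i<N. \<forall>j<N. (\<lambda>x. f x $$ (i, j)) \<in> borel_measurable M)"
    by auto
next
  assume a: "f \<in> space M \<rightarrow> unitary_group N \<and>
     (\<forall>i<N. \<forall>j<N. (\<lambda>x. f x $$ (i, j)) \<in> borel_measurable M)"
  then have "(\<lambda>x. mat_coords N (f x)) \<in> measurable M (PiM ({..<N} \<times> {..<N}) (\<lambda>_. borel))"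
    unfolding mat_coords_def by (intro measurable_restrict) auto
  with a show "f \<in> measurable M (unitary_borel N)"
    unfolding unitary_borel_def by (intro measurable_vimage_algebra2) auto
qed

lemma mat_adjoint_carrier:
  "A \<in> carrier_mat n m \<Longrightarrow> mat_adjoint A \<in> carrier_mat m n"
  by (auto simp: mat_adjoint_def)

lemma mat_adjoint_index:
  "A \<in> carrier_mat n m \<Longrightarrow> i < m \<Longrightarrow> j < n \<Longrightarrow> mat_adjoint A $$ (i, j) = cnj (A $$ (j, i))"
  by (auto simp: mat_adjoint_def mat_of_rows_def conjugate_complex_def)

lemma mat_adjoint_adjoint:
  fixes A :: "complex mat"
  assumes "A \<in> carrier_mat n m" shows "mat_adjoint (mat_adjoint A) = A"
proof (rule eq_matI)
  note c = mat_adjoint_carrier[OF assms]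
  fix i j assume "i < dim_row A" "j < dim_col A"
  with assms show "mat_adjoint (mat_adjoint A) $$ (i, j) = A $$ (i, j)"
    by (simp add: mat_adjoint_index[OF c] mat_adjoint_index[OF assms])
qed (use assms in \<open>auto simp: mat_adjoint_def\<close>)

lemma mat_adjoint_mult:
  fixes A B :: "complex mat"
  assumes A: "A \<in> carrier_mat n m" and B: "B \<in> carrier_mat m k"
  shows "mat_adjoint (A * B) = mat_adjoint B * mat_adjoint A"
proof (rule eq_matI)
  note cA = mat_adjoint_carrier[OF A] and cB = mat_adjoint_carrier[OF B]
  have AB: "A * B \<in> carrier_mat n k" using A B by auto
  fix i j assume "i < dim_row (mat_adjoint B * mat_adjoint A)"
    and "j < dim_col (mat_adjoint B * mat_adjoint A)"
  then have i: "i < k" and j: "j < n" using cA cB by auto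
  have "mat_adjoint (A * B) $$ (i, j) = cnj (\<Sum>l<m. A $$ (j, l) * B $$ (l, i))"
    using A B i j
    by (simp add: mat_adjoint_index[OF AB i j] scalar_prod_def atLeast0LessThan)
  also have "\<dots> = (mat_adjoint B * mat_adjoint A) $$ (i, j)"
    using A B cA cB i j
    by (simp add: scalar_prod_def atLeast0LessThan mult.commute
        mat_adjoint_index[OF A] mat_adjoint_index[OF B])
  finally show "mat_adjoint (A * B) $$ (i, j) = (mat_adjoint B * mat_adjoint A) $$ (i, j)" .
qed (use A B in \<open>auto simp: mat_adjoint_def\<close>)

lemma unitary_group_adjoint: "A \<in> unitary_group N \<Longrightarrow> mat_adjoint A \<in> unitary_group N"
  by (auto simp: unitary_group_def mat_adjoint_adjoint intro: mat_adjoint_carrier)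

lemma unitary_group_mult:
  assumes "A \<in> unitary_group N" and "B \<in> unitary_group N" shows "A * B \<in> unitary_group N"
proof -
  from assms have c: "A \<in> carrier_mat N N" "B \<in> carrier_mat N N"
    and u: "A * mat_adjoint A = 1\<^sub>m N" "mat_adjoint A * A = 1\<^sub>m N"
      "B * mat_adjoint B = 1\<^sub>m N" "mat_adjoint B * B = 1\<^sub>m N"
    by (auto simp: unitary_group_def)
  note d = mat_adjoint_carrier[OF c(1)] mat_adjoint_carrier[OF c(2)]
  have "(A * B) * (mat_adjoint B * mat_adjoint A) = A * ((B * mat_adjoint B) * mat_adjoint A)"
    using c d by (simp add: assoc_mult_mat[of _ N N _ N _ N])
  moreover have "(mat_adjoint B * mat_adjoint A) * (A * B) = mat_adjoint B * ((mat_adjoint A * A) * B)"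
    using c d by (simp add: assoc_mult_mat[of _ N N _ N _ N])
  ultimately show ?thesis
    using c d u by (auto simp: unitary_group_def mat_adjoint_mult)
qed

lemma measurable_unitary_adjoint:
  assumes f: "f \<in> measurable M (unitary_borel N)"
  shows "(\<lambda>x. mat_adjoint (f x)) \<in> measurable M (unitary_borel N)"
proof -
  from f have s: "\<And>x. x \<in> space M \<Longrightarrow> f x \<in> unitary_group N"
    and m: "\<And>i j. i < N \<Longrightarrow> j < N \<Longrightarrow> (\<lambda>x. f x $$ (i, j)) \<in> borel_measurable M"
    by (auto simp: measurable_unitary_borel_iff)
  have "(\<lambda>x. mat_adjoint (f x) $$ (i, j)) \<in> borel_measurable M" if "i < N" "j < N" for i j
  proof -
    have eq: "mat_adjoint (f x) $$ (i, j) = cnj (f x $$ (j, i))" if "x \<in> space M" for x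
      using s[OF that] \<open>i < N\<close> \<open>j < N\<close> mat_adjoint_index by (auto simp: unitary_group_def)
    have "(\<lambda>x. cnj (f x $$ (j, i))) \<in> borel_measurable M"
      by (rule measurable_compose[OF m[OF \<open>j < N\<close> \<open>i < N\<close>]])
        (intro borel_measurable_continuous_onI continuous_intros)
    then show ?thesis by (subst measurable_cong[OF eq]) auto
  qed
  with s show ?thesis by (auto simp: measurable_unitary_borel_iff unitary_group_adjoint)
qed

lemma measurable_unitary_mult:
  assumes f: "f \<in> measurable M (unitary_borel N)" and g: "g \<in> measurable M (unitary_borel N)"
  shows "(\<lambda>x. f x * g x) \<in> measurable M (unitary_borel N)"
proof -
  from f g have s: "\<And>x. x \<in> space M \<Longrightarrow> f x \<in> unitary_group N"
      "\<And>x. x \<in> space M \<Longrightarrow> g x \<in> unitary_group N"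
    and m: "\<And>i j. i < N \<Longrightarrow> j < N \<Longrightarrow> (\<lambda>x. f x $$ (i, j)) \<in> borel_measurable M"
      "\<And>i j. i < N \<Longrightarrow> j < N \<Longrightarrow> (\<lambda>x. g x $$ (i, j)) \<in> borel_measurable M"
    by (auto simp: measurable_unitary_borel_iff)
  have "(\<lambda>x. (f x * g x) $$ (i, j)) \<in> borel_measurable M" if "i < N" "j < N" for i j
  proof -
    have eq: "(f x * g x) $$ (i, j) = (\<Sum>k<N. f x $$ (i, k) * g x $$ (k, j))"
      if "x \<in> space M" for x
      using s[OF that] \<open>i < N\<close> \<open>j < N\<close>
      by (auto simp: unitary_group_def scalar_prod_def atLeast0LessThan)
    show ?thesis
      by (subst measurable_cong[OF eq]) (use m that in \<open>auto intro!: borel_measurable_sum borel_measurable_times\<close>)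
  qed
  with s show ?thesis by (auto simp: measurable_unitary_borel_iff unitary_group_mult)
qed

lemma measurable_rotated_product:
  assumes H: "haar_unitary N H" and \<mu>: "unitary_pair_law N \<mu>"
  shows "(\<lambda>((U, V), (D1, D2)). (U * D1 * mat_adjoint U) * (V * D2 * mat_adjoint V))
    \<in> measurable ((H \<Otimes>\<^sub>M H) \<Otimes>\<^sub>M \<mu>) (unitary_borel N)"
proof -
  have sH: "sets H = sets (unitary_borel N)"
    and s\<mu>: "sets \<mu> = sets (unitary_borel N \<Otimes>\<^sub>M unitary_borel N)"
    using H \<mu> by (auto simp: haar_unitary_def unitary_pair_law_def)
  let ?B = "unitary_borel N"
  have eq: "sets ((H \<Otimes>\<^sub>M H) \<Otimes>\<^sub>M \<mu>) = sets ((?B \<Otimes>\<^sub>M ?B) \<Otimes>\<^sub>M (?B \<Otimes>\<^sub>M ?B))"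
    by (intro sets_pair_measure_cong sH s\<mu>)
  show ?thesis
    unfolding measurable_cong_sets[OF eq refl] case_prod_beta
    by (intro measurable_unitary_mult measurable_unitary_adjoint) measurable
qed

lemma prob_space_rotated_product_law:
  assumes "haar_unitary N H" and "unitary_pair_law N \<mu>"
  shows "prob_space (rotated_product_law N H \<mu>)"
proof -
  interpret H: prob_space H using assms(1) by (simp add: haar_unitary_def)
  interpret m: prob_space \<mu> using assms(2) by (simp add: unitary_pair_law_def)
  interpret HH: pair_prob_space H H ..
  interpret P: pair_prob_space "H \<Otimes>\<^sub>M H" \<mu> ..
  show ?thesis
    unfolding rotated_product_law_def
    by (rule P.prob_space_distr[OF measurable_rotated_product[OF assms]])
qed

end

(*
Conjugating by U leaves one Haar unitary: the moment is E tr (Y X)^p with X = D1, Y = V D2 V^*.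
Left invariance of Haar measure under the rotations 1 + (e^{it} - 1) v v^* gives, at first order in t,
exact loop equations that express E tr (Y^k X (Y X)^j) through expectations of products of two traces
of shorter words.  The traces have variance O(p^2 / N): write the Haar unitary as a product of N
Householder matrices, each a rank one perturbation of the identity, and sum the squares of the
martingale differences.  So up to O(p^3 / N) the products factor and the loop equations become a
closed quadratic system for the expectations.  Because the l1-norms of the moments of D1 and D2 are at
most 1/4, this system is a contraction in l1 of the word length, and its solution is controlled by
(|tr D1| + |tr D2|) / 2 plus O(p^4 / N), which is below the error term in the stated range of N.
*)

theory Submission
  imports Defs
begin

subsection \<open>Stability of the quadratic loop system\<close>

text \<open>The words Y^k X (Y X)^j, with Y the rotated matrix, are chosen because Y^k is a
  conjugate of a fixed power: its derivative is a commutator with two terms, and its Lipschitz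
  constant is the same for every k >= 1. Cutting inside (Y X)^j gives words of the same family up to
  cyclic order. At k = 0 the loop equation is a tautology, because the trace of the zeroth power is
  1 and the linear terms cancel. Cyclicity supplies the missing relation: X (Y X)^(j+1) has the
  trace of X^2 Y (X Y)^j, where the two matrices are exchanged. Hence two coupled systems are solved
  together, and the first traces of the two matrices enter as the words with k = j = 0. Each
  Householder factor changes a normalised trace by at most 2/N, and a conjugation contains U twice,
  so a word with j < p changes by at most c = 4p/N and has variance at most N c^2 = 16 p^2/N. A loop
  equation has at most p summands with two covariances each, so its error is at most \<delta> = 32
  p^3/N. The stability argument needs p \<delta> \<le> 1/48. Otherwise 1536 p^4/N, with 1536 = 48 *
  32, exceeds 1 and the estimate is trivial.\<close>

lemma sum_convolution_le:
  fixes x y :: "nat \<Rightarrow> real"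
  assumes x: "\<And>i. x i \<ge> 0" and y: "\<And>i. y i \<ge> 0"
  shows "(\<Sum>j<Suc J. \<Sum>i<j. x i * y (j - 1 - i)) \<le> (\<Sum>i<J. x i) * (\<Sum>i<J. y i)"
proof -
  have "(\<Sum>j<Suc J. \<Sum>i<j. x i * y (j - 1 - i)) = (\<Sum>j<J. \<Sum>i<Suc j. x i * y (j - i))"
    by (subst sum.lessThan_Suc_shift) simp
  also have "\<dots> = (\<Sum>j<J. \<Sum>i\<le>j. x i * y (j - i))"
    by (simp add: lessThan_Suc_atMost)
  also have "\<dots> = (\<Sum>(i, j) \<in> {(i, j). i + j < J}. x i * y j)"
    by (rule sum.triangle_reindex[symmetric])
  also have "\<dots> \<le> (\<Sum>(i, j) \<in> {..<J} \<times> {..<J}. x i * y j)"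
    by (rule sum_mono2) (auto simp: x y)
  also have "\<dots> = (\<Sum>i<J. x i) * (\<Sum>i<J. y i)"
    by (simp add: sum.cartesian_product sum_product)
  finally show ?thesis .
qed

text \<open>The second indices in a product add up to \<open>j - 1\<close>, so the quadratic sums on
  the right stop at \<open>J\<close> while the left side reaches \<open>Suc J\<close>. The induction
  on \<open>J\<close> in \<open>l1_bounds\<close> runs on this gain of one index; only the linear
  term keeps \<open>Suc J\<close>, and it involves index 0, which is controlled separately.\<close>

lemma loop_l1_step:
  fixes a :: "nat \<Rightarrow> nat \<Rightarrow> complex" and \<tau> :: complex
  assumes loop: "\<And>j. j \<le> J \<Longrightarrow> cmod (a k j - \<tau> * a 0 j -
      (\<Sum>i<j. a (Suc k) i * a 0 (j - 1 - i) - a k i * a 1 (j - 1 - i))) \<le> \<delta>"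
  shows "(\<Sum>j<Suc J. cmod (a k j)) \<le> cmod \<tau> * (\<Sum>j<Suc J. cmod (a 0 j))
     + (\<Sum>j<J. cmod (a (Suc k) j)) * (\<Sum>j<J. cmod (a 0 j))
     + (\<Sum>j<J. cmod (a k j)) * (\<Sum>j<J. cmod (a 1 j)) + real (Suc J) * \<delta>"
proof -
  have pt: "cmod (a k j) \<le> cmod \<tau> * cmod (a 0 j)
      + (\<Sum>i<j. cmod (a (Suc k) i) * cmod (a 0 (j - 1 - i)))
      + (\<Sum>i<j. cmod (a k i) * cmod (a 1 (j - 1 - i))) + \<delta>" if "j \<le> J" for j
  proof -
    let ?S = "\<Sum>i<j. a (Suc k) i * a 0 (j - 1 - i) - a k i * a 1 (j - 1 - i)"
    have "cmod ?S \<le> (\<Sum>i<j. cmod (a (Suc k) i) * cmod (a 0 (j - 1 - i))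
         + cmod (a k i) * cmod (a 1 (j - 1 - i)))"
      by (rule order_trans[OF norm_sum sum_mono])
        (auto simp: norm_mult[symmetric] intro: norm_triangle_ineq4)
    moreover have "cmod (a k j) \<le> cmod (a k j - \<tau> * a 0 j - ?S) + cmod (\<tau> * a 0 j) + cmod ?S"
      using norm_triangle_ineq[of "a k j - \<tau> * a 0 j - ?S" "\<tau> * a 0 j + ?S"]
        norm_triangle_ineq[of "\<tau> * a 0 j" ?S] by simp
    ultimately show ?thesis
      using loop[OF that] by (simp add: norm_mult sum.distrib)
  qed
  have "(\<Sum>j<Suc J. cmod (a k j)) \<le> (\<Sum>j<Suc J. cmod \<tau> * cmod (a 0 j)
      + (\<Sum>i<j. cmod (a (Suc k) i) * cmod (a 0 (j - 1 - i)))
      + (\<Sum>i<j. cmod (a k i) * cmod (a 1 (j - 1 - i))) + \<delta>)"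
    by (rule sum_mono) (use pt in auto)
  also have "\<dots> = cmod \<tau> * (\<Sum>j<Suc J. cmod (a 0 j))
      + (\<Sum>j<Suc J. \<Sum>i<j. cmod (a (Suc k) i) * cmod (a 0 (j - 1 - i)))
      + (\<Sum>j<Suc J. \<Sum>i<j. cmod (a k i) * cmod (a 1 (j - 1 - i))) + real (Suc J) * \<delta>"
    unfolding sum.distrib sum_distrib_left by simp
  finally show ?thesis
    using sum_convolution_le[of "\<lambda>i. cmod (a (Suc k) i)" "\<lambda>i. cmod (a 0 i)" J]
      sum_convolution_le[of "\<lambda>i. cmod (a k i)" "\<lambda>i. cmod (a 1 i)" J] by simp
qed

text \<open>The constants solve \<open>c = 1 + c/4\<close> and \<open>c' = 1 + (1/2 + 1/4) c'\<close>, where \<open>1/2\<close> and \<open>1/4\<close> are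
  the bounds on \<open>\<alpha>\<close> and \<open>\<mu>\<close>.\<close>

lemma tail_bound_step:
  fixes \<alpha> \<mu> \<eta> \<theta> \<theta>' t A A' \<alpha>' :: real
  assumes "A \<le> (4/3) * \<alpha> * \<theta> + 4 * \<eta>" "A' \<le> (4/3) * \<alpha> * \<theta>' + 4 * \<eta>" "\<theta> = t + \<theta>'"
    and "\<alpha> \<le> 1/2" "\<mu> \<le> 1/4" "0 \<le> \<alpha>" "0 \<le> \<mu>" "0 \<le> \<eta>" "0 \<le> t" "0 \<le> \<theta>'" "\<alpha> \<le> \<alpha>'"
    and "0 \<le> A" "0 \<le> A'"
  shows "t * \<alpha>' + A' * \<alpha> + A * \<mu> + \<eta> \<le> (4/3) * \<alpha>' * \<theta> + 4 * \<eta>"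
proof -
  have 1: "A' * \<alpha> \<le> ((4/3) * \<alpha>' * \<theta>' + 4 * \<eta>) * (1/2)"
  proof (rule mult_mono)
    have "(4/3) * \<alpha> * \<theta>' \<le> (4/3) * \<alpha>' * \<theta>'" using assms by (intro mult_right_mono) auto
    then show "A' \<le> (4/3) * \<alpha>' * \<theta>' + 4 * \<eta>" using assms by linarith
  qed (use assms in auto)
  have 2: "A * \<mu> \<le> ((4/3) * \<alpha>' * \<theta> + 4 * \<eta>) * (1/4)"
  proof (rule mult_mono)
    have "(4/3) * \<alpha> * \<theta> \<le> (4/3) * \<alpha>' * \<theta>" using assms by (intro mult_right_mono) auto
    then show "A \<le> (4/3) * \<alpha>' * \<theta> + 4 * \<eta>" using assms by linarith
  qed (use assms in auto)
  have 3: "0 \<le> \<alpha>' * \<theta>'" using assms by (intro mult_nonneg_nonneg) auto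
  have "(4/3) * \<alpha>' * \<theta> = (4/3) * (\<alpha>' * t) + (4/3) * (\<alpha>' * \<theta>')"
    using assms(3) by (simp add: algebra_simps)
  with 1 2 3 show ?thesis using mult.commute[of t \<alpha>'] by argo
qed

lemma two_variable_bound:
  fixes x y u v e :: real
  assumes "x \<le> u + (1/3) * y + 4 * e" "y \<le> v + (1/3) * x + 4 * e"
  shows "x + y \<le> (3/2) * (v + u) + 12 * e"
proof -
  have "(x + y) * (2/3) \<le> (u + v) + 8 * e" using assms by (simp add: field_simps)
  then show ?thesis by (simp add: field_simps)
qed

text \<open>To be read with \<open>a k j\<close> as the expected trace of Y^k X (Y X)^j,
  \<open>b\<close> as the same with the two matrices exchanged, \<open>t\<close> as the trace
  moments of the matrix rotated into Y and \<open>s\<close> as those of X. The conditions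
  \<open>a_zero\<close>, \<open>b_zero\<close> and \<open>ab_one\<close> express cyclicity of the
  trace. In this form the stability argument is about sequences only.\<close>

locale loop_system =
  fixes a b :: "nat \<Rightarrow> nat \<Rightarrow> complex" and t s :: "nat \<Rightarrow> complex" and p :: nat and \<delta> :: real
  assumes loop_a: "\<And>k j. 1 \<le> k \<Longrightarrow> k + j \<le> p \<Longrightarrow> cmod (a k j - t k * a 0 j -
      (\<Sum>i<j. a (Suc k) i * a 0 (j - 1 - i) - a k i * a 1 (j - 1 - i))) \<le> \<delta>"
    and loop_b: "\<And>k j. 1 \<le> k \<Longrightarrow> k + j \<le> p \<Longrightarrow> cmod (b k j - s k * b 0 j -
      (\<Sum>i<j. b (Suc k) i * b 0 (j - 1 - i) - b k i * b 1 (j - 1 - i))) \<le> \<delta>"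
    and a_zero: "a 0 0 = s 1" "\<And>j. a 0 (Suc j) = b 2 j"
    and b_zero: "b 0 0 = t 1" "\<And>j. b 0 (Suc j) = a 2 j"
    and ab_one: "\<And>j. b 1 j = a 1 j"
    and small_t: "(\<Sum>k = 1..p. cmod (t k)) \<le> 1/4"
    and small_s: "(\<Sum>k = 1..p. cmod (s k)) \<le> 1/4"
    and small_\<delta>: "real p * \<delta> \<le> 1/48"
    and \<delta>_nonneg: "0 \<le> \<delta>"
begin

abbreviation "SA k J \<equiv> \<Sum>j<J. cmod (a k j)"
abbreviation "SB k J \<equiv> \<Sum>j<J. cmod (b k j)"
abbreviation "tail f k \<equiv> \<Sum>l = k..p. cmod (f l)"
abbreviation "\<eta> \<equiv> real p * \<delta>"

lemma tail_eq: "k \<le> p \<Longrightarrow> tail f k = cmod (f k) + tail f (Suc k)"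
  by (simp add: sum.atLeast_Suc_atMost)

lemma SA_zero_Suc: "SA 0 (Suc J) = cmod (s 1) + SB 2 J"
  unfolding sum.lessThan_Suc_shift by (simp add: a_zero)

lemma SB_zero_Suc: "SB 0 (Suc J) = cmod (t 1) + SA 2 J"
  unfolding sum.lessThan_Suc_shift by (simp add: b_zero)

text \<open>The equation at index \<open>k\<close> feeds on index \<open>Suc k\<close> with weight
  \<open>SA 0 J\<close>, so the sources \<open>t k\<close> accumulate into tail sums; this dictates
  the shape of the bound. Length \<open>Suc J\<close> at \<open>k \<ge> 1\<close> needs length
  \<open>J\<close> at \<open>k\<close> and \<open>Suc k\<close>, while index 0 at length
  \<open>Suc J\<close> is a first trace plus index 2 of the other system at length \<open>J\<close>.
  The condition \<open>k + J \<le> Suc p\<close> keeps every equation used inside the range of the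
  locale.\<close>

lemma l1_bounds:
  assumes "J \<le> p"
  shows "SA 0 J \<le> 1/2 \<and> SB 0 J \<le> 1/2 \<and> SA 1 J \<le> 1/4 \<and>
    (\<forall>k. 1 \<le> k \<and> k + J \<le> Suc p \<longrightarrow> SA k J \<le> (4/3) * SA 0 J * tail t k + 4 * \<eta> \<and>
                            SB k J \<le> (4/3) * SB 0 J * tail s k + 4 * \<eta>)"
  using assms
proof (induction J)
  case 0
  then show ?case using \<delta>_nonneg by auto
next
  case (Suc J)
  then have IH0: "SA 0 J \<le> 1/2" "SB 0 J \<le> 1/2" "SA 1 J \<le> 1/4"
    and IH: "\<And>k. 1 \<le> k \<Longrightarrow> k + J \<le> Suc p \<Longrightarrow> SA k J \<le> (4/3) * SA 0 J * tail t k + 4 * \<eta>"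
      "\<And>k. 1 \<le> k \<Longrightarrow> k + J \<le> Suc p \<Longrightarrow> SB k J \<le> (4/3) * SB 0 J * tail s k + 4 * \<eta>"
    by auto
  have \<eta>0: "0 \<le> \<eta>" using \<delta>_nonneg by simp
  have nn: "\<And>f::nat \<Rightarrow> complex. \<And>A. 0 \<le> (\<Sum>j\<in>A. cmod (f j))" by (rule sum_nonneg) auto
  have J\<eta>: "real (Suc J) * \<delta> \<le> \<eta>" using Suc.prems \<delta>_nonneg by (intro mult_right_mono) auto
  have stepA: "SA k (Suc J) \<le> (4/3) * SA 0 (Suc J) * tail t k + 4 * \<eta>"
    if k: "1 \<le> k" "k + Suc J \<le> Suc p" for k
  proof -
    have "SA k (Suc J) \<le> cmod (t k) * SA 0 (Suc J) + SA (Suc k) J * SA 0 J + SA k J * SA 1 J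
        + real (Suc J) * \<delta>"
      by (rule loop_l1_step) (use loop_a k in auto)
    also have "\<dots> \<le> cmod (t k) * SA 0 (Suc J) + SA (Suc k) J * SA 0 J + SA k J * SA 1 J + \<eta>"
      using J\<eta> by simp
    also have "\<dots> \<le> (4/3) * SA 0 (Suc J) * tail t k + 4 * \<eta>"
      by (rule tail_bound_step[OF IH(1)[of k] IH(1)[of "Suc k"] tail_eq IH0(1,3)])
        (use k \<eta>0 nn in auto)
    finally show ?thesis .
  qed
  have b1: "SB 1 J = SA 1 J" by (simp only: ab_one)
  have stepB: "SB k (Suc J) \<le> (4/3) * SB 0 (Suc J) * tail s k + 4 * \<eta>"
    if k: "1 \<le> k" "k + Suc J \<le> Suc p" for k
  proof -
    have "SB k (Suc J) \<le> cmod (s k) * SB 0 (Suc J) + SB (Suc k) J * SB 0 J + SB k J * SB 1 J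
        + real (Suc J) * \<delta>"
      by (rule loop_l1_step) (use loop_b k in auto)
    also have "\<dots> \<le> cmod (s k) * SB 0 (Suc J) + SB (Suc k) J * SB 0 J + SB k J * SB 1 J + \<eta>"
      using J\<eta> by simp
    also have "\<dots> \<le> (4/3) * SB 0 (Suc J) * tail s k + 4 * \<eta>"
      by (rule tail_bound_step[OF IH(2)[of k] IH(2)[of "Suc k"] tail_eq IH0(2) IH0(3)[folded b1]])
        (use k \<eta>0 nn in auto)
    finally show ?thesis .
  qed
  have p1: "1 \<le> p" using Suc.prems by simp
  have t2: "tail t 1 \<le> 1/4" "tail t 1 = cmod (t 1) + tail t 2"
    and s2: "tail s 1 \<le> 1/4" "tail s 1 = cmod (s 1) + tail s 2"
    using small_t small_s tail_eq[OF p1, of t] tail_eq[OF p1, of s] by (auto simp: numeral_2_eq_2)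
  have "SA 2 J \<le> (4/3) * SA 0 J * tail t 2 + 4 * \<eta>" "SB 2 J \<le> (4/3) * SB 0 J * tail s 2 + 4 * \<eta>"
    using IH(1)[of 2] IH(2)[of 2] Suc.prems by auto
  moreover have "SA 0 J * tail t 2 \<le> (1/2) * tail t 2" "SB 0 J * tail s 2 \<le> (1/2) * tail s 2"
    by (rule mult_right_mono[OF IH0(1) nn] mult_right_mono[OF IH0(2) nn])+
  \<comment> \<open>Since \<open>4/3 * 1/2 \<le> 1\<close>, the first trace and the weighted tail
    from 2 on stay below the full tail, hence below 1/4; the error \<open>4 * \<eta>\<close> adds at
    most 1/12.\<close>
  ultimately have z: "SB 0 (Suc J) \<le> 1/2" "SA 0 (Suc J) \<le> 1/2"
    unfolding SA_zero_Suc SB_zero_Suc using t2 s2 small_\<delta> nn[of t "{2..p}"] nn[of s "{2..p}"]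
      norm_ge_zero[of "t 1"] norm_ge_zero[of "s 1"] by linarith+
  have "SA 0 (Suc J) * tail t 1 \<le> (1/2) * (1/4)"
    using z t2 nn by (intro mult_mono) auto
  moreover have "SA 1 (Suc J) \<le> (4/3) * SA 0 (Suc J) * tail t 1 + 4 * \<eta>"
    using stepA[of 1] Suc.prems by simp
  \<comment> \<open>The threshold 1/48 is used up exactly here:
    \<open>4/3 * 1/8 + 4/48 = 1/4\<close>.\<close>
  ultimately have "SA 1 (Suc J) \<le> 1/4"
    using small_\<delta> by linarith
  then show ?case using z stepA stepB by blast
qed

text \<open>The only sources are \<open>s 1\<close> and \<open>t 1\<close>: an index 0 sum starts
  with one of them and continues with an index 2 sum of the other system, which is at most
  \<open>4/3 * 1/4 = 1/3\<close> of that system's index 0 sum up to \<open>4 * \<eta>\<close>.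
  Solving this pair of inequalities gives the factor 3/2 and the error \<open>12 * \<eta>\<close>.
  Passing to index 1 costs another third, which leaves 1/2 and \<open>12/3 + 4 = 8\<close>.\<close>

theorem moment_bound:
  assumes p: "1 \<le> p"
  shows "cmod (a 1 (p - 1)) \<le> (cmod (t 1) + cmod (s 1)) / 2 + 8 * (real p * \<delta>)"
proof -
  have nn: "\<And>f::nat \<Rightarrow> complex. \<And>A. 0 \<le> (\<Sum>j\<in>A. cmod (f j))" by (rule sum_nonneg) auto
  obtain J where J: "p = Suc J" using p by (cases p) auto
  note B = l1_bounds[of p] and BJ = l1_bounds[of J]
  have t2: "tail t 1 \<le> 1/4" "tail t 2 \<le> 1/4" and s2: "tail s 1 \<le> 1/4" "tail s 2 \<le> 1/4"
    using small_t small_s tail_eq[OF p, of t] tail_eq[OF p, of s]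
      norm_ge_zero[of "t 1"] norm_ge_zero[of "s 1"] unfolding Suc_1 by linarith+
  have mono: "SA 0 J \<le> SA 0 p" "SB 0 J \<le> SB 0 p" by (auto simp: J)
  have "SA 2 J \<le> (4/3) * SA 0 J * tail t 2 + 4 * \<eta>" "SB 2 J \<le> (4/3) * SB 0 J * tail s 2 + 4 * \<eta>"
    using BJ J by auto
  moreover have "SA 0 J * tail t 2 \<le> SA 0 p * (1/4)" "SB 0 J * tail s 2 \<le> SB 0 p * (1/4)"
    by (rule mult_mono[OF mono(1) t2(2) nn nn] mult_mono[OF mono(2) s2(2) nn nn])+
  moreover have "SA 0 p = cmod (s 1) + SB 2 J" "SB 0 p = cmod (t 1) + SA 2 J"
    by (simp_all only: J SA_zero_Suc SB_zero_Suc)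
  ultimately have "SA 0 p \<le> cmod (s 1) + (1/3) * SB 0 p + 4 * \<eta>"
    "SB 0 p \<le> cmod (t 1) + (1/3) * SA 0 p + 4 * \<eta>"
    by linarith+
  then have "SA 0 p + SB 0 p \<le> (3/2) * (cmod (t 1) + cmod (s 1)) + 12 * \<eta>"
    by (rule two_variable_bound)
  moreover have "SA 1 p \<le> (4/3) * SA 0 p * tail t 1 + 4 * \<eta>" using B by simp
  moreover have "SA 0 p * tail t 1 \<le> SA 0 p * (1/4)" using t2 nn by (intro mult_left_mono) auto
  ultimately have "SA 1 p \<le> (cmod (t 1) + cmod (s 1)) / 2 + 8 * \<eta>"
    using nn[of "b 0" "{..<p}"] by linarith
  moreover have "cmod (a 1 (p - 1)) \<le> SA 1 p" using p by (intro member_le_sum) auto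
  ultimately show ?thesis by simp
qed

end

subsection \<open>Unitary matrices\<close>

abbreviation "UG \<equiv> unitary_group"

lemma unitary_iff:
  "A \<in> UG N \<longleftrightarrow> A \<in> carrier_mat N N \<and> A * mat_adjoint A = 1\<^sub>m N \<and> mat_adjoint A * A = 1\<^sub>m N"
  by (simp add: unitary_group_def)

lemma unitary_inverse:
  assumes "A \<in> UG N"
  shows "A * mat_adjoint A = 1\<^sub>m N" "mat_adjoint A * A = 1\<^sub>m N"
  using assms by (simp_all add: unitary_group_def)

lemma unitary_carrier [simp]: "A \<in> UG N \<Longrightarrow> A \<in> carrier_mat N N"
  by (simp add: unitary_group_def)

lemma unitary_dim [simp]: "A \<in> UG N \<Longrightarrow> dim_row A = N" "A \<in> UG N \<Longrightarrow> dim_col A = N"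
  using carrier_matD unitary_carrier by blast+

lemma one_unitary [simp]: "1\<^sub>m N \<in> UG N"
proof -
  have "mat_adjoint (1\<^sub>m N :: complex mat) = 1\<^sub>m N"
  proof (rule eq_matI)
    fix i j assume "i < dim_row (1\<^sub>m N :: complex mat)" "j < dim_col (1\<^sub>m N :: complex mat)"
    then show "mat_adjoint (1\<^sub>m N) $$ (i, j) = (1\<^sub>m N :: complex mat) $$ (i, j)"
      by (subst mat_adjoint_index[of _ N N]) auto
  qed (auto simp: mat_adjoint_def)
  then show ?thesis unfolding unitary_iff by (metis left_mult_one_mat one_carrier_mat)
qed

lemma unitary_pow [simp]: "A \<in> UG N \<Longrightarrow> A ^\<^sub>m k \<in> UG N"
  by (induction k) (auto simp: unitary_group_mult)

lemma unitary_mult_assoc: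
  "A \<in> UG N \<Longrightarrow> B \<in> UG N \<Longrightarrow> C \<in> UG N \<Longrightarrow> (A * B) * C = A * (B * C)"
  by (rule assoc_mult_mat) auto

lemma unitary_adjoint_cancel:
  assumes "A \<in> UG N" "B \<in> UG N"
  shows "mat_adjoint A * (A * B) = B" "A * (mat_adjoint A * B) = B"
    "(B * A) * mat_adjoint A = B" "(B * mat_adjoint A) * A = B"
proof -
  note a = unitary_group_adjoint[OF assms(1)]
  have e: "A * mat_adjoint A = 1\<^sub>m N" "mat_adjoint A * A = 1\<^sub>m N"
    using unitary_inverse[OF assms(1)] by auto
  show "mat_adjoint A * (A * B) = B" "A * (mat_adjoint A * B) = B"
    "(B * A) * mat_adjoint A = B" "(B * mat_adjoint A) * A = B"
    using assms a e
    by (simp_all add: unitary_mult_assoc[symmetric] left_mult_one_mat[of _ N N])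
      (simp_all add: unitary_mult_assoc[of _ N] right_mult_one_mat[of _ N N])
qed

lemma unitary_conj_pow:
  assumes "U \<in> UG N" "D \<in> UG N"
  shows "(U * D * mat_adjoint U) ^\<^sub>m k = U * D ^\<^sub>m k * mat_adjoint U"
proof (induction k)
  case 0
  have "U * mat_adjoint U = 1\<^sub>m N" using unitary_inverse[OF assms(1)] by simp
  then show ?case using assms by (simp add: right_mult_one_mat[of _ N N])
next
  case (Suc k)
  note a = unitary_group_adjoint[OF assms(1)]
  have "(U * D ^\<^sub>m k * mat_adjoint U) * (U * D * mat_adjoint U)
      = U * (D ^\<^sub>m k * (mat_adjoint U * (U * (D * mat_adjoint U))))"
    using assms a by (simp add: unitary_mult_assoc[of _ N] unitary_group_mult)
  also have "\<dots> = U * (D ^\<^sub>m k * D) * mat_adjoint U"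
    using assms a by (simp add: unitary_adjoint_cancel[of _ N] unitary_mult_assoc[of _ N] unitary_group_mult)
  finally show ?case using Suc by simp
qed

lemma mat_mult_index:
  fixes A B :: "complex mat"
  shows "A \<in> carrier_mat N N \<Longrightarrow> B \<in> carrier_mat N N \<Longrightarrow> i < N \<Longrightarrow> j < N \<Longrightarrow>
    (A * B) $$ (i, j) = (\<Sum>l<N. A $$ (i, l) * B $$ (l, j))"
  by (simp add: scalar_prod_def atLeast0LessThan)

lemma unitary_col_inner:
  assumes "A \<in> UG N" "i < N" "j < N"
  shows "(\<Sum>l<N. cnj (A $$ (l, i)) * A $$ (l, j)) = (if i = j then 1 else 0)"
proof -
  have "(mat_adjoint A * A) $$ (i, j) = (\<Sum>l<N. cnj (A $$ (l, i)) * A $$ (l, j))"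
    using assms by (subst mat_mult_index[of _ N])
      (auto simp: mat_adjoint_carrier mat_adjoint_index[of _ N N])
  then show ?thesis using assms unitary_inverse[OF assms(1)] by simp
qed

lemma unitaryI_rows:
  fixes A :: "complex mat"
  assumes A: "A \<in> carrier_mat N N"
    and o: "\<And>i j. i < N \<Longrightarrow> j < N \<Longrightarrow>
      (\<Sum>l<N. A $$ (i, l) * cnj (A $$ (j, l))) = (if i = j then 1 else 0)"
  shows "A \<in> UG N"
proof -
  have "A * mat_adjoint A = 1\<^sub>m N"
  proof (rule eq_matI)
    fix i j assume "i < dim_row (1\<^sub>m N :: complex mat)" "j < dim_col (1\<^sub>m N :: complex mat)"
    then show "(A * mat_adjoint A) $$ (i, j) = 1\<^sub>m N $$ (i, j)"
      using A o[of i j] by (subst mat_mult_index[of _ N])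
        (auto simp: mat_adjoint_carrier mat_adjoint_index[of _ N N])
  qed (use A in \<open>auto simp: mat_adjoint_def\<close>)
  then show ?thesis
    using A mat_mult_left_right_inverse[OF A mat_adjoint_carrier[OF A]]
    unfolding unitary_iff by blast
qed

lemma unitary_col_norm:
  assumes "A \<in> UG N" "j < N"
  shows "(\<Sum>l<N. (cmod (A $$ (l, j)))\<^sup>2) = 1"
proof -
  have "complex_of_real (\<Sum>l<N. (cmod (A $$ (l, j)))\<^sup>2) = (\<Sum>l<N. cnj (A $$ (l, j)) * A $$ (l, j))"
    by (simp add: complex_norm_square mult.commute del: of_real_power)
  also have "\<dots> = of_real 1" using unitary_col_inner[OF assms(1,2,2)] by simp
  finally show ?thesis using of_real_eq_iff by blast
qed

lemma unitary_entry_le_1: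
  assumes "A \<in> UG N" "i < N" "j < N"
  shows "cmod (A $$ (i, j)) \<le> 1"
proof -
  have "(cmod (A $$ (i, j)))\<^sup>2 \<le> (\<Sum>l<N. (cmod (A $$ (l, j)))\<^sup>2)"
    using assms by (intro member_le_sum) auto
  then have "(cmod (A $$ (i, j)))\<^sup>2 \<le> 1\<^sup>2" using unitary_col_norm[OF assms(1,3)] by simp
  then show ?thesis by (rule power2_le_imp_le) simp
qed

lemma unitary_isometry:
  assumes A: "A \<in> UG N"
  shows "(\<Sum>i<N. (cmod (\<Sum>j<N. A $$ (i, j) * u j))\<^sup>2) = (\<Sum>j<N. (cmod (u j))\<^sup>2)"
proof -
  have "complex_of_real (\<Sum>i<N. (cmod (\<Sum>j<N. A $$ (i, j) * u j))\<^sup>2)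
      = (\<Sum>i<N. \<Sum>j<N. \<Sum>k<N. (A $$ (i, j) * u j) * cnj (A $$ (i, k) * u k))"
    by (simp add: complex_norm_square sum_product del: of_real_power)
  also have "\<dots> = (\<Sum>j<N. \<Sum>k<N. \<Sum>i<N. (A $$ (i, j) * u j) * cnj (A $$ (i, k) * u k))"
    by (subst sum.swap, rule sum.cong[OF refl], subst sum.swap, rule refl)
  also have "\<dots> = (\<Sum>j<N. \<Sum>k<N. u j * cnj (u k) * (\<Sum>i<N. cnj (A $$ (i, k)) * A $$ (i, j)))"
    by (simp add: sum_distrib_left mult_ac)
  also have "\<dots> = (\<Sum>j<N. \<Sum>k<N. if k = j then u j * cnj (u k) else 0)"
    by (intro sum.cong refl) (simp add: unitary_col_inner[OF A])
  also have "\<dots> = complex_of_real (\<Sum>j<N. (cmod (u j))\<^sup>2)"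
    by (simp add: complex_norm_square del: of_real_power)
  finally show ?thesis using of_real_eq_iff by blast
qed

text \<open>Cauchy-Schwarz together with the isometry property. In \<open>householder_close\<close>
  this controls the trace of a rank one perturbation, whatever its direction.\<close>

lemma norm_sesquilinear_le:
  assumes A: "A \<in> UG N"
  shows "cmod (\<Sum>i<N. \<Sum>j<N. cnj (u i) * A $$ (i, j) * u j) \<le> (\<Sum>j<N. (cmod (u j))\<^sup>2)"
proof -
  let ?w = "\<lambda>i. \<Sum>j<N. A $$ (i, j) * u j"
  have "cmod (\<Sum>i<N. \<Sum>j<N. cnj (u i) * A $$ (i, j) * u j) = cmod (\<Sum>i<N. cnj (u i) * ?w i)"
    by (simp add: sum_distrib_left mult.assoc)
  also have "\<dots> \<le> (\<Sum>i<N. \<bar>cmod (u i)\<bar> * \<bar>cmod (?w i)\<bar>)"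
    by (rule order_trans[OF norm_sum]) (simp add: norm_mult)
  also have "\<dots> \<le> L2_set (\<lambda>i. cmod (u i)) {..<N} * L2_set (\<lambda>i. cmod (?w i)) {..<N}"
    by (rule L2_set_mult_ineq)
  also have "\<dots> = (\<Sum>j<N. (cmod (u j))\<^sup>2)"
    by (simp add: L2_set_def unitary_isometry[OF A] sum_nonneg)
  finally show ?thesis .
qed

subsection \<open>Normalised traces\<close>

lemma norm_trace_comm:
  assumes "A \<in> UG N" "B \<in> UG N"
  shows "norm_trace (A * B) = norm_trace (B * A)"
proof -
  have "(\<Sum>i<N. (A * B) $$ (i, i)) = (\<Sum>i<N. \<Sum>l<N. A $$ (i, l) * B $$ (l, i))"
    using assms by (intro sum.cong refl mat_mult_index) auto
  also have "\<dots> = (\<Sum>i<N. \<Sum>l<N. B $$ (i, l) * A $$ (l, i))"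
    by (subst sum.swap) (simp add: mult.commute)
  also have "\<dots> = (\<Sum>i<N. (B * A) $$ (i, i))"
    using assms by (intro sum.cong refl mat_mult_index[symmetric]) auto
  finally show ?thesis using assms by (simp add: norm_trace_def)
qed

lemma norm_trace_unitary_le_1:
  assumes "A \<in> UG N"
  shows "cmod (norm_trace A) \<le> 1"
proof -
  have "cmod (\<Sum>i<N. A $$ (i, i)) \<le> (\<Sum>i<N. 1)"
    using assms by (intro order_trans[OF norm_sum] sum_mono unitary_entry_le_1) auto
  then show ?thesis using assms by (auto simp: norm_trace_def norm_divide divide_le_eq)
qed

lemma measurable_norm_trace:
  assumes "f \<in> measurable M (unitary_borel N)"
  shows "(\<lambda>x. norm_trace (f x)) \<in> borel_measurable M"
proof -
  have f: "\<And>x. x \<in> space M \<Longrightarrow> f x \<in> UG N"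
    "\<And>i j. i < N \<Longrightarrow> j < N \<Longrightarrow> (\<lambda>x. f x $$ (i, j)) \<in> borel_measurable M"
    using assms by (auto simp: measurable_unitary_borel_iff)
  have "norm_trace (f x) = (\<Sum>i<N. f x $$ (i, i)) / of_nat N" if "x \<in> space M" for x
    using f(1)[OF that] by (simp add: norm_trace_def)
  then show ?thesis
    by (subst measurable_cong) (use f(2) in \<open>auto intro!: borel_measurable_divide borel_measurable_sum\<close>)
qed

lemma measurable_unitary_pow:
  assumes "f \<in> measurable M (unitary_borel N)"
  shows "(\<lambda>x. f x ^\<^sub>m k) \<in> measurable M (unitary_borel N)"
proof (induction k)
  case 0
  have "(\<lambda>x. f x ^\<^sub>m 0) \<in> measurable M (unitary_borel N) \<longleftrightarrow>
      (\<lambda>x. 1\<^sub>m N) \<in> measurable M (unitary_borel N)"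
  proof (rule measurable_cong)
    fix x assume "x \<in> space M"
    then have "f x \<in> UG N" using measurable_space[OF assms] by simp
    then show "f x ^\<^sub>m 0 = 1\<^sub>m N" by simp
  qed
  also have "\<dots>" by (rule measurable_const) simp
  finally show ?case .
next
  case (Suc k)
  then show ?case using assms by (simp add: measurable_unitary_mult)
qed

text \<open>Closeness is tested against all unitaries so that it adds up along products.\<close>

definition trace_close :: "nat \<Rightarrow> real \<Rightarrow> complex mat \<Rightarrow> complex mat \<Rightarrow> bool" where
  "trace_close N c A B \<longleftrightarrow> A \<in> UG N \<and> B \<in> UG N \<and>
     (\<forall>M \<in> UG N. cmod (norm_trace (M * A) - norm_trace (M * B)) \<le> c)"

lemma trace_close_refl: "A \<in> UG N \<Longrightarrow> trace_close N 0 A A"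
  by (simp add: trace_close_def)

text \<open>One factor is replaced at a time; cyclicity of the trace moves the unchanged factor into
  the test matrix \<open>M\<close>.\<close>

lemma trace_close_mult:
  assumes "trace_close N c A A'" "trace_close N d B B'"
  shows "trace_close N (c + d) (A * B) (A' * B')"
proof -
  have u: "A \<in> UG N" "A' \<in> UG N" "B \<in> UG N" "B' \<in> UG N"
    using assms by (auto simp: trace_close_def)
  have "cmod (norm_trace (M * (A * B)) - norm_trace (M * (A' * B'))) \<le> c + d" if M: "M \<in> UG N" for M
  proof -
    have "norm_trace (M * (C * B)) = norm_trace ((B * M) * C)" if "C \<in> UG N" for C
      using norm_trace_comm[of "M * C" N B] u M that
      by (simp add: unitary_mult_assoc[of _ N] unitary_group_mult)
    then have 1: "cmod (norm_trace (M * (A * B)) - norm_trace (M * (A' * B))) \<le> c"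
      using assms(1) u M unitary_group_mult[OF u(3) M] by (simp add: trace_close_def)
    have 2: "cmod (norm_trace (M * (A' * B)) - norm_trace (M * (A' * B'))) \<le> d"
      using assms(2) u M unitary_group_mult[OF M u(2)]
      by (simp add: trace_close_def unitary_mult_assoc[of _ N, symmetric])
    show ?thesis
      using norm_triangle_ineq[of "norm_trace (M * (A * B)) - norm_trace (M * (A' * B))"
          "norm_trace (M * (A' * B)) - norm_trace (M * (A' * B'))"] 1 2 by simp
  qed
  with u show ?thesis by (simp add: trace_close_def unitary_group_mult)
qed

lemma trace_close_pow:
  assumes "trace_close N c A B"
  shows "trace_close N (real k * c) (A ^\<^sub>m k) (B ^\<^sub>m k)"
proof (induction k)
  case 0
  have "dim_row A = N" "dim_row B = N" using assms by (auto simp: trace_close_def)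
  then show ?case using trace_close_refl[OF one_unitary] by simp
next
  case (Suc k)
  from trace_close_mult[OF this assms] show ?case by (simp add: algebra_simps)
qed

lemma trace_close_norm_trace:
  assumes "trace_close N c A B"
  shows "cmod (norm_trace A - norm_trace B) \<le> c"
  using assms one_unitary[of N] unfolding trace_close_def
  by (metis left_mult_one_mat unitary_carrier)

lemma trace_close_adjoint:
  assumes "trace_close N c A B"
  shows "trace_close N c (mat_adjoint A) (mat_adjoint B)"
proof -
  have u: "A \<in> UG N" "B \<in> UG N" using assms by (auto simp: trace_close_def)
  have tr: "norm_trace (mat_adjoint C) = cnj (norm_trace C)" if "C \<in> UG N" for C
  proof -
    have "(\<Sum>i<N. mat_adjoint C $$ (i, i)) = cnj (\<Sum>i<N. C $$ (i, i))"
      unfolding cnj_sum using that by (intro sum.cong refl mat_adjoint_index[of _ N N]) auto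
    then show ?thesis using that unitary_group_adjoint[OF that] by (simp add: norm_trace_def)
  qed
  have "norm_trace (M * mat_adjoint C) = cnj (norm_trace (mat_adjoint M * C))"
    if "M \<in> UG N" "C \<in> UG N" for M C
  proof -
    have "mat_adjoint (M * mat_adjoint C) = C * mat_adjoint M"
      using that mat_adjoint_carrier[of C N N]
      by (subst mat_adjoint_mult[of _ N N _ N]) (auto simp: mat_adjoint_adjoint[of _ N N])
    with tr[of "M * mat_adjoint C"] norm_trace_comm[of C N "mat_adjoint M"] that show ?thesis
      by (simp add: unitary_group_mult unitary_group_adjoint)
  qed
  with assms show ?thesis
    by (auto simp: trace_close_def unitary_group_adjoint simp flip: complex_cnj_diff)
qed

subsection \<open>Householder matrices\<close>

definition hvec :: "nat \<Rightarrow> complex mat \<Rightarrow> nat \<Rightarrow> complex" where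
  "hvec k A i = (if i = k then 1 else 0) - A $$ (i, k)"

text \<open>With x = e_k - A e_k this is the complex reflection 1 - x x^* / (1 - cnj A_kk). For
  unitary \<open>A\<close> it is unitary and has the same column \<open>k\<close> as
  \<open>A\<close>. If A_kk = 1, then column \<open>k\<close> of \<open>A\<close> is e_k, so x = 0,
  and the convention 0 / 0 = 0 makes the matrix the identity.\<close>

definition householder :: "nat \<Rightarrow> nat \<Rightarrow> complex mat \<Rightarrow> complex mat" where
  "householder N k A = mat N N (\<lambda>(i, j). (if i = j then 1 else 0)
     - hvec k A i * cnj (hvec k A j) / (1 - cnj (A $$ (k, k))))"

text \<open>The unit length of column \<open>k\<close> enters here. With \<beta> = 1 - A_kk, the
  identity |x|^2 = \<beta> + cnj \<beta> is what makes 1 - x x^* / cnj \<beta> unitary: it cancels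
  the quadratic term against the two linear ones.\<close>

lemma hvec_norm:
  assumes A: "A \<in> UG N" and k: "k < N"
  shows "(\<Sum>l<N. hvec k A l * cnj (hvec k A l)) = (1 - A $$ (k, k)) + (1 - cnj (A $$ (k, k)))"
proof -
  have "(\<Sum>l<N. hvec k A l * cnj (hvec k A l)) = (\<Sum>l<N. (if l = k then 1 - A $$ (k, k) - cnj (A $$ (k, k)) else 0)
      + cnj (A $$ (l, k)) * A $$ (l, k))"
    by (intro sum.cong refl) (auto simp: hvec_def algebra_simps)
  also have "\<dots> = (1 - A $$ (k, k)) + (1 - cnj (A $$ (k, k)))"
    using k unitary_col_inner[OF A k k] by (simp add: sum.distrib)
  finally show ?thesis .
qed

lemma hvec_norm_real:
  assumes A: "A \<in> UG N" and k: "k < N"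
  shows "(\<Sum>l<N. (cmod (hvec k A l))\<^sup>2) = 2 * Re (1 - A $$ (k, k))"
proof -
  have "complex_of_real (\<Sum>l<N. (cmod (hvec k A l))\<^sup>2) = complex_of_real (2 * Re (1 - A $$ (k, k)))"
    using hvec_norm[OF A k] by (simp add: complex_norm_square complex_eq_iff del: of_real_power)
  then show ?thesis using of_real_eq_iff by blast
qed

lemma householder_carrier: "householder N k A \<in> carrier_mat N N"
  by (simp add: householder_def)

lemma householder_index:
  "i < N \<Longrightarrow> j < N \<Longrightarrow> householder N k A $$ (i, j) = (if i = j then 1 else 0)
     - hvec k A i * cnj (hvec k A j) / (1 - cnj (A $$ (k, k)))"
  by (simp add: householder_def)

lemma householder_unitary:
  assumes A: "A \<in> UG N" and k: "k < N"
  shows "householder N k A \<in> UG N"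
proof (rule unitaryI_rows[OF householder_carrier])
  fix i j assume ij: "i < N" "j < N"
  let ?x = "hvec k A" and ?\<beta> = "1 - A $$ (k, k)"
  have "(\<Sum>l<N. ?x l * cnj (?x l)) = ?\<beta> + cnj ?\<beta>" using hvec_norm[OF A k] by simp
  then have c: "(\<Sum>l<N. C * (?x l * cnj (?x l))) = C * (?\<beta> + cnj ?\<beta>)" for C
    by (simp only: sum_distrib_left[symmetric])
  have "(\<Sum>l<N. householder N k A $$ (i, l) * cnj (householder N k A $$ (j, l)))
     = (\<Sum>l<N. (if l = i then (if i = j then 1 else 0) - cnj (?x j) * ?x i / ?\<beta> else 0)
         + ((if l = j then - ?x i * cnj (?x j) / cnj ?\<beta> else 0)
         + ?x i * cnj (?x j) / (?\<beta> * cnj ?\<beta>) * (?x l * cnj (?x l))))"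
    using ij by (intro sum.cong refl) (auto simp: householder_index algebra_simps)
  also have "\<dots> = (if i = j then 1 else 0) - cnj (?x j) * ?x i / ?\<beta> - ?x i * cnj (?x j) / cnj ?\<beta>
      + ?x i * cnj (?x j) / (?\<beta> * cnj ?\<beta>) * (?\<beta> + cnj ?\<beta>)"
    unfolding sum.distrib c using ij by simp
  also have "\<dots> = (if i = j then 1 else 0)"
  proof (cases "?\<beta> = 0")
    case False
    have g: "X / (b * c) * (b + c) = X / b + X / c" if "b \<noteq> 0" "c \<noteq> 0" for X b c :: complex
      using that by (simp add: field_simps)
    from False have "cnj ?\<beta> \<noteq> 0" by (simp only: complex_cnj_zero_iff not_False_eq_True)
    with False have "?x i * cnj (?x j) / (?\<beta> * cnj ?\<beta>) * (?\<beta> + cnj ?\<beta>)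
        = ?x i * cnj (?x j) / ?\<beta> + ?x i * cnj (?x j) / cnj ?\<beta>" by (rule g)
    then show ?thesis
      by (simp only: mult.commute[of "cnj (?x j)" "?x i"] diff_diff_eq diff_add_cancel)
  qed simp
  finally show "(\<Sum>l<N. householder N k A $$ (i, l) * cnj (householder N k A $$ (j, l)))
      = (if i = j then 1 else 0)" .
qed

lemma householder_col:
  assumes A: "A \<in> UG N" and k: "k < N" and i: "i < N"
  shows "householder N k A $$ (i, k) = A $$ (i, k)"
proof (cases "1 - A $$ (k, k) = 0")
  case True
  then have "(\<Sum>l<N. (cmod (hvec k A l))\<^sup>2) = 0" using hvec_norm_real[OF A k] by simp
  then have "hvec k A i = 0" using i by (simp add: sum_nonneg_eq_0_iff)
  then show ?thesis using i k by (auto simp: householder_index hvec_def)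
next
  case False
  then have "cnj (1 - A $$ (k, k)) \<noteq> 0" by (simp only: complex_cnj_zero_iff not_False_eq_True)
  then show ?thesis using i k by (auto simp: householder_index hvec_def)
qed

text \<open>With \<beta> = 1 - A_kk, the unnormalised trace changes by x^* M x / cnj \<beta> up to
  sign, and |x^* M x| \<le> |x|^2 = 2 Re \<beta> \<le> 2 |\<beta>|. The denominator cancels, so the
  bound does not deteriorate when \<beta> is close to 0.\<close>

lemma householder_close:
  assumes A: "A \<in> UG N" and k: "k < N"
  shows "trace_close N (2 / real N) (householder N k A) (1\<^sub>m N)"
proof -
  let ?x = "hvec k A" and ?\<beta> = "1 - A $$ (k, k)" and ?R = "householder N k A"
  have R: "?R \<in> UG N" by (rule householder_unitary[OF A k])
  have "cmod (norm_trace (M * ?R) - norm_trace (M * 1\<^sub>m N)) \<le> 2 / real N" if M: "M \<in> UG N" for M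
  proof -
    let ?S = "\<Sum>i<N. \<Sum>j<N. cnj (?x i) * M $$ (i, j) * ?x j"
    have d: "(M * ?R) $$ (i, i) = M $$ (i, i) - (\<Sum>j<N. cnj (?x i) * M $$ (i, j) * ?x j) / cnj ?\<beta>"
      if i: "i < N" for i
    proof -
      have "(M * ?R) $$ (i, i) = (\<Sum>j<N. M $$ (i, j) * ?R $$ (j, i))"
        using M R i by (intro mat_mult_index) auto
      also have "\<dots> = (\<Sum>j<N. (if j = i then M $$ (i, i) else 0)
          - cnj (?x i) * M $$ (i, j) * ?x j / cnj ?\<beta>)"
        using i by (intro sum.cong refl) (auto simp: householder_index algebra_simps)
      finally show ?thesis using i by (simp add: sum_subtractf sum_divide_distrib)
    qed
    have "norm_trace (M * ?R) = (\<Sum>i<N. (M * ?R) $$ (i, i)) / of_nat N"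
      by (simp only: norm_trace_def unitary_dim(1)[OF unitary_group_mult[OF M R]])
    also have "(\<Sum>i<N. (M * ?R) $$ (i, i)) = (\<Sum>i<N. M $$ (i, i)) - ?S / cnj ?\<beta>"
      unfolding sum_divide_distrib[of "\<lambda>i. \<Sum>j<N. cnj (?x i) * M $$ (i, j) * ?x j"] sum_subtractf[symmetric]
      by (intro sum.cong refl d) simp
    finally have "norm_trace (M * ?R) = ((\<Sum>i<N. M $$ (i, i)) - ?S / cnj ?\<beta>) / of_nat N" .
    moreover have "norm_trace (M * 1\<^sub>m N) = (\<Sum>i<N. M $$ (i, i)) / of_nat N"
      using M by (simp add: norm_trace_def right_mult_one_mat[of _ N N])
    ultimately have e: "norm_trace (M * ?R) - norm_trace (M * 1\<^sub>m N) = - (?S / cnj ?\<beta>) / of_nat N"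
      by (simp add: diff_divide_distrib)
    have "cmod ?S \<le> 2 * Re ?\<beta>"
      using norm_sesquilinear_le[OF M, of ?x] hvec_norm_real[OF A k] by simp
    also have "\<dots> \<le> 2 * cmod ?\<beta>" by (simp only: complex_Re_le_cmod mult_le_cancel_left) simp
    finally have "cmod (?S / cnj ?\<beta>) \<le> 2"
      unfolding norm_divide complex_mod_cnj by (cases "cmod ?\<beta> = 0") (auto simp: divide_le_eq)
    moreover have "cmod (norm_trace (M * ?R) - norm_trace (M * 1\<^sub>m N)) = cmod (?S / cnj ?\<beta>) / real N"
      by (simp only: e norm_divide norm_minus_cancel norm_of_nat)
    ultimately show ?thesis by (simp only: divide_right_mono of_nat_0_le_iff)
  qed
  with R show ?thesis by (simp add: trace_close_def)
qed

text \<open>The stabiliser of the first \<open>k\<close> basis vectors, a copy of U(N - k). These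
  subgroups decrease from the whole group at \<open>k = 0\<close> to the trivial group at
  \<open>k = N\<close> and provide the filtration for the martingale argument.\<close>

definition stab :: "nat \<Rightarrow> nat \<Rightarrow> complex mat set" where
  "stab N k = {A \<in> UG N. \<forall>i<k. \<forall>j<N. A $$ (j, i) = (if j = i then 1 else 0)}"

lemma stab_unitary: "A \<in> stab N k \<Longrightarrow> A \<in> UG N"
  by (simp add: stab_def)

lemma stab_index: "A \<in> stab N k \<Longrightarrow> i < k \<Longrightarrow> j < N \<Longrightarrow> A $$ (j, i) = (if j = i then 1 else 0)"
  by (simp add: stab_def)

lemma stab_mono: "A \<in> stab N (Suc k) \<Longrightarrow> A \<in> stab N k"
  by (simp add: stab_def)

lemma stab_zero: "stab N 0 = UG N"
  by (auto simp: stab_def)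

lemma stab_full: "A \<in> stab N N \<Longrightarrow> A = 1\<^sub>m N"
  by (rule eq_matI) (auto simp: stab_index stab_unitary[THEN unitary_dim(1)] stab_unitary[THEN unitary_dim(2)])

lemma stab_adjoint:
  assumes A: "A \<in> stab N k" and k: "k \<le> N"
  shows "mat_adjoint A \<in> stab N k"
proof -
  note u = stab_unitary[OF A]
  have "mat_adjoint A $$ (j, i) = (if j = i then 1 else 0)" if "i < k" "j < N" for i j
  proof -
    have "(if j = i then 1 else 0) = (\<Sum>l<N. cnj (A $$ (l, j)) * A $$ (l, i))"
      using unitary_col_inner[OF u, of j i] that k by auto
    also have "\<dots> = (\<Sum>l<N. if l = i then cnj (A $$ (i, j)) else 0)"
      using that A by (intro sum.cong refl) (auto simp: stab_index)
    also have "\<dots> = mat_adjoint A $$ (j, i)"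
      using that k u by (simp add: mat_adjoint_index[of A N N])
    finally show ?thesis by simp
  qed
  then show ?thesis using unitary_group_adjoint[OF u] by (simp add: stab_def)
qed

lemma stab_mult:
  assumes A: "A \<in> stab N k" and B: "B \<in> stab N k" and k: "k \<le> N"
  shows "A * B \<in> stab N k"
proof -
  note u = stab_unitary[OF A] stab_unitary[OF B]
  have "(A * B) $$ (j, i) = (if j = i then 1 else 0)" if "i < k" "j < N" for i j
  proof -
    have "(A * B) $$ (j, i) = (\<Sum>l<N. A $$ (j, l) * B $$ (l, i))"
      using u that k by (intro mat_mult_index) auto
    also have "\<dots> = (\<Sum>l<N. if l = i then A $$ (j, i) else 0)"
      using that B by (intro sum.cong refl) (auto simp: stab_index)
    finally show ?thesis using that k A by (simp add: stab_index)
  qed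
  then show ?thesis using unitary_group_mult[OF u] by (simp add: stab_def)
qed

text \<open>Since the adjoint of \<open>A\<close> lies in the same stabiliser, the rows of
  \<open>A\<close> with index below \<open>k\<close> are basis vectors too. Hence column
  \<open>k\<close> vanishes there, and so does the reflection vector.\<close>

lemma householder_stab:
  assumes A: "A \<in> stab N k" and k: "k < N"
  shows "householder N k A \<in> stab N k"
proof -
  note u = stab_unitary[OF A]
  have h: "hvec k A i = 0" if "i < k" for i
  proof -
    have "cnj (A $$ (i, k)) = mat_adjoint A $$ (k, i)"
      using that k u by (simp add: mat_adjoint_index[of A N N])
    also have "\<dots> = 0" using stab_index[OF stab_adjoint[OF A]] that k by auto
    finally show ?thesis using that by (simp add: hvec_def)
  qed
  have "householder N k A $$ (j, i) = (if j = i then 1 else 0)" if "i < k" "j < N" for i j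
    using that k h by (simp add: householder_index)
  then show ?thesis using householder_unitary[OF u k] by (simp add: stab_def)
qed

lemma measurable_householder:
  assumes f: "f \<in> measurable M (unitary_borel N)" and k: "k < N"
  shows "(\<lambda>x. householder N k (f x)) \<in> measurable M (unitary_borel N)"
proof -
  have m: "\<And>i j. i < N \<Longrightarrow> j < N \<Longrightarrow> (\<lambda>x. f x $$ (i, j)) \<in> borel_measurable M"
    and s: "\<And>x. x \<in> space M \<Longrightarrow> f x \<in> UG N"
    using f unfolding measurable_unitary_borel_iff by auto
  have c: "(\<lambda>x. cnj (g x)) \<in> borel_measurable M" if "g \<in> borel_measurable M" for g :: "_ \<Rightarrow> complex"
    by (rule measurable_compose[OF that])
      (intro borel_measurable_continuous_onI continuous_intros)
  have "(\<lambda>x. householder N k (f x) $$ (i, j)) \<in> borel_measurable M" if "i < N" "j < N" for i j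
    unfolding householder_index[OF that] hvec_def
    by (intro borel_measurable_diff borel_measurable_divide borel_measurable_times c
        borel_measurable_const m that k)
  then show ?thesis
    unfolding measurable_unitary_borel_iff using householder_unitary[OF s k] by auto
qed

subsection \<open>Reducing a unitary column by column\<close>

text \<open>Householder reduction of \<open>U\<close> to the identity. For Z the current matrix, the
  new factor has column \<open>k\<close> equal to Z^* e_k, so its product with Z fixes e_k. The
  factors are put on the right so that left translations of \<open>U\<close> pass through, see
  \<open>reduced_equivariant\<close>.\<close>

fun reduced :: "nat \<Rightarrow> nat \<Rightarrow> complex mat \<Rightarrow> complex mat" where
  "reduced N 0 U = U"
| "reduced N (Suc k) U = reduced N k U * householder N k (mat_adjoint (reduced N k U))"

lemma reduced_stab:
  assumes U: "U \<in> UG N"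
  shows "k \<le> N \<Longrightarrow> reduced N k U \<in> stab N k"
proof (induction k)
  case 0
  then show ?case using U by (simp add: stab_zero)
next
  case (Suc k)
  let ?Z = "reduced N k U"
  let ?R = "householder N k (mat_adjoint ?Z)"
  have k: "k < N" "k \<le> N" using Suc.prems by auto
  have Z: "?Z \<in> stab N k" using Suc by simp
  have a: "mat_adjoint ?Z \<in> stab N k" by (rule stab_adjoint[OF Z k(2)])
  have R: "?R \<in> stab N k" by (rule householder_stab[OF a k(1)])
  note u = stab_unitary[OF Z] stab_unitary[OF a] stab_unitary[OF R]
  have ZR: "?Z * ?R \<in> stab N k" by (rule stab_mult[OF Z R k(2)])
  have "(?Z * ?R) $$ (j, k) = (if j = k then 1 else 0)" if j: "j < N" for j
  proof -
    have "(?Z * ?R) $$ (j, k) = (\<Sum>l<N. ?Z $$ (j, l) * ?R $$ (l, k))"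
      using u j k by (intro mat_mult_index) auto
    also have "\<dots> = (\<Sum>l<N. ?Z $$ (j, l) * mat_adjoint ?Z $$ (l, k))"
      using u k by (intro sum.cong refl) (simp add: householder_col)
    also have "\<dots> = (?Z * mat_adjoint ?Z) $$ (j, k)"
      using u j k by (intro mat_mult_index[symmetric]) auto
    also have "\<dots> = (if j = k then 1 else 0)"
      using unitary_inverse(1)[OF u(1)] j k by simp
    finally show ?thesis .
  qed
  then show ?case using ZR by (auto simp: stab_def less_Suc_eq)
qed

text \<open>The factor with index i depends only on Z^* e_i, and (s Z)^* e_i = Z^* s^* e_i = Z^* e_i
  as long as \<open>s\<close> fixes e_i. None of the first \<open>k\<close> factors therefore
  notices \<open>s\<close>. This is how left invariance of Haar measure passes to the law of
  \<open>reduced N k\<close> on the stabiliser.\<close>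

lemma reduced_equivariant:
  assumes U: "U \<in> UG N" and s: "s \<in> stab N k" and k: "k \<le> N"
  shows "reduced N k (s * U) = s * reduced N k U"
  using s k
proof (induction k)
  case (Suc k)
  let ?Z = "reduced N k U"
  have k: "k < N" "k \<le> N" using Suc.prems by auto
  have IH: "reduced N k (s * U) = s * ?Z" using Suc stab_mono by auto
  note su = stab_unitary[OF Suc.prems(1)]
  have Zu: "?Z \<in> UG N" using reduced_stab[OF U k(2)] stab_unitary by blast
  note au = unitary_group_adjoint[OF Zu] unitary_group_adjoint[OF su]
  have adj: "mat_adjoint (s * ?Z) = mat_adjoint ?Z * mat_adjoint s"
    using su Zu by (intro mat_adjoint_mult) auto
  have "mat_adjoint (s * ?Z) $$ (i, k) = mat_adjoint ?Z $$ (i, k)" if i: "i < N" for i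
  proof -
    have "mat_adjoint (s * ?Z) $$ (i, k) = (\<Sum>l<N. mat_adjoint ?Z $$ (i, l) * mat_adjoint s $$ (l, k))"
      unfolding adj using au i k by (intro mat_mult_index) auto
    also have "\<dots> = (\<Sum>l<N. if l = k then mat_adjoint ?Z $$ (i, k) else 0)"
      using stab_index[OF stab_adjoint[OF Suc.prems], of k] by (intro sum.cong refl) auto
    finally show ?thesis using k by simp
  qed
  then have "householder N k (mat_adjoint (s * ?Z)) = householder N k (mat_adjoint ?Z)"
    using k by (intro eq_matI) (auto simp: householder_def hvec_def)
  then show ?case
    using IH su Zu householder_unitary[OF au(1) k(1)] by (simp add: unitary_mult_assoc[of _ N])
qed simp

lemma measurable_reduced:
  assumes f: "f \<in> measurable M (unitary_borel N)"
  shows "k \<le> N \<Longrightarrow> (\<lambda>x. reduced N k (f x)) \<in> measurable M (unitary_borel N)"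
proof (induction k)
  case (Suc k)
  then show ?case
    by (simp add: measurable_unitary_mult measurable_householder measurable_unitary_adjoint)
qed (simp add: f)

subsection \<open>Haar measure and the variance of trace functions\<close>

locale haar = prob_space H for H :: "complex mat measure" +
  fixes N :: nat
  assumes haar: "haar_unitary N H"
begin

lemma sets_H [measurable_cong]: "sets H = sets (unitary_borel N)"
  using haar by (simp add: haar_unitary_def)

lemma space_H: "space H = UG N"
  using sets_eq_imp_space_eq[OF sets_H] by simp

lemma measurable_H: "measurable H M = measurable (unitary_borel N) M"
  by (rule measurable_cong_sets[OF sets_H refl])

text \<open>A class of functions that are integrable for the probability measure \<open>H\<close>
  and closed under the operations needed, so integrability follows from the form of an
  expression.\<close>

definition bounded_fun :: "(complex mat \<Rightarrow> complex) \<Rightarrow> bool" where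
  "bounded_fun f \<longleftrightarrow> f \<in> borel_measurable (unitary_borel N) \<and> (\<exists>B. \<forall>U \<in> UG N. cmod (f U) \<le> B)"

lemma bounded_fun_integrable:
  assumes "bounded_fun f" shows "integrable H f"
proof -
  obtain B where "\<And>U. U \<in> UG N \<Longrightarrow> cmod (f U) \<le> B" using assms by (auto simp: bounded_fun_def)
  then show ?thesis
    using assms by (intro integrable_const_bound[of _ B] AE_I2) (auto simp: bounded_fun_def measurable_H space_H)
qed

lemma bounded_fun_const: "bounded_fun (\<lambda>_. c)"
  by (auto simp: bounded_fun_def)

lemma bounded_fun_mult:
  assumes "bounded_fun f" "bounded_fun g" shows "bounded_fun (\<lambda>U. f U * g U)"
proof -
  obtain A B where "\<And>U. U \<in> UG N \<Longrightarrow> cmod (f U) \<le> A" "\<And>U. U \<in> UG N \<Longrightarrow> cmod (g U) \<le> B"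
    using assms by (auto simp: bounded_fun_def)
  then have "cmod (f U * g U) \<le> A * B" if "U \<in> UG N" for U
    unfolding norm_mult using that by (intro mult_mono) (auto intro: order_trans[OF norm_ge_zero])
  then show ?thesis using assms by (auto simp: bounded_fun_def intro!: borel_measurable_times)
qed

lemma bounded_fun_add:
  assumes "bounded_fun f" "bounded_fun g" shows "bounded_fun (\<lambda>U. f U + g U)"
proof -
  obtain A B where "\<And>U. U \<in> UG N \<Longrightarrow> cmod (f U) \<le> A" "\<And>U. U \<in> UG N \<Longrightarrow> cmod (g U) \<le> B"
    using assms by (auto simp: bounded_fun_def)
  then have "cmod (f U + g U) \<le> A + B" if "U \<in> UG N" for U
    using that by (intro norm_triangle_mono) auto
  then show ?thesis using assms by (auto simp: bounded_fun_def intro!: borel_measurable_add)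
qed

lemma bounded_fun_diff:
  assumes "bounded_fun f" "bounded_fun g" shows "bounded_fun (\<lambda>U. f U - g U)"
  using bounded_fun_add[OF assms(1) bounded_fun_mult[OF bounded_fun_const[of "-1"] assms(2)]] by simp

lemma bounded_fun_sum: "(\<And>i. i \<in> I \<Longrightarrow> bounded_fun (f i)) \<Longrightarrow> bounded_fun (\<lambda>U. \<Sum>i\<in>I. f i U)"
  by (induction I rule: infinite_finite_induct) (auto intro: bounded_fun_const bounded_fun_add)

lemma bounded_fun_cnj:
  assumes "bounded_fun f" shows "bounded_fun (\<lambda>U. cnj (f U))"
proof -
  have m: "f \<in> borel_measurable (unitary_borel N)" using assms by (simp add: bounded_fun_def)
  have "(\<lambda>U. cnj (f U)) \<in> borel_measurable (unitary_borel N)"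
    by (rule measurable_compose[OF m]) (intro borel_measurable_continuous_onI continuous_intros)
  then show ?thesis using assms by (simp add: bounded_fun_def)
qed

lemma bounded_fun_comp:
  assumes "bounded_fun f" "g \<in> measurable (unitary_borel N) (unitary_borel N)"
  shows "bounded_fun (\<lambda>U. f (g U))"
  using assms measurable_space[OF assms(2)] by (fastforce simp: bounded_fun_def)

lemma measurable_left: "G \<in> UG N \<Longrightarrow> (\<lambda>A. G * A) \<in> measurable (unitary_borel N) (unitary_borel N)"
  by (rule measurable_unitary_mult) auto

lemma measurable_right: "G \<in> UG N \<Longrightarrow> (\<lambda>A. A * G) \<in> measurable (unitary_borel N) (unitary_borel N)"
  by (rule measurable_unitary_mult) auto

lemma left_invariant:
  fixes f :: "complex mat \<Rightarrow> complex"
  assumes G: "G \<in> UG N" and f: "bounded_fun f"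
  shows "(\<integral>A. f (G * A) \<partial>H) = (\<integral>A. f A \<partial>H)"
proof -
  have "(\<integral>A. f A \<partial>H) = (\<integral>A. f A \<partial>(distr H (unitary_borel N) (\<lambda>A. G * A)))"
    using haar G by (simp add: haar_unitary_def)
  also have "\<dots> = (\<integral>A. f (G * A) \<partial>H)"
    by (rule integral_distr) (use f measurable_left[OF G] in \<open>auto simp: bounded_fun_def measurable_H\<close>)
  finally show ?thesis by simp
qed

lemma Fubini_bounded:
  fixes f :: "complex mat \<Rightarrow> complex mat \<Rightarrow> complex"
  assumes m: "(\<lambda>(U, V). f U V) \<in> borel_measurable (unitary_borel N \<Otimes>\<^sub>M unitary_borel N)"
    and b: "\<And>U V. U \<in> UG N \<Longrightarrow> V \<in> UG N \<Longrightarrow> cmod (f U V) \<le> B"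
  shows "(\<integral>U. (\<integral>V. f U V \<partial>H) \<partial>H) = (\<integral>V. (\<integral>U. f U V \<partial>H) \<partial>H)"
proof -
  interpret P: pair_prob_space H H ..
  have "sets (H \<Otimes>\<^sub>M H) = sets (unitary_borel N \<Otimes>\<^sub>M unitary_borel N)"
    by (intro sets_pair_measure_cong sets_H)
  then have "(\<lambda>(U, V). f U V) \<in> borel_measurable (H \<Otimes>\<^sub>M H)"
    using m measurable_cong_sets by blast
  moreover have "AE x in H \<Otimes>\<^sub>M H. cmod (case x of (U, V) \<Rightarrow> f U V) \<le> B"
    by (rule AE_I2) (auto simp: space_pair_measure space_H b)
  ultimately have "integrable (H \<Otimes>\<^sub>M H) (\<lambda>(U, V). f U V)"
    by (intro P.P.integrable_const_bound[of _ B])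
  then show ?thesis by (rule P.Fubini_integral[symmetric])
qed

lemma bounded_fun_compose:
  assumes f: "bounded_fun f" and g: "g \<in> measurable M (unitary_borel N)"
  shows "(\<lambda>x. f (g x)) \<in> borel_measurable M"
  using f g unfolding bounded_fun_def by (auto intro: measurable_compose)

lemma bounded_fun_bound: "bounded_fun f \<Longrightarrow> \<exists>B. \<forall>U \<in> UG N. cmod (f U) \<le> B"
  by (simp add: bounded_fun_def)

text \<open>Left invariance of \<open>H\<close> and right invariance of its image under inversion identify the two:
  integrate \<open>f (U\<^sup>* V)\<close> in both orders.\<close>

lemma inverse_invariant:
  assumes f: "bounded_fun f"
  shows "(\<integral>A. f (mat_adjoint A) \<partial>H) = (\<integral>A. f A \<partial>H)"
proof -
  obtain B where B: "\<And>U. U \<in> UG N \<Longrightarrow> cmod (f U) \<le> B" using bounded_fun_bound[OF f] by auto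
  have fa: "bounded_fun (\<lambda>A. f (mat_adjoint A))"
    by (rule bounded_fun_comp[OF f measurable_unitary_adjoint]) simp
  have "(\<integral>A. f A \<partial>H) = (\<integral>U. (\<integral>V. f (mat_adjoint U * V) \<partial>H) \<partial>H)"
  proof -
    have "(\<integral>U. (\<integral>V. f (mat_adjoint U * V) \<partial>H) \<partial>H) = (\<integral>U. (\<integral>V. f V \<partial>H) \<partial>H)"
      by (rule Bochner_Integration.integral_cong)
        (auto simp: space_H intro: left_invariant[OF unitary_group_adjoint f])
    then show ?thesis by (simp add: prob_space)
  qed
  also have "\<dots> = (\<integral>V. (\<integral>U. f (mat_adjoint U * V) \<partial>H) \<partial>H)"
  proof (rule Fubini_bounded)
    have "(\<lambda>x. f (mat_adjoint (fst x) * snd x)) \<in> borel_measurable (unitary_borel N \<Otimes>\<^sub>M unitary_borel N)"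
      by (rule bounded_fun_compose[OF f measurable_unitary_mult[OF measurable_unitary_adjoint]]) auto
    then show "(\<lambda>(U, V). f (mat_adjoint U * V)) \<in> borel_measurable (unitary_borel N \<Otimes>\<^sub>M unitary_borel N)"
      by (simp add: case_prod_beta)
    show "\<And>U V. U \<in> UG N \<Longrightarrow> V \<in> UG N \<Longrightarrow> cmod (f (mat_adjoint U * V)) \<le> B"
      by (intro B unitary_group_mult unitary_group_adjoint)
  qed
  also have "\<dots> = (\<integral>V. (\<integral>U. f (mat_adjoint U) \<partial>H) \<partial>H)"
  proof (rule Bochner_Integration.integral_cong)
    fix V assume "V \<in> space H"
    then have V: "V \<in> UG N" by (simp add: space_H)
    have "(\<integral>U. f (mat_adjoint U * V) \<partial>H) = (\<integral>U. f (mat_adjoint (mat_adjoint V * U)) \<partial>H)"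
    proof (rule Bochner_Integration.integral_cong)
      fix U assume "U \<in> space H"
      then have U: "U \<in> UG N" by (simp add: space_H)
      have "mat_adjoint (mat_adjoint V * U) = mat_adjoint U * mat_adjoint (mat_adjoint V)"
        by (rule mat_adjoint_mult[of _ N N _ N]) (use U V unitary_group_adjoint in auto)
      then show "f (mat_adjoint U * V) = f (mat_adjoint (mat_adjoint V * U))"
        using mat_adjoint_adjoint[of V N N] V by simp
    qed simp
    also have "\<dots> = (\<integral>U. f (mat_adjoint U) \<partial>H)"
      by (rule left_invariant[OF unitary_group_adjoint[OF V] fa])
    finally show "(\<integral>U. f (mat_adjoint U * V) \<partial>H) = (\<integral>U. f (mat_adjoint U) \<partial>H)" .
  qed simp
  finally show ?thesis by (simp add: prob_space)
qed

text \<open>Inversion preserves \<open>H\<close> and carries right translations to left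
  translations.\<close>

lemma right_invariant:
  assumes G: "G \<in> UG N" and f: "bounded_fun f"
  shows "(\<integral>A. f (A * G) \<partial>H) = (\<integral>A. f A \<partial>H)"
proof -
  have fa: "bounded_fun (\<lambda>A. f (mat_adjoint A))"
    by (rule bounded_fun_comp[OF f measurable_unitary_adjoint]) simp
  have "(\<integral>A. f (A * G) \<partial>H) = (\<integral>A. f (mat_adjoint A * G) \<partial>H)"
    by (rule inverse_invariant[symmetric]) (rule bounded_fun_comp[OF f measurable_right[OF G]])
  also have "\<dots> = (\<integral>A. f (mat_adjoint (mat_adjoint G * A)) \<partial>H)"
  proof (rule Bochner_Integration.integral_cong)
    fix U assume "U \<in> space H"
    then have U: "U \<in> UG N" by (simp add: space_H)
    have "mat_adjoint (mat_adjoint G * U) = mat_adjoint U * mat_adjoint (mat_adjoint G)"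
      by (rule mat_adjoint_mult[of _ N N _ N]) (use U G unitary_group_adjoint in auto)
    then show "f (mat_adjoint U * G) = f (mat_adjoint (mat_adjoint G * U))"
      using mat_adjoint_adjoint[of G N N] G by simp
  qed simp
  also have "\<dots> = (\<integral>A. f (mat_adjoint A) \<partial>H)"
    by (rule left_invariant[OF unitary_group_adjoint[OF G] fa])
  also have "\<dots> = (\<integral>A. f A \<partial>H)" by (rule inverse_invariant[OF f])
  finally show ?thesis .
qed

text \<open>\<open>reduced N k\<close> maps \<open>H\<close> to the Haar measure of the stabiliser of the first \<open>k\<close> basis vectors,
  so \<open>avg k\<close> is the projection onto the functions invariant under right translation by it.\<close>

definition avg :: "nat \<Rightarrow> (complex mat \<Rightarrow> complex) \<Rightarrow> complex mat \<Rightarrow> complex" where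
  "avg k f U = (\<integral>G. f (U * reduced N k G) \<partial>H)"

lemma reduced_unitary: "G \<in> UG N \<Longrightarrow> k \<le> N \<Longrightarrow> reduced N k G \<in> UG N"
  using reduced_stab stab_unitary by blast

lemma bounded_fun_reduced:
  assumes f: "bounded_fun f" and U: "U \<in> UG N" and k: "k \<le> N"
  shows "bounded_fun (\<lambda>G. f (U * reduced N k G))"
  by (rule bounded_fun_comp[OF bounded_fun_comp[OF f measurable_left[OF U]]]) (rule measurable_reduced[OF _ k], simp)

lemma norm_integral_le:
  assumes "bounded_fun f" and b: "\<And>U. U \<in> UG N \<Longrightarrow> cmod (f U) \<le> c"
  shows "cmod (\<integral>U. f U \<partial>H) \<le> c"
proof -
  have "cmod (\<integral>U. f U \<partial>H) \<le> (\<integral>U. cmod (f U) \<partial>H)" by (rule integral_norm_bound)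
  also have "\<dots> \<le> (\<integral>U. c \<partial>H)"
    using bounded_fun_integrable[OF assms(1)] b by (intro integral_mono) (auto simp: space_H)
  finally show ?thesis by (simp add: prob_space)
qed

lemma avg_bounded_fun:
  assumes f: "bounded_fun f" and k: "k \<le> N"
  shows "bounded_fun (avg k f)"
proof -
  obtain B where B: "\<And>U. U \<in> UG N \<Longrightarrow> cmod (f U) \<le> B" using bounded_fun_bound[OF f] by auto
  have e: "sets (unitary_borel N \<Otimes>\<^sub>M H) = sets (unitary_borel N \<Otimes>\<^sub>M unitary_borel N)"
    by (intro sets_pair_measure_cong sets_H refl)
  have "(\<lambda>x. f (fst x * reduced N k (snd x))) \<in> borel_measurable (unitary_borel N \<Otimes>\<^sub>M unitary_borel N)"
    by (rule bounded_fun_compose[OF f measurable_unitary_mult[OF _ measurable_reduced[OF _ k]]]) auto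
  then have "(\<lambda>(U, G). f (U * reduced N k G)) \<in> borel_measurable (unitary_borel N \<Otimes>\<^sub>M H)"
    using measurable_cong_sets[OF e refl] by (simp add: case_prod_beta)
  then have "(\<lambda>U. \<integral>G. f (U * reduced N k G) \<partial>H) \<in> borel_measurable (unitary_borel N)"
    by (rule borel_measurable_lebesgue_integral)
  moreover have "cmod (avg k f U) \<le> B" if "U \<in> UG N" for U
    unfolding avg_def
    by (rule norm_integral_le[OF bounded_fun_reduced[OF f that k]])
      (intro B unitary_group_mult that reduced_unitary k)
  ultimately show ?thesis unfolding bounded_fun_def avg_def by blast
qed

lemma avg_full: "U \<in> UG N \<Longrightarrow> avg N f U = f U"
proof -
  assume U: "U \<in> UG N"
  have "avg N f U = (\<integral>G. f U \<partial>H)"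
    unfolding avg_def
  proof (rule Bochner_Integration.integral_cong)
    fix G assume "G \<in> space H"
    then have "reduced N N G = 1\<^sub>m N" by (intro stab_full reduced_stab) (auto simp: space_H)
    then show "f (U * reduced N N G) = f U" using U by (simp add: right_mult_one_mat[of _ N N])
  qed simp
  then show ?thesis by (simp add: prob_space)
qed

lemma avg_zero: "bounded_fun f \<Longrightarrow> U \<in> UG N \<Longrightarrow> avg 0 f U = (\<integral>A. f A \<partial>H)"
  by (simp add: avg_def left_invariant)

text \<open>By equivariance \<open>s * reduced N k G = reduced N k (s * G)\<close>, so
  \<open>s\<close> merges with the integration variable and left invariance removes it.\<close>

lemma avg_right_invariant:
  assumes f: "bounded_fun f" and k: "k \<le> N" and U: "U \<in> UG N" and s: "s \<in> stab N k"
  shows "avg k f (U * s) = avg k f U"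
proof -
  note su = stab_unitary[OF s]
  have "avg k f (U * s) = (\<integral>G. f (U * reduced N k (s * G)) \<partial>H)"
    unfolding avg_def
  proof (rule Bochner_Integration.integral_cong)
    fix G assume "G \<in> space H"
    then have G: "G \<in> UG N" by (simp add: space_H)
    show "f (U * s * reduced N k G) = f (U * reduced N k (s * G))"
      using U su G s k reduced_unitary[OF G k]
      by (simp add: reduced_equivariant unitary_mult_assoc[of _ N])
  qed simp
  also have "\<dots> = avg k f U"
    unfolding avg_def by (rule left_invariant[OF su bounded_fun_reduced[OF f U k]])
  finally show ?thesis .
qed

text \<open>This is the characteristic property of a conditional expectation, with \<open>g\<close>
  as test function. After exchanging the integrals, translate \<open>U\<close> by
  \<open>reduced N k G\<close>: neither \<open>H\<close> nor \<open>g\<close> changes.\<close>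

lemma avg_orthogonal:
  assumes f: "bounded_fun f" and k: "k \<le> N" and g: "bounded_fun g"
    and inv: "\<And>U s. U \<in> UG N \<Longrightarrow> s \<in> stab N k \<Longrightarrow> g (U * s) = g U"
  shows "(\<integral>U. avg k f U * g U \<partial>H) = (\<integral>U. f U * g U \<partial>H)"
proof -
  obtain B B' where B: "\<And>U. U \<in> UG N \<Longrightarrow> cmod (f U) \<le> B" "\<And>U. U \<in> UG N \<Longrightarrow> cmod (g U) \<le> B'"
    using bounded_fun_bound[OF f] bounded_fun_bound[OF g] by auto
  have "(\<integral>U. avg k f U * g U \<partial>H) = (\<integral>U. (\<integral>G. f (U * reduced N k G) * g U \<partial>H) \<partial>H)"
    by (simp add: avg_def)
  also have "\<dots> = (\<integral>G. (\<integral>U. f (U * reduced N k G) * g U \<partial>H) \<partial>H)"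
  proof (rule Fubini_bounded)
    have "(\<lambda>x. f (fst x * reduced N k (snd x)) * g (fst x))
        \<in> borel_measurable (unitary_borel N \<Otimes>\<^sub>M unitary_borel N)"
      by (intro borel_measurable_times bounded_fun_compose[OF f measurable_unitary_mult[OF _ measurable_reduced[OF _ k]]]
        bounded_fun_compose[OF g]) auto
    then show "(\<lambda>(U, G). f (U * reduced N k G) * g U)
        \<in> borel_measurable (unitary_borel N \<Otimes>\<^sub>M unitary_borel N)"
      by (simp add: case_prod_beta)
    fix U V assume UV: "U \<in> UG N" "V \<in> UG N"
    have "cmod (f (U * reduced N k V)) \<le> B"
      by (intro B unitary_group_mult UV reduced_unitary k)
    then show "cmod (f (U * reduced N k V) * g U) \<le> B * B'"
      unfolding norm_mult using B(2)[OF UV(1)]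
      by (intro mult_mono) (auto intro: order_trans[OF norm_ge_zero])
  qed
  also have "\<dots> = (\<integral>G. (\<integral>U. f U * g U \<partial>H) \<partial>H)"
  proof (rule Bochner_Integration.integral_cong)
    fix G assume "G \<in> space H"
    then have G: "G \<in> UG N" by (simp add: space_H)
    let ?s = "reduced N k G"
    have s: "?s \<in> stab N k" by (rule reduced_stab[OF G k])
    note su = stab_unitary[OF s]
    have "(\<integral>U. f (U * ?s) * g U \<partial>H) = (\<integral>U. f (U * ?s) * g (U * ?s) \<partial>H)"
      by (rule Bochner_Integration.integral_cong) (auto simp: inv space_H s)
    also have "\<dots> = (\<integral>U. f U * g U \<partial>H)"
      by (rule right_invariant[OF su, of "\<lambda>U. f U * g U"]) (rule bounded_fun_mult[OF f g])
    finally show "(\<integral>U. f (U * ?s) * g U \<partial>H) = (\<integral>U. f U * g U \<partial>H)" .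
  qed simp
  finally show ?thesis by (simp add: prob_space)
qed

text \<open>Both averages are written over the same \<open>G\<close>, which couples them: the two
  arguments then differ by a single Householder factor on the right. The martingale difference is
  thus bounded pointwise and not only in mean.\<close>

lemma avg_step:
  assumes f: "bounded_fun f" and k: "k < N"
    and c: "\<And>U R. U \<in> UG N \<Longrightarrow> trace_close N (2 / real N) R (1\<^sub>m N) \<Longrightarrow> cmod (f (U * R) - f U) \<le> c"
    and U: "U \<in> UG N"
  shows "cmod (avg (Suc k) f U - avg k f U) \<le> c"
proof -
  have k': "Suc k \<le> N" "k \<le> N" using k by auto
  note b = bounded_fun_reduced[OF f U k'(1)] bounded_fun_reduced[OF f U k'(2)]
  have "avg (Suc k) f U - avg k f U
      = (\<integral>G. f (U * reduced N (Suc k) G) - f (U * reduced N k G) \<partial>H)"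
    unfolding avg_def by (rule Bochner_Integration.integral_diff[symmetric]) (intro bounded_fun_integrable b)+
  also have "cmod \<dots> \<le> c"
  proof (rule norm_integral_le[OF bounded_fun_diff[OF b]])
    fix G assume G: "G \<in> UG N"
    let ?Z = "reduced N k G"
    have Z: "?Z \<in> UG N" by (rule reduced_unitary[OF G k'(2)])
    note a = unitary_group_adjoint[OF Z]
    have "U * reduced N (Suc k) G = (U * ?Z) * householder N k (mat_adjoint ?Z)"
      using U Z householder_unitary[OF a k] by (simp add: unitary_mult_assoc[of _ N])
    then show "cmod (f (U * reduced N (Suc k) G) - f (U * ?Z)) \<le> c"
      using c[OF unitary_group_mult[OF U Z] householder_close[OF a k]] by simp
  qed
  finally show ?thesis .
qed

text \<open>Pythagoras: the difference of the two averages is orthogonal to \<open>avg k f\<close>,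
  because \<open>avg k f\<close> is invariant under the larger stabiliser and so also under the
  smaller one. The squared L2 norm grows by that of the difference.\<close>

lemma variance_step:
  assumes f: "bounded_fun f" and k: "k < N"
    and c: "\<And>U R. U \<in> UG N \<Longrightarrow> trace_close N (2 / real N) R (1\<^sub>m N) \<Longrightarrow> cmod (f (U * R) - f U) \<le> c"
  shows "Re (\<integral>U. avg (Suc k) f U * cnj (avg (Suc k) f U) \<partial>H)
    \<le> Re (\<integral>U. avg k f U * cnj (avg k f U) \<partial>H) + c\<^sup>2"
proof -
  have k': "Suc k \<le> N" "k \<le> N" using k by auto
  let ?g = "avg (Suc k) f" and ?h = "avg k f"
  note b = avg_bounded_fun[OF f k'(1)] avg_bounded_fun[OF f k'(2)]
  note bc = bounded_fun_cnj[OF b(1)] bounded_fun_cnj[OF b(2)]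
  have "(\<integral>U. ?h U * cnj (?h U) \<partial>H) = (\<integral>U. f U * cnj (?h U) \<partial>H)"
    by (rule avg_orthogonal[OF f k'(2) bc(2)]) (simp add: avg_right_invariant[OF f k'(2)])
  moreover have "(\<integral>U. ?g U * cnj (?h U) \<partial>H) = (\<integral>U. f U * cnj (?h U) \<partial>H)"
    by (rule avg_orthogonal[OF f k'(1) bc(2)]) (simp add: avg_right_invariant[OF f k'(2)] stab_mono)
  ultimately have gh: "(\<integral>U. ?g U * cnj (?h U) \<partial>H) = (\<integral>U. ?h U * cnj (?h U) \<partial>H)" by simp
  have "(\<integral>U. ?h U * cnj (?g U) \<partial>H) = (\<integral>U. cnj (?g U * cnj (?h U)) \<partial>H)"
    by (simp only: complex_cnj_mult complex_cnj_cnj mult.commute)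
  also have "\<dots> = cnj (\<integral>U. ?h U * cnj (?h U) \<partial>H)"
    by (simp only: Bochner_Integration.integral_cnj gh)
  finally have hg: "Re (\<integral>U. ?h U * cnj (?g U) \<partial>H) = Re (\<integral>U. ?h U * cnj (?h U) \<partial>H)"
    by (simp only: cnj.sel)
  have "(\<integral>U. (?g U - ?h U) * cnj (?g U - ?h U) \<partial>H)
      = (\<integral>U. (?g U * cnj (?g U) - ?g U * cnj (?h U)) - (?h U * cnj (?g U) - ?h U * cnj (?h U)) \<partial>H)"
    by (intro Bochner_Integration.integral_cong) (auto simp: algebra_simps)
  also have "\<dots> = ((\<integral>U. ?g U * cnj (?g U) \<partial>H) - (\<integral>U. ?g U * cnj (?h U) \<partial>H))
      - ((\<integral>U. ?h U * cnj (?g U) \<partial>H) - (\<integral>U. ?h U * cnj (?h U) \<partial>H))"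
    by (simp add: Bochner_Integration.integral_diff bounded_fun_integrable bounded_fun_mult bounded_fun_diff b bc)
  finally have "Re (\<integral>U. ?g U * cnj (?g U) \<partial>H) - Re (\<integral>U. ?h U * cnj (?h U) \<partial>H)
      = Re (\<integral>U. (?g U - ?h U) * cnj (?g U - ?h U) \<partial>H)"
    using gh hg by simp
  also have "\<dots> \<le> cmod (\<integral>U. (?g U - ?h U) * cnj (?g U - ?h U) \<partial>H)" by (rule complex_Re_le_cmod)
  also have "\<dots> \<le> c\<^sup>2"
  proof (rule norm_integral_le)
    show "bounded_fun (\<lambda>U. (?g U - ?h U) * cnj (?g U - ?h U))"
      by (intro bounded_fun_mult bounded_fun_cnj bounded_fun_diff b)
    fix U assume "U \<in> UG N"
    from avg_step[OF f k c this] show "cmod ((?g U - ?h U) * cnj (?g U - ?h U)) \<le> c\<^sup>2"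
      unfolding norm_mult complex_mod_cnj power2_eq_square
      by (intro mult_mono) (auto intro: order_trans[OF norm_ge_zero])
  qed
  finally show ?thesis by simp
qed

text \<open>Telescope \<open>variance_step\<close> for the centred function, from
  \<open>avg 0\<close>, which maps it to its mean 0, to \<open>avg N\<close>, which acts as the
  identity because only the identity matrix fixes all basis vectors.\<close>

lemma variance_bound:
  assumes f: "bounded_fun f"
    and c: "\<And>U R. U \<in> UG N \<Longrightarrow> trace_close N (2 / real N) R (1\<^sub>m N) \<Longrightarrow> cmod (f (U * R) - f U) \<le> c"
  shows "(\<integral>U. (cmod (f U - (\<integral>A. f A \<partial>H)))\<^sup>2 \<partial>H) \<le> real N * c\<^sup>2"
proof -
  let ?e = "\<integral>A. f A \<partial>H"
  let ?g = "\<lambda>U. f U - ?e"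
  have g: "bounded_fun ?g" by (intro bounded_fun_diff f bounded_fun_const)
  have g0: "(\<integral>A. ?g A \<partial>H) = 0"
    using bounded_fun_integrable[OF f] by (simp add: prob_space)
  have "Re (\<integral>U. avg k ?g U * cnj (avg k ?g U) \<partial>H) \<le> real k * c\<^sup>2" if "k \<le> N" for k
    using that
  proof (induction k)
    case 0
    have "(\<integral>U. avg 0 ?g U * cnj (avg 0 ?g U) \<partial>H) = (\<integral>U. 0 \<partial>H)"
      by (rule Bochner_Integration.integral_cong) (use g0 in \<open>auto simp: avg_zero[OF g] space_H\<close>)
    then show ?case by simp
  next
    case (Suc k)
    then show ?case using variance_step[OF g, of k c] c by (auto simp: algebra_simps)
  qed
  from this[of N] have "Re (\<integral>U. avg N ?g U * cnj (avg N ?g U) \<partial>H) \<le> real N * c\<^sup>2" by simp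
  also have "(\<integral>U. avg N ?g U * cnj (avg N ?g U) \<partial>H) = (\<integral>U. complex_of_real ((cmod (?g U))\<^sup>2) \<partial>H)"
    by (rule Bochner_Integration.integral_cong)
      (auto simp: avg_full space_H complex_norm_square simp del: of_real_power)
  finally show ?thesis by (simp del: of_real_power)
qed

text \<open>The product of the centred functions is bounded by half the sum of the squares; this
  loses nothing against Cauchy-Schwarz here, as both variances obey the same bound.\<close>

lemma covariance_bound:
  assumes f: "bounded_fun f" and g: "bounded_fun g"
    and cf: "\<And>U R. U \<in> UG N \<Longrightarrow> trace_close N (2 / real N) R (1\<^sub>m N) \<Longrightarrow> cmod (f (U * R) - f U) \<le> c"
    and cg: "\<And>U R. U \<in> UG N \<Longrightarrow> trace_close N (2 / real N) R (1\<^sub>m N) \<Longrightarrow> cmod (g (U * R) - g U) \<le> c"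
  shows "cmod ((\<integral>U. f U * g U \<partial>H) - (\<integral>U. f U \<partial>H) * (\<integral>U. g U \<partial>H)) \<le> real N * c\<^sup>2"
proof -
  let ?a = "\<integral>U. f U \<partial>H" and ?b = "\<integral>U. g U \<partial>H"
  let ?f = "\<lambda>U. f U - ?a" and ?g = "\<lambda>U. g U - ?b"
  have b: "bounded_fun ?f" "bounded_fun ?g" by (intro bounded_fun_diff f g bounded_fun_const)+
  have sq: "integrable H (\<lambda>U. (cmod (h U))\<^sup>2)" if "bounded_fun h" for h
    using integrable_norm[OF bounded_fun_integrable[OF bounded_fun_mult[OF that that]]]
    by (simp add: norm_mult power2_eq_square)
  have "(\<integral>U. ?f U * ?g U \<partial>H) = (\<integral>U. (f U * g U - ?b * f U) - (?a * g U - ?a * ?b) \<partial>H)"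
    by (intro Bochner_Integration.integral_cong) (auto simp: algebra_simps)
  also have "\<dots> = (\<integral>U. f U * g U \<partial>H) - ?a * ?b"
    using bounded_fun_integrable[OF f] bounded_fun_integrable[OF g] bounded_fun_integrable[OF bounded_fun_mult[OF f g]]
    by (simp add: prob_space mult.commute)
  finally have "cmod ((\<integral>U. f U * g U \<partial>H) - ?a * ?b) = cmod (\<integral>U. ?f U * ?g U \<partial>H)" by simp
  also have "\<dots> \<le> (\<integral>U. cmod (?f U * ?g U) \<partial>H)" by (rule integral_norm_bound)
  also have "\<dots> \<le> (\<integral>U. ((cmod (?f U))\<^sup>2 + (cmod (?g U))\<^sup>2) / 2 \<partial>H)"
  proof (rule integral_mono)
    show "integrable H (\<lambda>U. cmod (?f U * ?g U))"
      by (intro integrable_norm bounded_fun_integrable bounded_fun_mult b)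
    show "integrable H (\<lambda>U. ((cmod (?f U))\<^sup>2 + (cmod (?g U))\<^sup>2) / 2)"
      using sq[OF b(1)] sq[OF b(2)] by simp
    show "cmod (?f U * ?g U) \<le> ((cmod (?f U))\<^sup>2 + (cmod (?g U))\<^sup>2) / 2" for U
      using sum_squares_bound[of "cmod (?f U)" "cmod (?g U)"] by (simp add: norm_mult)
  qed
  also have "\<dots> = ((\<integral>U. (cmod (?f U))\<^sup>2 \<partial>H) + (\<integral>U. (cmod (?g U))\<^sup>2 \<partial>H)) / 2"
    using sq[OF b(1)] sq[OF b(2)] by simp
  also have "\<dots> \<le> real N * c\<^sup>2"
    using variance_bound[OF f cf] variance_bound[OF g cg] by simp
  finally show ?thesis .
qed

end

subsection \<open>Uniform first order expansions\<close>

text \<open>A first order Taylor expansion at t = 0 with one remainder constant for the whole set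
  \<open>S\<close>. It stands in for differentiation under the integral sign; the bounds on
  \<open>f0\<close> and \<open>f1\<close> are included so that products can be expanded.\<close>

definition unif_expansion :: "'a set \<Rightarrow> (real \<Rightarrow> 'a \<Rightarrow> complex) \<Rightarrow> ('a \<Rightarrow> complex) \<Rightarrow> ('a \<Rightarrow> complex) \<Rightarrow> bool" where
  "unif_expansion S f f0 f1 \<longleftrightarrow> (\<exists>C. \<forall>u\<in>S. cmod (f0 u) \<le> C \<and> cmod (f1 u) \<le> C \<and>
     (\<forall>t\<in>{0..1}. cmod (f t u - f0 u - of_real t * f1 u) \<le> C * t\<^sup>2))"

lemma unif_expansionI:
  assumes "\<And>u. u \<in> S \<Longrightarrow> cmod (f0 u) \<le> A" "\<And>u. u \<in> S \<Longrightarrow> cmod (f1 u) \<le> B"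
    and "\<And>u t. u \<in> S \<Longrightarrow> 0 \<le> t \<Longrightarrow> t \<le> 1 \<Longrightarrow> cmod (f t u - f0 u - of_real t * f1 u) \<le> D * t\<^sup>2"
  shows "unif_expansion S f f0 f1"
  unfolding unif_expansion_def
proof (intro exI[of _ "max A (max B D)"] ballI conjI)
  fix u assume u: "u \<in> S"
  show "cmod (f0 u) \<le> max A (max B D)" "cmod (f1 u) \<le> max A (max B D)"
    using assms(1,2)[OF u] by auto
  fix t assume t: "t \<in> {0..1::real}"
  have "D * t\<^sup>2 \<le> max A (max B D) * t\<^sup>2" by (intro mult_right_mono) auto
  then show "cmod (f t u - f0 u - of_real t * f1 u) \<le> max A (max B D) * t\<^sup>2"
    using assms(3)[OF u, of t] t by auto
qed

lemma unif_expansion_const: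
  assumes "\<And>u. u \<in> S \<Longrightarrow> cmod (g u) \<le> A"
  shows "unif_expansion S (\<lambda>t. g) g (\<lambda>_. 0)"
  by (rule unif_expansionI[of _ _ A _ 0 _ 0]) (use assms in auto)

lemma unif_expansion_cong:
  assumes "\<And>t u. u \<in> S \<Longrightarrow> f t u = g t u" "\<And>u. u \<in> S \<Longrightarrow> f0 u = g0 u" "\<And>u. u \<in> S \<Longrightarrow> f1 u = g1 u"
  shows "unif_expansion S f f0 f1 \<longleftrightarrow> unif_expansion S g g0 g1"
  unfolding unif_expansion_def using assms by (intro ex_cong1 ball_cong refl) auto

lemma unif_expansion_add:
  assumes "unif_expansion S f f0 f1" "unif_expansion S g g0 g1"
  shows "unif_expansion S (\<lambda>t u. f t u + g t u) (\<lambda>u. f0 u + g0 u) (\<lambda>u. f1 u + g1 u)"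
proof -
  obtain A where A: "\<And>u. u \<in> S \<Longrightarrow> cmod (f0 u) \<le> A" "\<And>u. u \<in> S \<Longrightarrow> cmod (f1 u) \<le> A"
    "\<And>u t. u \<in> S \<Longrightarrow> 0 \<le> t \<Longrightarrow> t \<le> 1 \<Longrightarrow> cmod (f t u - f0 u - of_real t * f1 u) \<le> A * t\<^sup>2"
    using assms(1) unfolding unif_expansion_def by force
  obtain B where B: "\<And>u. u \<in> S \<Longrightarrow> cmod (g0 u) \<le> B" "\<And>u. u \<in> S \<Longrightarrow> cmod (g1 u) \<le> B"
    "\<And>u t. u \<in> S \<Longrightarrow> 0 \<le> t \<Longrightarrow> t \<le> 1 \<Longrightarrow> cmod (g t u - g0 u - of_real t * g1 u) \<le> B * t\<^sup>2"
    using assms(2) unfolding unif_expansion_def by force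
  show ?thesis
  proof (rule unif_expansionI[of _ _ "A + B" _ "A + B" _ "A + B"])
    fix u t assume u: "u \<in> S" "0 \<le> t" "t \<le> (1::real)"
    have "cmod (f t u + g t u - (f0 u + g0 u) - of_real t * (f1 u + g1 u))
       = cmod ((f t u - f0 u - of_real t * f1 u) + (g t u - g0 u - of_real t * g1 u))"
      by (simp add: algebra_simps)
    also have "\<dots> \<le> A * t\<^sup>2 + B * t\<^sup>2" by (intro norm_triangle_mono A B u)
    finally show "cmod (f t u + g t u - (f0 u + g0 u) - of_real t * (f1 u + g1 u)) \<le> (A + B) * t\<^sup>2"
      by (simp add: algebra_simps)
  qed (auto intro!: norm_triangle_mono A B)
qed

lemma unif_expansion_sum:
  assumes "finite I" "\<And>i. i \<in> I \<Longrightarrow> unif_expansion S (f i) (f0 i) (f1 i)"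
  shows "unif_expansion S (\<lambda>t u. \<Sum>i\<in>I. f i t u) (\<lambda>u. \<Sum>i\<in>I. f0 i u) (\<lambda>u. \<Sum>i\<in>I. f1 i u)"
  using assms
proof (induction I rule: finite_induct)
  case empty
  show ?case using unif_expansion_const[of S "\<lambda>_. 0" 0] by simp
next
  case (insert i I)
  then show ?case using unif_expansion_add[of S "f i" "f0 i" "f1 i"] by simp
qed

lemma unif_expansion_mult:
  assumes "unif_expansion S f f0 f1" "unif_expansion S g g0 g1"
  shows "unif_expansion S (\<lambda>t u. f t u * g t u) (\<lambda>u. f0 u * g0 u) (\<lambda>u. f1 u * g0 u + f0 u * g1 u)"
proof -
  obtain A' where A': "\<And>u. u \<in> S \<Longrightarrow> cmod (f0 u) \<le> A'" "\<And>u. u \<in> S \<Longrightarrow> cmod (f1 u) \<le> A'"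
    "\<And>u t. u \<in> S \<Longrightarrow> 0 \<le> t \<Longrightarrow> t \<le> 1 \<Longrightarrow> cmod (f t u - f0 u - of_real t * f1 u) \<le> A' * t\<^sup>2"
    using assms(1) unfolding unif_expansion_def by force
  obtain B' where B': "\<And>u. u \<in> S \<Longrightarrow> cmod (g0 u) \<le> B'" "\<And>u. u \<in> S \<Longrightarrow> cmod (g1 u) \<le> B'"
    "\<And>u t. u \<in> S \<Longrightarrow> 0 \<le> t \<Longrightarrow> t \<le> 1 \<Longrightarrow> cmod (g t u - g0 u - of_real t * g1 u) \<le> B' * t\<^sup>2"
    using assms(2) unfolding unif_expansion_def by force
  \<comment> \<open>If \<open>S\<close> is empty, the constant obtained from the definition may be
    negative.\<close>
  define A where "A = \<bar>A'\<bar>"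
  define B where "B = \<bar>B'\<bar>"
  have nn: "0 \<le> A" "0 \<le> B" by (auto simp: A_def B_def)
  have A: "cmod (f0 u) \<le> A" "cmod (f1 u) \<le> A" if "u \<in> S" for u
    using A'(1,2)[OF that] by (auto simp: A_def)
  have B: "cmod (g0 u) \<le> B" "cmod (g1 u) \<le> B" if "u \<in> S" for u
    using B'(1,2)[OF that] by (auto simp: B_def)
  have Ar: "cmod (f t u - f0 u - of_real t * f1 u) \<le> A * t\<^sup>2" if "u \<in> S" "0 \<le> t" "t \<le> 1" for u t
    using A'(3)[OF that] mult_right_mono[OF abs_ge_self[of A'], of "t\<^sup>2"] by (simp add: A_def)
  have Br: "cmod (g t u - g0 u - of_real t * g1 u) \<le> B * t\<^sup>2" if "u \<in> S" "0 \<le> t" "t \<le> 1" for u t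
    using B'(3)[OF that] mult_right_mono[OF abs_ge_self[of B'], of "t\<^sup>2"] by (simp add: B_def)
  show ?thesis
  proof (rule unif_expansionI[of _ _ "A * B" _ "A * B + A * B" _ "6 * A * B"])
    fix u assume u: "u \<in> S"
    note b = A[OF u] B[OF u]
    show "cmod (f0 u * g0 u) \<le> A * B"
      unfolding norm_mult by (intro mult_mono b nn norm_ge_zero)
    have "cmod (f1 u * g0 u) \<le> A * B" "cmod (f0 u * g1 u) \<le> A * B"
      unfolding norm_mult by (intro mult_mono b nn norm_ge_zero)+
    then show "cmod (f1 u * g0 u + f0 u * g1 u) \<le> A * B + A * B"
      by (rule norm_triangle_mono)
    fix t :: real assume t: "0 \<le> t" "t \<le> 1"
    let ?rf = "f t u - f0 u - of_real t * f1 u" and ?rg = "g t u - g0 u - of_real t * g1 u"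
    note r = Ar[OF u t] Br[OF u t]
    have t2: "t\<^sup>2 \<le> 1" using t by (simp add: power_le_one)
    have tf: "cmod (of_real t * f1 u) \<le> A" "cmod (of_real t * g1 u) \<le> B"
      using b t mult_mono[of t 1 "cmod (f1 u)" A] mult_mono[of t 1 "cmod (g1 u)" B]
      by (auto simp: norm_mult)
    have rg1: "cmod ?rg \<le> B" using r(2) mult_left_mono[OF t2 nn(2)] by simp
    have G: "cmod (g0 u + of_real t * g1 u + ?rg) \<le> B + B + B"
      by (intro norm_triangle_mono b tf rg1)
    \<comment> \<open>The three pieces of the product remainder contribute 2, 3 and 1 to the
      constant 6.\<close>
    have "f t u * g t u - f0 u * g0 u - of_real t * (f1 u * g0 u + f0 u * g1 u)
      = (f0 u + of_real t * f1 u) * ?rg + ?rf * (g0 u + of_real t * g1 u + ?rg)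
        + of_real (t\<^sup>2) * (f1 u * g1 u)"
      by (simp add: algebra_simps power2_eq_square)
    also have "cmod \<dots> \<le> (A + A) * (B * t\<^sup>2) + (A * t\<^sup>2) * (B + B + B) + t\<^sup>2 * (A * B)"
    proof (intro norm_triangle_mono)
      show "cmod ((f0 u + of_real t * f1 u) * ?rg) \<le> (A + A) * (B * t\<^sup>2)"
        unfolding norm_mult by (intro mult_mono norm_triangle_mono b tf r norm_ge_zero add_nonneg_nonneg nn)
      show "cmod (?rf * (g0 u + of_real t * g1 u + ?rg)) \<le> (A * t\<^sup>2) * (B + B + B)"
        unfolding norm_mult by (intro mult_mono r G norm_ge_zero mult_nonneg_nonneg nn zero_le_power2)
      show "cmod (of_real (t\<^sup>2) * (f1 u * g1 u)) \<le> t\<^sup>2 * (A * B)"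
        unfolding norm_mult norm_of_real abs_power2
        by (intro mult_left_mono mult_mono b nn norm_ge_zero zero_le_power2)
    qed
    also have "\<dots> = 6 * A * B * t\<^sup>2" by (simp add: algebra_simps)
    finally show "cmod (f t u * g t u - f0 u * g0 u - of_real t * (f1 u * g0 u + f0 u * g1 u)) \<le> 6 * A * B * t\<^sup>2" .
  qed
qed

text \<open>Integration cancels the zeroth order, so t times the modulus of the integral of
  \<open>f1\<close> is at most C t^2. Divide by t and let t tend to 0.\<close>

lemma unif_expansion_constant_integral:
  assumes "prob_space M" and e: "unif_expansion (space M) f f0 f1"
    and i: "\<And>t. integrable M (f t)" "integrable M f0" "integrable M f1"
    and c: "\<And>t. (\<integral>u. f t u \<partial>M) = (\<integral>u. f0 u \<partial>M)"
  shows "(\<integral>u. f1 u \<partial>M) = 0"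
proof -
  interpret prob_space M by fact
  obtain C where C: "\<And>u t. u \<in> space M \<Longrightarrow> 0 \<le> t \<Longrightarrow> t \<le> 1 \<Longrightarrow> cmod (f t u - f0 u - of_real t * f1 u) \<le> C * t\<^sup>2"
    using e unfolding unif_expansion_def by force
  have b: "cmod (\<integral>u. f1 u \<partial>M) \<le> C * t" if t: "0 < t" "t \<le> 1" for t
  proof -
    have "(\<integral>u. f t u - f0 u - of_real t * f1 u \<partial>M) = - (of_real t * (\<integral>u. f1 u \<partial>M))"
      using i c[of t] by simp
    then have "t * cmod (\<integral>u. f1 u \<partial>M) = cmod (\<integral>u. f t u - f0 u - of_real t * f1 u \<partial>M)"
      using t by (simp add: norm_mult)
    also have "\<dots> \<le> (\<integral>u. cmod (f t u - f0 u - of_real t * f1 u) \<partial>M)" by (rule integral_norm_bound)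
    also have "\<dots> \<le> (\<integral>u. C * t\<^sup>2 \<partial>M)"
      using i C t by (intro integral_mono) auto
    also have "\<dots> = t * (C * t)" by (simp add: prob_space power2_eq_square)
    finally show ?thesis using t by (simp only: mult_le_cancel_left_pos)
  qed
  have "cmod (\<integral>u. f1 u \<partial>M) \<le> 0"
  proof (rule field_le_epsilon)
    fix e :: real assume "0 < e"
    let ?t = "min 1 (e / (\<bar>C\<bar> + 1))"
    have t: "0 < ?t" "?t \<le> 1" using \<open>0 < e\<close> by auto
    have "C * ?t \<le> \<bar>C\<bar> * (e / (\<bar>C\<bar> + 1))" using t by (intro mult_mono) auto
    also have "\<dots> \<le> e" using \<open>0 < e\<close> by (simp add: field_simps)
    finally show "cmod (\<integral>u. f1 u \<partial>M) \<le> 0 + e" using b[OF t] by simp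
  qed
  then show ?thesis by simp
qed

subsection \<open>Rank one phase rotations\<close>

text \<open>For a unit vector \<open>v\<close> this is the exponential of i t P, where P is the
  orthogonal projection onto the line of \<open>v\<close>. The closed form makes entries explicit,
  and changing the sign of \<open>t\<close> gives the adjoint.\<close>

definition phase :: "nat \<Rightarrow> (nat \<Rightarrow> complex) \<Rightarrow> real \<Rightarrow> complex mat" where
  "phase N v t = mat N N (\<lambda>(i, j). (if i = j then 1 else 0) + (cis t - 1) * (v i * cnj (v j)))"

lemma phase_index: "i < N \<Longrightarrow> j < N \<Longrightarrow>
    phase N v t $$ (i, j) = (if i = j then 1 else 0) + (cis t - 1) * (v i * cnj (v j))"
  by (simp add: phase_def)

lemma phase_unitary:
  assumes v: "(\<Sum>i<N. v i * cnj (v i)) = 1"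
  shows "phase N v t \<in> UG N"
proof (rule unitaryI_rows)
  show "phase N v t \<in> carrier_mat N N" by (simp add: phase_def)
  fix i j assume ij: "i < N" "j < N"
  let ?z = "cis t - 1"
  have z: "?z + cnj ?z + ?z * cnj ?z = 0"
    by (simp add: algebra_simps cis_mult cis_cnj)
  have c: "(\<Sum>l<N. C * (v l * cnj (v l))) = C" for C
    using v by (simp add: sum_distrib_left[symmetric])
  have "(\<Sum>l<N. phase N v t $$ (i, l) * cnj (phase N v t $$ (j, l)))
     = (\<Sum>l<N. (if l = i then (if i = j then 1 else 0) + cnj ?z * (v i * cnj (v j)) else 0)
         + ((if l = j then ?z * (v i * cnj (v j)) else 0)
         + (?z * cnj ?z * (v i * cnj (v j))) * (v l * cnj (v l))))"
    using ij by (intro sum.cong refl) (auto simp: phase_index algebra_simps)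
  also have "\<dots> = (if i = j then 1 else 0) + (?z + cnj ?z + ?z * cnj ?z) * (v i * cnj (v j))"
    unfolding sum.distrib c using ij by (simp add: algebra_simps)
  finally show "(\<Sum>l<N. phase N v t $$ (i, l) * cnj (phase N v t $$ (j, l))) = (if i = j then 1 else 0)"
    unfolding z by simp
qed

lemma phase_adjoint: "mat_adjoint (phase N v t) = phase N v (- t)"
proof (rule eq_matI)
  have c: "phase N v t \<in> carrier_mat N N" for t by (simp add: phase_def)
  fix i j assume "i < dim_row (phase N v (- t))" "j < dim_col (phase N v (- t))"
  then have "i < N" "j < N" by (auto simp: phase_def)
  then show "mat_adjoint (phase N v t) $$ (i, j) = phase N v (- t) $$ (i, j)"
    by (subst mat_adjoint_index[OF c]) (auto simp: phase_index cis_cnj)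
qed (auto simp: phase_def mat_adjoint_def)

lemma cis_linear_bound: "cmod (cis t - 1 - of_real t * \<i>) \<le> t\<^sup>2"
proof -
  have "cmod (iexp t - (\<Sum>k\<le>1. (\<i> * of_real t) ^ k / fact k)) \<le> \<bar>t\<bar> ^ Suc 1 / fact (Suc 1)"
    by (rule iexp_approx1)
  moreover have "(\<Sum>k\<le>1. (\<i> * of_real t) ^ k / fact k) = 1 + of_real t * \<i>" by simp
  ultimately have "cmod (cis t - 1 - of_real t * \<i>) \<le> t\<^sup>2 / 2"
    by (simp add: cis_conv_exp diff_diff_eq power2_eq_square mult.commute[of \<i>])
  then show ?thesis using zero_le_power2[of t] by linarith
qed

text \<open>A term \<open>(s, P, Q)\<close> of \<open>L\<close> stands for the contribution \<open>s P (v v\<^sup>*) Q\<close> to the derivative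
  divided by \<open>\<i>\<close>.\<close>

definition mat_expansion :: "nat \<Rightarrow> (nat \<Rightarrow> complex) \<Rightarrow> (real \<Rightarrow> complex mat \<Rightarrow> complex mat) \<Rightarrow> (complex mat \<Rightarrow> complex mat)
    \<Rightarrow> (complex \<times> (complex mat \<Rightarrow> complex mat) \<times> (complex mat \<Rightarrow> complex mat)) list \<Rightarrow> bool" where
  "mat_expansion N v F F0 L \<longleftrightarrow> (\<forall>u \<in> UG N. F0 u \<in> UG N \<and> (\<forall>t. F t u \<in> UG N) \<and>
       (\<forall>(s, P, Q) \<in> set L. P u \<in> UG N \<and> Q u \<in> UG N)) \<and>
     (\<forall>r<N. \<forall>c<N. unif_expansion (UG N) (\<lambda>t u. F t u $$ (r, c)) (\<lambda>u. F0 u $$ (r, c))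
       (\<lambda>u. \<i> * (\<Sum>(s, P, Q)\<leftarrow>L. s * (\<Sum>a<N. P u $$ (r, a) * v a) * (\<Sum>b<N. cnj (v b) * Q u $$ (b, c)))))"

lemma mat_expansion_const_fun:
  assumes "\<And>u. u \<in> UG N \<Longrightarrow> A u \<in> UG N"
  shows "mat_expansion N v (\<lambda>t. A) A []"
  unfolding mat_expansion_def
proof (intro conjI allI impI)
  fix r c assume "r < N" "c < N"
  then have "unif_expansion (UG N) (\<lambda>t u. A u $$ (r, c)) (\<lambda>u. A u $$ (r, c)) (\<lambda>u. 0)"
    by (intro unif_expansion_const[of _ _ 1] unitary_entry_le_1[OF assms])
  then show "unif_expansion (UG N) (\<lambda>t u. A u $$ (r, c)) (\<lambda>u. A u $$ (r, c))
       (\<lambda>u. \<i> * (\<Sum>(s, P, Q)\<leftarrow>[]. s * (\<Sum>a<N. P u $$ (r, a) * v a) * (\<Sum>b<N. cnj (v b) * Q u $$ (b, c))))"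
    by simp
qed (use assms in auto)

lemma mat_expansion_const:
  assumes "A \<in> UG N"
  shows "mat_expansion N v (\<lambda>t u. A) (\<lambda>u. A) []"
  by (rule mat_expansion_const_fun) (rule assms)

text \<open>The Leibniz rule: every term keeps a single insertion of v v^*, and the factor that is
  not differentiated is absorbed into \<open>Q\<close> or into \<open>P\<close>. The inductions over
  the list move matrix multiplication through the two vector contractions.\<close>

lemma mat_expansion_mult:
  assumes F: "mat_expansion N v F F0 L" and G: "mat_expansion N v G G0 L'"
  shows "mat_expansion N v (\<lambda>t u. F t u * G t u) (\<lambda>u. F0 u * G0 u)
    (map (\<lambda>(s, P, Q). (s, P, \<lambda>u. Q u * G0 u)) L @ map (\<lambda>(s, P, Q). (s, \<lambda>u. F0 u * P u, Q)) L')"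
    (is "mat_expansion N v _ _ ?L")
proof -
  have u: "F0 u \<in> UG N" "F t u \<in> UG N" "G0 u \<in> UG N" "G t u \<in> UG N"
    "\<And>s P Q. (s, P, Q) \<in> set L \<Longrightarrow> P u \<in> UG N \<and> Q u \<in> UG N"
    "\<And>s P Q. (s, P, Q) \<in> set L' \<Longrightarrow> P u \<in> UG N \<and> Q u \<in> UG N" if "u \<in> UG N" for u t
    using F G that unfolding mat_expansion_def by auto
  let ?D = "\<lambda>L u r c. \<Sum>(s, P, Q)\<leftarrow>L. s * (\<Sum>a<N. P u $$ (r, a) * v a) * (\<Sum>b<N. cnj (v b) * Q u $$ (b, c))"
  have DQ: "?D (map (\<lambda>(s, P, Q). (s, P, \<lambda>u. Q u * G0 u)) L) w r c = (\<Sum>l<N. ?D L w r l * G0 w $$ (l, c))"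
    if w: "w \<in> UG N" and c: "c < N" and L: "\<And>s P Q. (s, P, Q) \<in> set L \<Longrightarrow> Q w \<in> UG N" for w r c
      and L :: "(complex \<times> (complex mat \<Rightarrow> complex mat) \<times> (complex mat \<Rightarrow> complex mat)) list"
    using L
  proof (induction L)
    case (Cons x L)
    obtain s P Q where x: "x = (s, P, Q)" by (cases x)
    have Q: "Q w \<in> UG N" using Cons.prems[of s P Q] x by auto
    have "(\<Sum>b<N. cnj (v b) * (Q w * G0 w) $$ (b, c)) = (\<Sum>b<N. \<Sum>l<N. cnj (v b) * Q w $$ (b, l) * G0 w $$ (l, c))"
      using Q u(3)[OF w] c by (intro sum.cong refl) (subst mat_mult_index[of _ N], auto simp: sum_distrib_left mult.assoc)
    also have "\<dots> = (\<Sum>l<N. (\<Sum>b<N. cnj (v b) * Q w $$ (b, l)) * G0 w $$ (l, c))"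
      by (subst sum.swap) (simp add: sum_distrib_right)
    finally have e: "(\<Sum>b<N. cnj (v b) * (Q w * G0 w) $$ (b, c)) = (\<Sum>l<N. (\<Sum>b<N. cnj (v b) * Q w $$ (b, l)) * G0 w $$ (l, c))" .
    have e2: "q * (\<Sum>l<N. (\<Sum>b<N. cnj (v b) * Q w $$ (b, l)) * G0 w $$ (l, c))
        = (\<Sum>l<N. q * (\<Sum>b<N. cnj (v b) * Q w $$ (b, l)) * G0 w $$ (l, c))" for q
      by (subst sum_distrib_left) (simp only: mult.assoc)
    have "?D (map (\<lambda>(s, P, Q). (s, P, \<lambda>u. Q u * G0 u)) L) w r c = (\<Sum>l<N. ?D L w r l * G0 w $$ (l, c))"
      using Cons by auto
    then show ?case
      by (simp add: x e e2 ring_distribs sum.distrib)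
  qed simp
  have DP: "?D (map (\<lambda>(s, P, Q). (s, \<lambda>u. F0 u * P u, Q)) L) w r c = (\<Sum>l<N. F0 w $$ (r, l) * ?D L w l c)"
    if w: "w \<in> UG N" and r: "r < N" and L: "\<And>s P Q. (s, P, Q) \<in> set L \<Longrightarrow> P w \<in> UG N" for w r c
      and L :: "(complex \<times> (complex mat \<Rightarrow> complex mat) \<times> (complex mat \<Rightarrow> complex mat)) list"
    using L
  proof (induction L)
    case (Cons x L)
    obtain s P Q where x: "x = (s, P, Q)" by (cases x)
    have P: "P w \<in> UG N" using Cons.prems[of s P Q] x by auto
    have "(\<Sum>a<N. (F0 w * P w) $$ (r, a) * v a) = (\<Sum>a<N. \<Sum>l<N. F0 w $$ (r, l) * (P w $$ (l, a) * v a))"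
      using P u(1)[OF w] r by (intro sum.cong refl) (subst mat_mult_index[of _ N], auto simp: sum_distrib_right mult.assoc)
    also have "\<dots> = (\<Sum>l<N. F0 w $$ (r, l) * (\<Sum>a<N. P w $$ (l, a) * v a))"
      by (subst sum.swap) (simp add: sum_distrib_left)
    finally have e: "(\<Sum>a<N. (F0 w * P w) $$ (r, a) * v a) = (\<Sum>l<N. F0 w $$ (r, l) * (\<Sum>a<N. P w $$ (l, a) * v a))" .
    have e2: "s * (\<Sum>l<N. F0 w $$ (r, l) * (\<Sum>a<N. P w $$ (l, a) * v a)) * q
        = (\<Sum>l<N. F0 w $$ (r, l) * (s * (\<Sum>a<N. P w $$ (l, a) * v a) * q))" for q
      by (subst sum_distrib_left, subst sum_distrib_right, intro sum.cong refl) (simp only: mult_ac)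
    have "?D (map (\<lambda>(s, P, Q). (s, \<lambda>u. F0 u * P u, Q)) L) w r c = (\<Sum>l<N. F0 w $$ (r, l) * ?D L w l c)"
      using Cons by auto
    then show ?case
      by (simp add: x e e2 ring_distribs sum.distrib)
  qed simp
  have "unif_expansion (UG N) (\<lambda>t u. (F t u * G t u) $$ (r, c)) (\<lambda>u. (F0 u * G0 u) $$ (r, c)) (\<lambda>u. \<i> * ?D ?L u r c)"
    if rc: "r < N" "c < N" for r c
  proof -
    have "unif_expansion (UG N) (\<lambda>t u. \<Sum>l<N. F t u $$ (r, l) * G t u $$ (l, c)) (\<lambda>u. \<Sum>l<N. F0 u $$ (r, l) * G0 u $$ (l, c))
      (\<lambda>u. \<Sum>l<N. (\<i> * ?D L u r l) * G0 u $$ (l, c) + F0 u $$ (r, l) * (\<i> * ?D L' u l c))"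
      using F G rc unfolding mat_expansion_def by (intro unif_expansion_sum unif_expansion_mult) auto
    moreover have "\<i> * ?D ?L w r c
        = (\<Sum>l<N. (\<i> * ?D L w r l) * G0 w $$ (l, c) + F0 w $$ (r, l) * (\<i> * ?D L' w l c))" if w: "w \<in> UG N" for w
    proof -
      have gen: "\<i> * ((\<Sum>l<N. d l * g l) + (\<Sum>l<N. f l * e l))
          = (\<Sum>l<N. (\<i> * d l) * g l + f l * (\<i> * e l))" for d e f g :: "nat \<Rightarrow> complex"
        by (simp add: sum.distrib ring_distribs sum_distrib_left mult_ac)
      have dq: "?D (map (\<lambda>(s, P, Q). (s, P, \<lambda>u. Q u * G0 u)) L) w r c = (\<Sum>l<N. ?D L w r l * G0 w $$ (l, c))"
        by (rule DQ[OF w rc(2)]) (use u(5)[OF w] in blast)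
      have dp: "?D (map (\<lambda>(s, P, Q). (s, \<lambda>u. F0 u * P u, Q)) L') w r c = (\<Sum>l<N. F0 w $$ (r, l) * ?D L' w l c)"
        by (rule DP[OF w rc(1)]) (use u(6)[OF w] in blast)
      show ?thesis unfolding map_append sum_list_append dq dp by (rule gen)
    qed
    ultimately show ?thesis
      using rc u by (subst unif_expansion_cong[where g = "\<lambda>t u. \<Sum>l<N. F t u $$ (r, l) * G t u $$ (l, c)"
          and ?g0.0 = "\<lambda>u. \<Sum>l<N. F0 u $$ (r, l) * G0 u $$ (l, c)"])
        (auto intro!: mat_mult_index)
  qed
  moreover have "\<forall>w\<in>UG N. F0 w * G0 w \<in> UG N \<and> (\<forall>t. F t w * G t w \<in> UG N) \<and>
       (\<forall>(s, P, Q) \<in> set ?L. P w \<in> UG N \<and> Q w \<in> UG N)"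
    using u by (fastforce intro: unitary_group_mult)
  ultimately show ?thesis unfolding mat_expansion_def by simp
qed

text \<open>The sign \<open>\<epsilon>\<close> is 1 for the rotation and -1 for its adjoint on the
  other side of a conjugation.\<close>

lemma mat_expansion_phase:
  assumes v: "(\<Sum>i<N. v i * cnj (v i)) = 1"
  shows "mat_expansion N v (\<lambda>t u. phase N v (\<epsilon> * t)) (\<lambda>u. 1\<^sub>m N) [(of_real \<epsilon>, \<lambda>u. 1\<^sub>m N, \<lambda>u. 1\<^sub>m N)]"
proof -
  have "unif_expansion (UG N) (\<lambda>t u. phase N v (\<epsilon> * t) $$ (r, c)) (\<lambda>u. 1\<^sub>m N $$ (r, c))
      (\<lambda>u. \<i> * (of_real \<epsilon> * (v r * cnj (v c))))" if rc: "r < N" "c < N" for r c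
  proof (rule unif_expansionI[of _ _ 1 _ "cmod (\<i> * (of_real \<epsilon> * (v r * cnj (v c))))" _ "\<epsilon>\<^sup>2 * cmod (v r * cnj (v c))"])
    fix t :: real
    have "phase N v (\<epsilon> * t) $$ (r, c) - 1\<^sub>m N $$ (r, c) - of_real t * (\<i> * (of_real \<epsilon> * (v r * cnj (v c))))
        = (cis (\<epsilon> * t) - 1 - of_real (\<epsilon> * t) * \<i>) * (v r * cnj (v c))"
      using rc by (simp add: phase_index algebra_simps)
    then have "cmod (phase N v (\<epsilon> * t) $$ (r, c) - 1\<^sub>m N $$ (r, c) - of_real t * (\<i> * (of_real \<epsilon> * (v r * cnj (v c)))))
        \<le> (\<epsilon> * t)\<^sup>2 * cmod (v r * cnj (v c))"
      using cis_linear_bound[of "\<epsilon> * t"] by (simp only: norm_mult mult_right_mono norm_ge_zero mult_nonneg_nonneg)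
    then show "cmod (phase N v (\<epsilon> * t) $$ (r, c) - 1\<^sub>m N $$ (r, c) - of_real t * (\<i> * (of_real \<epsilon> * (v r * cnj (v c)))))
        \<le> \<epsilon>\<^sup>2 * cmod (v r * cnj (v c)) * t\<^sup>2"
      by (simp add: power_mult_distrib mult_ac)
  qed (use rc in auto)
  moreover have "(\<Sum>a<N. 1\<^sub>m N $$ (r, a) * v a) = v r" if "r < N" for r
    using that by (simp add: if_distrib[of "\<lambda>x. x * _"] cong: if_cong)
  moreover have "(\<Sum>b<N. cnj (v b) * 1\<^sub>m N $$ (b, c)) = cnj (v c)" if "c < N" for c
    using that by (simp add: if_distrib[of "\<lambda>x. _ * x"] cong: if_cong)
  ultimately show ?thesis
    unfolding mat_expansion_def by (auto simp: phase_unitary[OF v] mult.assoc)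
qed

subsection \<open>Loop equations\<close>

text \<open>Only unit vectors are available, since only they give unitary rotations. Coordinate
  vectors yield the diagonal; vectors with two nonzero coordinates, the second one real or
  imaginary, yield the sum and the difference of the two off-diagonal entries.\<close>

lemma polarization:
  fixes \<kappa> :: "nat \<Rightarrow> nat \<Rightarrow> complex"
  assumes q: "\<And>v. (\<Sum>i<N. v i * cnj (v i)) = 1 \<Longrightarrow> (\<Sum>a<N. \<Sum>b<N. v a * cnj (v b) * \<kappa> a b) = 0"
    and ab: "a < N" "b < N"
  shows "\<kappa> a b = 0"
proof -
  have single: "\<kappa> x x = 0" if "x < N" for x
  proof -
    let ?v = "\<lambda>i. if i = x then 1 else 0 :: complex"
    have s: "(\<Sum>i<N. ?v i * h i) = h x" for h :: "nat \<Rightarrow> complex"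
      using that by (simp add: if_distrib[of "\<lambda>y. y * _"] cong: if_cong)
    have "(\<Sum>i<N. ?v i * cnj (?v i)) = 1" by (subst s) simp
    from q[OF this] have "(\<Sum>a<N. ?v a * (\<Sum>b<N. ?v b * \<kappa> a b)) = 0"
      by (simp add: sum_distrib_left mult.assoc if_distrib[of cnj] cong: if_cong)
    then show ?thesis unfolding s .
  qed
  show ?thesis
  proof (cases "a = b")
    case False
    define v where "v \<alpha> \<beta> i = (if i = a then \<alpha> else if i = b then \<beta> else 0 :: complex)" for \<alpha> \<beta> i
    have s: "(\<Sum>i<N. v \<alpha> \<beta> i * h i) = \<alpha> * h a + \<beta> * h b" for h \<alpha> \<beta>
    proof -
      have "(\<Sum>i<N. v \<alpha> \<beta> i * h i) = (\<Sum>i\<in>{a, b}. v \<alpha> \<beta> i * h i)"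
        using ab by (intro sum.mono_neutral_right) (auto simp: v_def)
      then show ?thesis using False by (simp add: v_def)
    qed
    have cv: "cnj (v \<alpha> \<beta> i) = v (cnj \<alpha>) (cnj \<beta>) i" for \<alpha> \<beta> i by (simp add: v_def)
    have pol: "\<alpha> * cnj \<beta> * \<kappa> a b + \<beta> * cnj \<alpha> * \<kappa> b a = 0" if "\<alpha> * cnj \<alpha> + \<beta> * cnj \<beta> = 1" for \<alpha> \<beta>
    proof -
      have "(\<Sum>i<N. v \<alpha> \<beta> i * cnj (v \<alpha> \<beta> i)) = 1"
        unfolding s using that False by (simp add: v_def)
      from q[OF this] have "(\<Sum>x<N. v \<alpha> \<beta> x * (\<Sum>y<N. v (cnj \<alpha>) (cnj \<beta>) y * \<kappa> x y)) = 0"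
        by (simp add: cv sum_distrib_left mult.assoc)
      then show ?thesis
        unfolding s using single ab by (simp add: algebra_simps)
    qed
    \<comment> \<open>The 3-4-5 triangle provides unit vectors with rational coordinates, and 25/12
      is the inverse of \<open>3/5 * 4/5\<close>. The second choice, with a factor \<i>, turns the
      sum into a difference.\<close>
    have "\<kappa> a b + \<kappa> b a = (25/12) * (3/5 * cnj (4/5) * \<kappa> a b + 4/5 * cnj (3/5) * \<kappa> b a)"
      by (simp add: field_simps)
    also have "\<dots> = 0" by (subst pol) simp_all
    finally have 1: "\<kappa> a b + \<kappa> b a = 0" .
    have "\<kappa> b a - \<kappa> a b = (25/12) * - \<i> * (3/5 * cnj (\<i> * (4/5)) * \<kappa> a b + \<i> * (4/5) * cnj (3/5) * \<kappa> b a)"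
      by (simp add: field_simps)
    also have "\<dots> = 0" by (subst pol) simp_all
    finally show ?thesis using 1 by simp
  qed (use single ab in simp)
qed

section \<open>Conjugation and alternating words\<close>

definition conj_by :: "complex mat \<Rightarrow> complex mat \<Rightarrow> complex mat" where
  "conj_by A U = U * A * mat_adjoint U"

lemma conj_by_unitary [simp]: "A \<in> UG N \<Longrightarrow> U \<in> UG N \<Longrightarrow> conj_by A U \<in> UG N"
  by (simp add: conj_by_def unitary_group_mult unitary_group_adjoint)

lemma adjoint_unitary_mult:
  "A \<in> UG N \<Longrightarrow> B \<in> UG N \<Longrightarrow> mat_adjoint (A * B) = mat_adjoint B * mat_adjoint A"
  by (rule mat_adjoint_mult[of _ N N _ N]) auto

lemma conj_by_mult:
  assumes "A \<in> UG N" "U \<in> UG N" "V \<in> UG N"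
  shows "conj_by A (V * U) = V * conj_by A U * mat_adjoint V"
  using assms unitary_group_adjoint[OF assms(2)] unitary_group_adjoint[OF assms(3)]
  by (simp add: conj_by_def adjoint_unitary_mult[of _ N] unitary_mult_assoc[of _ N] unitary_group_mult)

lemma conj_by_pow:
  "A \<in> UG N \<Longrightarrow> U \<in> UG N \<Longrightarrow> conj_by A U ^\<^sub>m k = conj_by (A ^\<^sub>m k) U"
  by (simp add: conj_by_def unitary_conj_pow)

lemma conj_by_hom:
  assumes "A \<in> UG N" "B \<in> UG N" "U \<in> UG N"
  shows "conj_by A U * conj_by B U = conj_by (A * B) U"
  using assms unitary_group_adjoint[OF assms(3)]
  by (simp add: conj_by_def unitary_mult_assoc[of _ N] unitary_group_mult unitary_adjoint_cancel[of _ N])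

lemma norm_trace_conj_by:
  assumes "A \<in> UG N" "U \<in> UG N"
  shows "norm_trace (conj_by A U) = norm_trace A"
proof -
  have "norm_trace (conj_by A U) = norm_trace (U * (A * mat_adjoint U))"
    using assms unitary_group_adjoint[OF assms(2)] by (simp add: conj_by_def unitary_mult_assoc[of _ N])
  also have "\<dots> = norm_trace (A * mat_adjoint U * U)"
    using assms unitary_group_adjoint[OF assms(2)]
    by (intro norm_trace_comm[of _ N]) (simp_all add: unitary_group_mult)
  finally show ?thesis using assms by (simp add: unitary_adjoint_cancel[of _ N])
qed

lemma measurable_conj_by:
  assumes "A \<in> UG N" "f \<in> measurable M (unitary_borel N)"
  shows "(\<lambda>x. conj_by A (f x)) \<in> measurable M (unitary_borel N)"
  unfolding conj_by_def
  by (intro measurable_unitary_mult measurable_unitary_adjoint assms(2)) (simp add: assms(1))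

lemma unitary_pow_Suc_left:
  assumes "A \<in> UG N"
  shows "A * A ^\<^sub>m k = A ^\<^sub>m Suc k"
proof (induction k)
  case 0
  then show ?case using assms by (simp add: left_mult_one_mat[of _ N N] right_mult_one_mat[of _ N N])
next
  case (Suc k)
  have "A * A ^\<^sub>m Suc k = (A * A ^\<^sub>m k) * A" using assms by (simp add: unitary_mult_assoc[of _ N])
  then show ?case using Suc by simp
qed

text \<open>The leading power of \<open>Y\<close> is kept apart so that it can be treated as one
  conjugated matrix. The case \<open>k = 1\<close> gives the powers of \<open>Y * X\<close> whose
  traces are wanted.\<close>

definition alt_word :: "complex mat \<Rightarrow> complex mat \<Rightarrow> nat \<Rightarrow> nat \<Rightarrow> complex mat" where
  "alt_word X Y k j = Y ^\<^sub>m k * (X * (Y * X) ^\<^sub>m j)"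

lemma alt_word_unitary [simp]: "X \<in> UG N \<Longrightarrow> Y \<in> UG N \<Longrightarrow> alt_word X Y k j \<in> UG N"
  by (simp add: alt_word_def unitary_group_mult)

lemma pow_swap:
  assumes "X \<in> UG N" "Y \<in> UG N"
  shows "X * (Y * X) ^\<^sub>m j = (X * Y) ^\<^sub>m j * X"
proof (induction j)
  case 0
  then show ?case using assms by (simp add: left_mult_one_mat[of _ N N] right_mult_one_mat[of _ N N])
next
  case (Suc j)
  have "X * (Y * X) ^\<^sub>m Suc j = (X * (Y * X) ^\<^sub>m j) * (Y * X)"
    using assms by (simp add: unitary_mult_assoc[of _ N] unitary_group_mult)
  also have "\<dots> = ((X * Y) ^\<^sub>m j * X) * (Y * X)" using Suc by simp
  also have "\<dots> = (X * Y) ^\<^sub>m Suc j * X"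
    using assms by (simp add: unitary_mult_assoc[of _ N] unitary_group_mult)
  finally show ?case .
qed

lemma alt_word_one:
  assumes "X \<in> UG N" "Y \<in> UG N"
  shows "alt_word X Y 1 j = (Y * X) ^\<^sub>m Suc j"
proof -
  have "Y ^\<^sub>m 1 = Y" using assms by (simp add: left_mult_one_mat[of _ N N])
  then have "alt_word X Y 1 j = (Y * X) * (Y * X) ^\<^sub>m j"
    using assms by (simp add: alt_word_def unitary_mult_assoc[of _ N] unitary_group_mult)
  also have "\<dots> = (Y * X) ^\<^sub>m Suc j" by (rule unitary_pow_Suc_left[OF unitary_group_mult[OF assms(2,1)]])
  finally show ?thesis .
qed

lemma norm_trace_pow_swap:
  assumes "X \<in> UG N" "Y \<in> UG N"
  shows "norm_trace ((X * Y) ^\<^sub>m Suc j) = norm_trace ((Y * X) ^\<^sub>m Suc j)"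
proof -
  have XY: "X * Y \<in> UG N" "Y * X \<in> UG N" using assms by (auto simp: unitary_group_mult)
  have "(X * Y) ^\<^sub>m Suc j = (X * (Y * X) ^\<^sub>m j) * Y"
    using pow_swap[OF assms, of j] assms XY by (simp add: unitary_mult_assoc[of _ N])
  moreover have "norm_trace ((X * (Y * X) ^\<^sub>m j) * Y) = norm_trace (Y * (X * (Y * X) ^\<^sub>m j))"
    using assms XY by (intro norm_trace_comm[of _ N]) (auto intro: unitary_group_mult)
  moreover have "Y * (X * (Y * X) ^\<^sub>m j) = (Y * X) ^\<^sub>m Suc j"
    using unitary_pow_Suc_left[OF XY(2), of j] assms XY by (simp add: unitary_mult_assoc[of _ N])
  ultimately show ?thesis by simp
qed

lemma norm_trace_alt_word_one:
  assumes "X \<in> UG N" "Y \<in> UG N"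
  shows "norm_trace (alt_word X Y 1 j) = norm_trace (alt_word Y X 1 j)"
  using norm_trace_pow_swap[OF assms(2,1)] by (simp only: alt_word_one[OF assms] alt_word_one[OF assms(2,1)])

lemma norm_trace_alt_word_zero_Suc:
  assumes "X \<in> UG N" "Y \<in> UG N"
  shows "norm_trace (alt_word X Y 0 (Suc j)) = norm_trace (alt_word Y X 2 j)"
proof -
  have XY: "X * Y \<in> UG N" "Y * X \<in> UG N" using assms by (auto simp: unitary_group_mult)
  have "alt_word X Y 0 (Suc j) = (X * Y) ^\<^sub>m Suc j * X"
    unfolding alt_word_def pow_swap[OF assms] using assms XY
    by (simp add: left_mult_one_mat[of _ N N] unitary_group_mult)
  also have "norm_trace \<dots> = norm_trace (X * (X * Y) ^\<^sub>m Suc j)"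
    using assms XY unitary_pow[OF XY(1)] by (intro norm_trace_comm[of _ N])
  also have "X * (X * Y) ^\<^sub>m Suc j = X * ((X * Y) * (X * Y) ^\<^sub>m j)"
    by (simp only: unitary_pow_Suc_left[OF XY(1)])
  also have "\<dots> = alt_word Y X 2 j"
    using assms XY by (simp add: alt_word_def numeral_2_eq_2 left_mult_one_mat[of _ N N]
        unitary_mult_assoc[of _ N] unitary_group_mult)
  finally show ?thesis .
qed

lemma norm_trace_alt_word_zero_zero:
  "X \<in> UG N \<Longrightarrow> Y \<in> UG N \<Longrightarrow> norm_trace (alt_word X Y 0 0) = norm_trace (X ^\<^sub>m 1)"
  by (simp add: alt_word_def left_mult_one_mat[of _ N N] right_mult_one_mat[of _ N N] unitary_group_mult)

lemma alt_word_conj_by: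
  assumes "X \<in> UG N" "Y \<in> UG N" "U \<in> UG N"
  shows "alt_word (conj_by X U) (conj_by Y U) k j = conj_by (alt_word X Y k j) U"
  using assms by (simp add: alt_word_def conj_by_pow[of _ N] conj_by_hom[of _ N] unitary_group_mult)

lemma conj_by_adjoint_cancel:
  assumes "A \<in> UG N" "U \<in> UG N"
  shows "conj_by (conj_by A (mat_adjoint U)) U = A"
  using assms unitary_group_adjoint[OF assms(2)] mat_adjoint_adjoint[of U N N]
  by (simp add: conj_by_def unitary_mult_assoc[of _ N] unitary_adjoint_cancel[of _ N] unitary_group_mult
      unitary_inverse[of _ N] right_mult_one_mat[of _ N N])

lemma measurable_alt_word:
  assumes "f \<in> measurable M (unitary_borel N)" "g \<in> measurable M (unitary_borel N)"
  shows "(\<lambda>x. alt_word (f x) (g x) k j) \<in> measurable M (unitary_borel N)"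
  unfolding alt_word_def by (intro measurable_unitary_mult measurable_unitary_pow assms)

section \<open>First order expansion of words and contraction to traces\<close>

lemma mat_expansion_cong:
  assumes m: "mat_expansion N v F F0 L"
    and F: "\<And>t u. u \<in> UG N \<Longrightarrow> F' t u = F t u" "\<And>u. u \<in> UG N \<Longrightarrow> F0' u = F0 u"
    and L: "list_all2 (\<lambda>(s, P, Q) (s', P', Q'). s = s' \<and> (\<forall>u\<in>UG N. P u = P' u \<and> Q u = Q' u)) L L'"
  shows "mat_expansion N v F' F0' L'"
proof -
  let ?D = "\<lambda>L u r c. \<Sum>(s, P, Q)\<leftarrow>L. s * (\<Sum>a<N. P u $$ (r, a) * v a) * (\<Sum>b<N. cnj (v b) * Q u $$ (b, c))"
  have D: "?D L u r c = ?D L' u r c" if "u \<in> UG N" for u r c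
    using L that by (induction rule: list_all2_induct) auto
  have "(\<forall>(s, P, Q) \<in> set L. \<forall>u \<in> UG N. P u \<in> UG N \<and> Q u \<in> UG N) \<longrightarrow>
      (\<forall>(s, P, Q) \<in> set L'. \<forall>u \<in> UG N. P u \<in> UG N \<and> Q u \<in> UG N)"
    using L by (induction rule: list_all2_induct) auto
  moreover have "\<forall>(s, P, Q) \<in> set L. \<forall>u \<in> UG N. P u \<in> UG N \<and> Q u \<in> UG N"
    using m unfolding mat_expansion_def by fast
  ultimately have mem: "\<forall>(s, P, Q) \<in> set L'. \<forall>u \<in> UG N. P u \<in> UG N \<and> Q u \<in> UG N" by blast
  have u: "F0' u \<in> UG N" "F' t u \<in> UG N" if "u \<in> UG N" for t u
    using m that F unfolding mat_expansion_def by auto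
  have "unif_expansion (UG N) (\<lambda>t u. F' t u $$ (r, c)) (\<lambda>u. F0' u $$ (r, c)) (\<lambda>u. \<i> * ?D L' u r c)"
    if "r < N" "c < N" for r c
  proof -
    have "unif_expansion (UG N) (\<lambda>t u. F t u $$ (r, c)) (\<lambda>u. F0 u $$ (r, c)) (\<lambda>u. \<i> * ?D L u r c)"
      using m that unfolding mat_expansion_def by blast
    then show ?thesis by (subst unif_expansion_cong) (simp_all only: F D[symmetric])
  qed
  then show ?thesis unfolding mat_expansion_def using u mem by fast
qed

text \<open>To first order, rotating the conjugating unitary adds the commutator of v v^* with the
  conjugated matrix: two terms of opposite sign, one on each side.\<close>

lemma mat_expansion_conj_by:
  assumes v: "(\<Sum>i<N. v i * cnj (v i)) = 1" and A: "A \<in> UG N"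
  shows "mat_expansion N v (\<lambda>t u. conj_by A (phase N v t * u)) (conj_by A) [(1, \<lambda>u. 1\<^sub>m N, conj_by A), (-1, conj_by A, \<lambda>u. 1\<^sub>m N)]"
proof -
  have c: "mat_expansion N v (\<lambda>t. conj_by A) (conj_by A) []" by (rule mat_expansion_const_fun) (simp add: A)
  from mat_expansion_mult[OF mat_expansion_mult[OF mat_expansion_phase[OF v, of 1] c] mat_expansion_phase[OF v, of "-1"]]
  show ?thesis
    by (rule mat_expansion_cong)
      (auto simp: A conj_by_mult[OF A] phase_unitary[OF v] phase_adjoint left_mult_one_mat[of _ N N]
        right_mult_one_mat[of _ N N])
qed

text \<open>The list is written in the form in which \<open>mat_expansion_mult\<close> produces it,
  including products with \<open>1\<^sub>m N\<close>, so that no rewriting inside the terms is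
  needed.\<close>

fun pow_terms :: "(complex mat \<Rightarrow> complex mat) \<Rightarrow> complex mat \<Rightarrow> nat \<Rightarrow> nat
    \<Rightarrow> (complex \<times> (complex mat \<Rightarrow> complex mat) \<times> (complex mat \<Rightarrow> complex mat)) list" where
  "pow_terms y X N 0 = []"
| "pow_terms y X N (Suc m) = map (\<lambda>(s, P, Q). (s, P, \<lambda>u. Q u * (y u * X))) (pow_terms y X N m) @
     [(1, \<lambda>u. (y u * X) ^\<^sub>m m * 1\<^sub>m N, \<lambda>u. y u * X), (-1, \<lambda>u. (y u * X) ^\<^sub>m m * y u, \<lambda>u. 1\<^sub>m N * X)]"

lemma mat_expansion_pow:
  assumes v: "(\<Sum>i<N. v i * cnj (v i)) = 1" and A: "A \<in> UG N" and X: "X \<in> UG N"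
  shows "mat_expansion N v (\<lambda>t u. (conj_by A (phase N v t * u) * X) ^\<^sub>m m) (\<lambda>u. (conj_by A u * X) ^\<^sub>m m) (pow_terms (conj_by A) X N m)"
proof (induction m)
  case 0
  have d: "dim_row (conj_by A u) = N" if "u \<in> UG N" for u
    using unitary_dim(1)[OF conj_by_unitary[OF A that]] .
  then show ?case
    using A by (intro mat_expansion_cong[OF mat_expansion_const[OF one_unitary]])
      (auto simp: d unitary_group_mult phase_unitary[OF v])
next
  case (Suc m)
  have "mat_expansion N v (\<lambda>t u. conj_by A (phase N v t * u) * X) (\<lambda>u. conj_by A u * X)
      [(1, \<lambda>u. 1\<^sub>m N, \<lambda>u. conj_by A u * X), (-1, conj_by A, \<lambda>u. 1\<^sub>m N * X)]"
    using mat_expansion_mult[OF mat_expansion_conj_by[OF v A] mat_expansion_const[OF X]] by simp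
  from mat_expansion_mult[OF Suc this] show ?case by simp
qed

text \<open>The first two terms are the whole contribution of Y^k for any \<open>k\<close>, because
  it is expanded as the conjugate of \<open>A ^\<^sub>m k\<close> and not as a product of
  \<open>k\<close> factors.\<close>

definition word_terms :: "complex mat \<Rightarrow> complex mat \<Rightarrow> nat \<Rightarrow> nat \<Rightarrow> nat
    \<Rightarrow> (complex \<times> (complex mat \<Rightarrow> complex mat) \<times> (complex mat \<Rightarrow> complex mat)) list" where
  "word_terms A X N k m =
    [(1, \<lambda>u. 1\<^sub>m N, \<lambda>u. conj_by (A ^\<^sub>m k) u * (X * (conj_by A u * X) ^\<^sub>m m)),
     (-1, conj_by (A ^\<^sub>m k), \<lambda>u. 1\<^sub>m N * (X * (conj_by A u * X) ^\<^sub>m m))]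
    @ map (\<lambda>(s, P, Q). (s, \<lambda>u. conj_by (A ^\<^sub>m k) u * (X * P u), Q)) (pow_terms (conj_by A) X N m)"

lemma mat_expansion_word:
  assumes v: "(\<Sum>i<N. v i * cnj (v i)) = 1" and A: "A \<in> UG N" and X: "X \<in> UG N"
  shows "mat_expansion N v (\<lambda>t u. alt_word X (conj_by A (phase N v t * u)) k m) (\<lambda>u. alt_word X (conj_by A u) k m) (word_terms A X N k m)"
proof -
  from mat_expansion_mult[OF mat_expansion_conj_by[OF v unitary_pow[OF A, of k]] mat_expansion_mult[OF mat_expansion_const[OF X] mat_expansion_pow[OF v A X, of m]]]
  have "mat_expansion N v (\<lambda>t u. conj_by (A ^\<^sub>m k) (phase N v t * u) * (X * (conj_by A (phase N v t * u) * X) ^\<^sub>m m))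
     (\<lambda>u. conj_by (A ^\<^sub>m k) u * (X * (conj_by A u * X) ^\<^sub>m m)) (word_terms A X N k m)"
    by (simp add: word_terms_def case_prod_unfold comp_def)
  then show ?thesis
    by (rule mat_expansion_cong)
      (auto simp: alt_word_def conj_by_pow[OF A] unitary_group_mult phase_unitary[OF v] list_all2_same)
qed

text \<open>Every Y in the power is cut off on its left, with sign 1, or on its right, with sign -1,
  and each cut splits the word in two. The right context \<open>C\<close> stays general because the
  recursion of \<open>pow_terms\<close> appends a factor to every \<open>Q\<close>.\<close>

lemma contract_pow_terms:
  assumes y: "y u \<in> UG N" and X: "X \<in> UG N" and B: "B \<in> UG N" and C: "C \<in> UG N"
  shows "(\<Sum>(s, P, Q)\<leftarrow>pow_terms y X N m. s * norm_trace (B * P u) * norm_trace (Q u * C))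
    = (\<Sum>i<m. norm_trace (B * (y u * X) ^\<^sub>m i) * norm_trace ((y u * X) ^\<^sub>m Suc (m - 1 - i) * C)
        - norm_trace (B * (y u * X) ^\<^sub>m i * y u) * norm_trace (X * (y u * X) ^\<^sub>m (m - 1 - i) * C))"
  using C
proof (induction m arbitrary: C)
  case (Suc m)
  let ?Z = "y u * X"
  have Z: "?Z \<in> UG N" using y X by (rule unitary_group_mult)
  have mem: "Q u \<in> UG N" if "(s, P, Q) \<in> set (pow_terms y X N m)" for s P Q
    using that
  proof (induction m arbitrary: s P Q)
    case (Suc m)
    then show ?case using Z X by (auto intro!: unitary_group_mult simp: left_mult_one_mat[of _ N N])
  qed simp
  have "(\<Sum>(s, P, Q)\<leftarrow>map (\<lambda>(s, P, Q). (s, P, \<lambda>u. Q u * (y u * X))) (pow_terms y X N m).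
        s * norm_trace (B * P u) * norm_trace (Q u * C))
     = (\<Sum>(s, P, Q)\<leftarrow>pow_terms y X N m. s * norm_trace (B * P u) * norm_trace (Q u * (?Z * C)))"
    unfolding map_map
    by (intro arg_cong[of _ _ sum_list] map_cong refl)
      (auto simp: unitary_mult_assoc[of _ N] mem Z Suc.prems)
  also have "\<dots> = (\<Sum>i<m. norm_trace (B * ?Z ^\<^sub>m i) * norm_trace (?Z ^\<^sub>m Suc (m - 1 - i) * (?Z * C))
        - norm_trace (B * ?Z ^\<^sub>m i * y u) * norm_trace (X * ?Z ^\<^sub>m (m - 1 - i) * (?Z * C)))"
    by (rule Suc.IH) (rule unitary_group_mult[OF Z Suc.prems])
  also have "\<dots> = (\<Sum>i<m. norm_trace (B * ?Z ^\<^sub>m i) * norm_trace (?Z ^\<^sub>m Suc (Suc m - 1 - i) * C)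
        - norm_trace (B * ?Z ^\<^sub>m i * y u) * norm_trace (X * ?Z ^\<^sub>m (Suc m - 1 - i) * C))"
  proof (rule sum.cong[OF refl])
    fix i assume "i \<in> {..<m}"
    then have e: "Suc m - 1 - i = Suc (m - 1 - i)" by auto
    have "?Z ^\<^sub>m Suc n * (?Z * C) = ?Z ^\<^sub>m Suc (Suc n) * C" for n
      using unitary_mult_assoc[OF unitary_pow[OF Z, of "Suc n"] Z Suc.prems] by simp
    moreover have "X * ?Z ^\<^sub>m n * (?Z * C) = X * ?Z ^\<^sub>m Suc n * C" for n
      using Z X Suc.prems by (simp add: unitary_mult_assoc[of _ N] unitary_group_mult)
    ultimately show "norm_trace (B * ?Z ^\<^sub>m i) * norm_trace (?Z ^\<^sub>m Suc (m - 1 - i) * (?Z * C))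
        - norm_trace (B * ?Z ^\<^sub>m i * y u) * norm_trace (X * ?Z ^\<^sub>m (m - 1 - i) * (?Z * C))
      = norm_trace (B * ?Z ^\<^sub>m i) * norm_trace (?Z ^\<^sub>m Suc (Suc m - 1 - i) * C)
        - norm_trace (B * ?Z ^\<^sub>m i * y u) * norm_trace (X * ?Z ^\<^sub>m (Suc m - 1 - i) * C)"
      unfolding e by presburger
  qed
  finally have IH: "(\<Sum>(s, P, Q)\<leftarrow>map (\<lambda>(s, P, Q). (s, P, \<lambda>u. Q u * (y u * X))) (pow_terms y X N m).
        s * norm_trace (B * P u) * norm_trace (Q u * C)) = \<dots>" .
  have "B * (?Z ^\<^sub>m m * 1\<^sub>m N) = B * ?Z ^\<^sub>m m" "?Z ^\<^sub>m Suc 0 = ?Z" "1\<^sub>m N * X * C = X * ?Z ^\<^sub>m 0 * C"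
    "B * (?Z ^\<^sub>m m * y u) = B * ?Z ^\<^sub>m m * y u"
    using Z X y B by (simp_all add: right_mult_one_mat[of _ N N] left_mult_one_mat[of _ N N] unitary_mult_assoc[of _ N])
  then show ?case
    unfolding pow_terms.simps map_append sum_list_append IH by simp
qed simp

lemma pow_terms_unitary:
  assumes "(s, P, Q) \<in> set (pow_terms y X N m)" "y u \<in> UG N" "X \<in> UG N"
  shows "P u \<in> UG N \<and> Q u \<in> UG N"
  using assms
proof (induction m arbitrary: s P Q)
  case (Suc m)
  have Z: "y u * X \<in> UG N" using Suc.prems by (auto intro: unitary_group_mult)
  then show ?case
    using Suc by (auto intro!: unitary_group_mult simp: left_mult_one_mat[of _ N N])
qed simp

lemma pow_terms_measurable:
  assumes "(s, P, Q) \<in> set (pow_terms y X N m)"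
    and y: "y \<in> measurable M (unitary_borel N)" and X: "X \<in> UG N"
  shows "P \<in> measurable M (unitary_borel N) \<and> Q \<in> measurable M (unitary_borel N)"
  using assms(1)
proof (induction m arbitrary: s P Q)
  case (Suc m)
  have c: "(\<lambda>_. A) \<in> measurable M (unitary_borel N)" if "A \<in> UG N" for A
    using that by simp
  have Z: "(\<lambda>u. y u * X) \<in> measurable M (unitary_borel N)"
    by (intro measurable_unitary_mult y c X)
  have "(\<lambda>u. (y u * X) ^\<^sub>m m * 1\<^sub>m N) \<in> measurable M (unitary_borel N)"
    "(\<lambda>u. (y u * X) ^\<^sub>m m * y u) \<in> measurable M (unitary_borel N)"
    "(\<lambda>u. 1\<^sub>m N * X) \<in> measurable M (unitary_borel N)"
    by (intro measurable_unitary_mult measurable_unitary_pow Z y c X one_unitary)+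
  moreover have "(\<lambda>u. Q u * (y u * X)) \<in> measurable M (unitary_borel N)"
    if "(s, P, Q) \<in> set (pow_terms y X N m)" for s P Q
    using Suc.IH[OF that] by (intro measurable_unitary_mult Z) auto
  ultimately show ?case using Suc Z y by auto
qed simp

lemma contract_word_terms:
  assumes A: "A \<in> UG N" and X: "X \<in> UG N" and u: "u \<in> UG N"
  shows "(\<Sum>(s, P, Q)\<leftarrow>word_terms A X N k m. s * norm_trace (P u) * norm_trace (Q u))
    = norm_trace (1\<^sub>m N) * norm_trace (alt_word X (conj_by A u) k m)
      - norm_trace (A ^\<^sub>m k) * norm_trace (alt_word X (conj_by A u) 0 m)
      - (\<Sum>i<m. norm_trace (alt_word X (conj_by A u) (Suc k) i) * norm_trace (alt_word X (conj_by A u) 0 (m - 1 - i))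
           - norm_trace (alt_word X (conj_by A u) k i) * norm_trace (alt_word X (conj_by A u) 1 (m - 1 - i)))"
proof -
  let ?y = "conj_by A u"
  let ?Z = "?y * X"
  let ?B = "?y ^\<^sub>m k * X"
  have y: "?y \<in> UG N" using A u by simp
  have Z: "?Z \<in> UG N" and B: "?B \<in> UG N" using y X by (auto intro: unitary_group_mult)
  have yk: "conj_by (A ^\<^sub>m k) u = ?y ^\<^sub>m k" by (simp add: conj_by_pow[OF A u])
  have k: "?B * ?Z ^\<^sub>m i = alt_word X ?y k i" for i
    using y X Z by (simp add: alt_word_def unitary_mult_assoc[of _ N])
  \<comment> \<open>A cut to the right of a Y leaves that Y at the end of the first half; cyclicity
    moves it to the front and raises \<open>k\<close> by one.\<close>
  have Sk: "norm_trace (?B * ?Z ^\<^sub>m i * ?y) = norm_trace (alt_word X ?y (Suc k) i)" for i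
  proof -
    have "norm_trace (?B * ?Z ^\<^sub>m i * ?y) = norm_trace (?y * (?B * ?Z ^\<^sub>m i))"
      by (rule norm_trace_comm[OF unitary_group_mult[OF B unitary_pow[OF Z]] y])
    also have "?y * (?B * ?Z ^\<^sub>m i) = (?y * ?y ^\<^sub>m k) * (X * ?Z ^\<^sub>m i)"
      using y X Z by (simp add: unitary_mult_assoc[of _ N] unitary_group_mult)
    finally show ?thesis by (simp only: alt_word_def unitary_pow_Suc_left[OF y])
  qed
  have z: "X * ?Z ^\<^sub>m i = alt_word X ?y 0 i" for i
    using y X Z by (simp add: alt_word_def unitary_group_mult)
  have "(\<Sum>(s, P, Q)\<leftarrow>map (\<lambda>(s, P, Q). (s, \<lambda>u. conj_by (A ^\<^sub>m k) u * (X * P u), Q)) (pow_terms (conj_by A) X N m).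
       s * norm_trace (P u) * norm_trace (Q u))
     = (\<Sum>(s, P, Q)\<leftarrow>pow_terms (conj_by A) X N m. s * norm_trace (?B * P u) * norm_trace (Q u * 1\<^sub>m N))"
    unfolding map_map
  proof (rule arg_cong[where f = sum_list], rule map_cong[OF refl], goal_cases)
    case (1 x)
    obtain s P Q where x: "x = (s, P, Q)" by (cases x)
    have "P u \<in> UG N" "Q u \<in> UG N"
      using pow_terms_unitary[of s P Q "conj_by A", OF _ y X] 1 by (auto simp: x)
    then show ?case
      using y X by (simp add: x yk unitary_mult_assoc[of _ N] right_mult_one_mat[of _ N N])
  qed
  also have "\<dots> = (\<Sum>i<m. norm_trace (?B * ?Z ^\<^sub>m i) * norm_trace (?Z ^\<^sub>m Suc (m - 1 - i) * 1\<^sub>m N)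
        - norm_trace (?B * ?Z ^\<^sub>m i * ?y) * norm_trace (X * ?Z ^\<^sub>m (m - 1 - i) * 1\<^sub>m N))"
    by (rule contract_pow_terms[where y = "conj_by A" and u = u, OF y X B one_unitary])
  also have "\<dots> = (\<Sum>i<m. norm_trace (alt_word X ?y k i) * norm_trace (alt_word X ?y 1 (m - 1 - i))
        - norm_trace (alt_word X ?y (Suc k) i) * norm_trace (alt_word X ?y 0 (m - 1 - i)))"
  proof (rule sum.cong[OF refl])
    fix i
    have "?Z ^\<^sub>m Suc n * 1\<^sub>m N = alt_word X ?y 1 n" for n
      using right_mult_one_mat[OF unitary_carrier[OF unitary_pow[OF Z]]] by (simp only: alt_word_one[OF X y])
    moreover have "X * ?Z ^\<^sub>m n * 1\<^sub>m N = alt_word X ?y 0 n" for n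
      using right_mult_one_mat[OF unitary_carrier[OF unitary_group_mult[OF X unitary_pow[OF Z]]]]
      by (simp only: z)
    ultimately show "norm_trace (?B * ?Z ^\<^sub>m i) * norm_trace (?Z ^\<^sub>m Suc (m - 1 - i) * 1\<^sub>m N)
        - norm_trace (?B * ?Z ^\<^sub>m i * ?y) * norm_trace (X * ?Z ^\<^sub>m (m - 1 - i) * 1\<^sub>m N)
      = norm_trace (alt_word X ?y k i) * norm_trace (alt_word X ?y 1 (m - 1 - i))
        - norm_trace (alt_word X ?y (Suc k) i) * norm_trace (alt_word X ?y 0 (m - 1 - i))"
      unfolding Sk by (simp only: k)
  qed
  finally have S: "(\<Sum>(s, P, Q)\<leftarrow>map (\<lambda>(s, P, Q). (s, \<lambda>u. conj_by (A ^\<^sub>m k) u * (X * P u), Q)) (pow_terms (conj_by A) X N m).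
       s * norm_trace (P u) * norm_trace (Q u)) = \<dots>" .
  have h1: "conj_by (A ^\<^sub>m k) u * (X * ?Z ^\<^sub>m m) = alt_word X ?y k m" by (simp add: alt_word_def yk)
  have h2: "1\<^sub>m N * (X * ?Z ^\<^sub>m m) = alt_word X ?y 0 m"
    using left_mult_one_mat[OF unitary_carrier[OF unitary_group_mult[OF X unitary_pow[OF Z]]]] by (simp only: z)
  have h3: "norm_trace (conj_by (A ^\<^sub>m k) u) = norm_trace (A ^\<^sub>m k)"
    by (rule norm_trace_conj_by[OF unitary_pow[OF A] u])
  have neg: "(\<Sum>i<m. f i - g i) = - (\<Sum>i<m. g i - f i)" for f g :: "nat \<Rightarrow> complex"
    by (simp add: sum_negf[symmetric])
  show ?thesis
    unfolding word_terms_def map_append sum_list_append S neg[of "\<lambda>i. norm_trace (alt_word X ?y k i) * norm_trace (alt_word X ?y 1 (m - 1 - i))"]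
    by (simp add: h1 h2 h3)
qed

section \<open>Identities between expected traces from left invariance\<close>

context haar
begin

lemma bounded_fun_entry:
  assumes "P \<in> measurable (unitary_borel N) (unitary_borel N)" "i < N" "j < N"
  shows "bounded_fun (\<lambda>u. P u $$ (i, j))"
proof -
  have "(\<lambda>u. P u $$ (i, j)) \<in> borel_measurable (unitary_borel N)"
    using assms unfolding measurable_unitary_borel_iff by blast
  moreover have "cmod (P u $$ (i, j)) \<le> 1" if "u \<in> UG N" for u
    by (rule unitary_entry_le_1[OF _ assms(2,3)]) (use measurable_space[OF assms(1)] that in simp)
  ultimately show ?thesis unfolding bounded_fun_def by blast
qed

lemma bounded_fun_norm_trace:
  assumes "P \<in> measurable (unitary_borel N) (unitary_borel N)"
  shows "bounded_fun (\<lambda>u. norm_trace (P u))"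
proof -
  have "cmod (norm_trace (P u)) \<le> 1" if "u \<in> UG N" for u
    by (rule norm_trace_unitary_le_1[of _ N]) (use measurable_space[OF assms] that in simp)
  then show ?thesis using measurable_norm_trace[OF assms] unfolding bounded_fun_def by blast
qed

lemma bounded_fun_sum_list:
  "(\<And>x. x \<in> set L \<Longrightarrow> bounded_fun (f x)) \<Longrightarrow> bounded_fun (\<lambda>u. \<Sum>x\<leftarrow>L. f x u)"
proof (induction L)
  case (Cons x L)
  then show ?case using bounded_fun_add[of "f x" "\<lambda>u. \<Sum>x\<leftarrow>L. f x u"] by simp
qed (simp add: bounded_fun_const)

text \<open>By left invariance the integral of each entry (r, c) is constant in t, so its first
  order term integrates to 0 for every unit vector. Polarization then separates the coefficients
  P_ra Q_bc for all indices; taking r = a and c = b and summing over a and b produces the two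
  traces.\<close>

lemma loop_contraction:
  assumes m: "\<And>v. (\<Sum>i<N. v i * cnj (v i)) = 1 \<Longrightarrow> mat_expansion N v (\<lambda>t u. F (phase N v t * u)) F L"
    and F: "F \<in> measurable (unitary_borel N) (unitary_borel N)"
    and L: "\<And>s P Q. (s, P, Q) \<in> set L \<Longrightarrow> P \<in> measurable (unitary_borel N) (unitary_borel N) \<and>
        Q \<in> measurable (unitary_borel N) (unitary_borel N)"
  shows "(\<integral>u. (\<Sum>(s, P, Q)\<leftarrow>L. s * norm_trace (P u) * norm_trace (Q u)) \<partial>H) = 0"
proof -
  define T where "T u r c a b = (\<Sum>(s, P, Q)\<leftarrow>L. s * P u $$ (r, a) * Q u $$ (b, c))" for u r c a b
  have Tb: "bounded_fun (\<lambda>u. T u r c a b)" if "r < N" "c < N" "a < N" "b < N" for r c a b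
    unfolding T_def case_prod_unfold
    using L that by (intro bounded_fun_sum_list bounded_fun_mult bounded_fun_const bounded_fun_entry) (force)+
  have zero: "(\<integral>u. T u r c a b \<partial>H) = 0" if rc: "r < N" "c < N" and ab: "a < N" "b < N" for r c a b
  proof (rule polarization[OF _ ab])
    fix v assume v: "(\<Sum>i<N. v i * cnj (v i)) = 1"
    let ?D = "\<lambda>u. \<i> * (\<Sum>(s, P, Q)\<leftarrow>L. s * (\<Sum>a<N. P u $$ (r, a) * v a) * (\<Sum>b<N. cnj (v b) * Q u $$ (b, c)))"
    have lin: "(\<Sum>(s, P, Q)\<leftarrow>L'. s * (\<Sum>a<N. P u $$ (r, a) * v a) * (\<Sum>b<N. cnj (v b) * Q u $$ (b, c)))
        = (\<Sum>a<N. \<Sum>b<N. v a * cnj (v b) * (\<Sum>(s, P, Q)\<leftarrow>L'. s * P u $$ (r, a) * Q u $$ (b, c)))"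
      for L' :: "(complex \<times> (complex mat \<Rightarrow> complex mat) \<times> (complex mat \<Rightarrow> complex mat)) list" and u
    proof (induction L')
      case (Cons x L')
      obtain s P Q where x: "x = (s, P, Q)" by (cases x)
      have "s * (\<Sum>a<N. P u $$ (r, a) * v a) * (\<Sum>b<N. cnj (v b) * Q u $$ (b, c))
          = (\<Sum>a<N. \<Sum>b<N. v a * cnj (v b) * (s * P u $$ (r, a) * Q u $$ (b, c)))"
        by (simp add: sum_product sum_distrib_left mult_ac)
      then show ?case using Cons by (simp add: x ring_distribs sum.distrib)
    qed simp
    have D: "?D u = \<i> * (\<Sum>a<N. \<Sum>b<N. v a * cnj (v b) * T u r c a b)" for u
      unfolding T_def lin ..
    have Db: "bounded_fun ?D"
      unfolding D by (intro bounded_fun_mult bounded_fun_const bounded_fun_sum Tb rc) auto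
    have Fb: "bounded_fun (\<lambda>u. F u $$ (r, c))" by (rule bounded_fun_entry[OF F rc])
    have ph: "phase N v t \<in> UG N" for t by (rule phase_unitary[OF v])
    have "(\<integral>u. ?D u \<partial>H) = 0"
    proof (rule unif_expansion_constant_integral[OF prob_space_axioms])
      show "unif_expansion (space H) (\<lambda>t u. F (phase N v t * u) $$ (r, c)) (\<lambda>u. F u $$ (r, c)) ?D"
        using m[OF v] rc unfolding mat_expansion_def space_H by blast
      show "integrable H (\<lambda>u. F (phase N v t * u) $$ (r, c))" for t
        by (rule bounded_fun_integrable[OF bounded_fun_comp[OF Fb measurable_left[OF ph]]])
      show "(\<integral>u. F (phase N v t * u) $$ (r, c) \<partial>H) = (\<integral>u. F u $$ (r, c) \<partial>H)" for t
        by (rule left_invariant[OF ph Fb])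
    qed (intro bounded_fun_integrable Fb Db)+
    moreover have "(\<integral>u. ?D u \<partial>H) = \<i> * (\<Sum>a<N. \<Sum>b<N. v a * cnj (v b) * (\<integral>u. T u r c a b \<partial>H))"
    proof -
      have "(\<integral>u. ?D u \<partial>H) = \<i> * (\<integral>u. (\<Sum>a<N. \<Sum>b<N. v a * cnj (v b) * T u r c a b) \<partial>H)"
        unfolding D by simp
      also have "(\<integral>u. (\<Sum>a<N. \<Sum>b<N. v a * cnj (v b) * T u r c a b) \<partial>H)
          = (\<Sum>a<N. \<integral>u. (\<Sum>b<N. v a * cnj (v b) * T u r c a b) \<partial>H)"
        by (intro Bochner_Integration.integral_sum bounded_fun_integrable bounded_fun_sum bounded_fun_mult bounded_fun_const Tb rc) auto
      also have "\<dots> = (\<Sum>a<N. \<Sum>b<N. \<integral>u. v a * cnj (v b) * T u r c a b \<partial>H)"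
        by (intro sum.cong refl Bochner_Integration.integral_sum bounded_fun_integrable bounded_fun_mult bounded_fun_const Tb rc) auto
      finally show ?thesis by simp
    qed
    ultimately show "(\<Sum>a<N. \<Sum>b<N. v a * cnj (v b) * (\<integral>u. T u r c a b \<partial>H)) = 0" by simp
  qed
  have tr: "(\<Sum>(s, P, Q)\<leftarrow>L. s * norm_trace (P u) * norm_trace (Q u))
      = (\<Sum>a<N. \<Sum>b<N. T u a b a b) / (of_nat N * of_nat N)" if u: "u \<in> UG N" for u
  proof -
    have nt: "norm_trace (P u) = (\<Sum>a<N. P u $$ (a, a)) / of_nat N"
      if "P \<in> measurable (unitary_borel N) (unitary_borel N)" for P
    proof -
      have "P u \<in> UG N" using measurable_space[OF that] u by simp
      then show ?thesis by (simp add: norm_trace_def)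
    qed
    have "(\<Sum>(s, P, Q)\<leftarrow>L'. s * norm_trace (P u) * norm_trace (Q u))
      = (\<Sum>a<N. \<Sum>b<N. (\<Sum>(s, P, Q)\<leftarrow>L'. s * P u $$ (a, a) * Q u $$ (b, b))) / (of_nat N * of_nat N)"
      if "set L' \<subseteq> set L" for L'
      using that
    proof (induction L')
      case (Cons x L')
      obtain s P Q where x: "x = (s, P, Q)" by (cases x)
      have PQ: "P \<in> measurable (unitary_borel N) (unitary_borel N)"
        "Q \<in> measurable (unitary_borel N) (unitary_borel N)"
        using L[of s P Q] Cons.prems by (auto simp: x)
      have "s * norm_trace (P u) * norm_trace (Q u)
          = (\<Sum>a<N. \<Sum>b<N. s * P u $$ (a, a) * Q u $$ (b, b)) / (of_nat N * of_nat N)"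
        unfolding nt[OF PQ(1)] nt[OF PQ(2)]
        by (simp add: sum_product sum_distrib_left sum_divide_distrib mult_ac)
      then show ?case using Cons by (simp add: x sum.distrib add_divide_distrib)
    qed simp
    then show ?thesis unfolding T_def by blast
  qed
  have "(\<integral>u. (\<Sum>(s, P, Q)\<leftarrow>L. s * norm_trace (P u) * norm_trace (Q u)) \<partial>H)
      = (\<integral>u. (\<Sum>a<N. \<Sum>b<N. T u a b a b) / (of_nat N * of_nat N) \<partial>H)"
    by (rule Bochner_Integration.integral_cong[OF refl]) (simp only: tr space_H)
  also have "\<dots> = (\<integral>u. (\<Sum>a<N. \<Sum>b<N. T u a b a b) \<partial>H) / (of_nat N * of_nat N)"
    by (rule Bochner_Integration.integral_divide_zero)
  also have "(\<integral>u. (\<Sum>a<N. \<Sum>b<N. T u a b a b) \<partial>H) = (\<Sum>a<N. \<integral>u. (\<Sum>b<N. T u a b a b) \<partial>H)"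
    by (intro Bochner_Integration.integral_sum bounded_fun_integrable bounded_fun_sum Tb) auto
  also have "\<dots> = (\<Sum>a<N. \<Sum>b<N. \<integral>u. T u a b a b \<partial>H)"
    by (intro sum.cong refl Bochner_Integration.integral_sum bounded_fun_integrable Tb) auto
  also have "\<dots> = 0" by (simp add: zero)
  finally show ?thesis by simp
qed

end

subsection \<open>Moments of the rotated product\<close>

context haar
begin

lemma measurable_word:
  assumes "A \<in> UG N" "X \<in> UG N"
  shows "(\<lambda>u. alt_word X (conj_by A u) k m) \<in> measurable (unitary_borel N) (unitary_borel N)"
proof -
  have "(\<lambda>_. X) \<in> measurable (unitary_borel N) (unitary_borel N)" using assms by simp
  moreover have "(\<lambda>u. conj_by A u) \<in> measurable (unitary_borel N) (unitary_borel N)"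
    by (rule measurable_conj_by[OF assms(1)]) simp
  ultimately show ?thesis by (rule measurable_alt_word)
qed

lemma bounded_fun_word: "A \<in> UG N \<Longrightarrow> X \<in> UG N \<Longrightarrow> bounded_fun (\<lambda>u. norm_trace (alt_word X (conj_by A u) k m))"
  by (rule bounded_fun_norm_trace[OF measurable_word])

lemma word_terms_measurable:
  assumes x: "(s, P, Q) \<in> set (word_terms A X N k m)" and A: "A \<in> UG N" and X: "X \<in> UG N"
  shows "P \<in> measurable (unitary_borel N) (unitary_borel N) \<and> Q \<in> measurable (unitary_borel N) (unitary_borel N)"
proof -
  let ?M = "measurable (unitary_borel N) (unitary_borel N)"
  have c: "(\<lambda>_. B) \<in> ?M" if "B \<in> UG N" for B using that by simp
  have conj_by: "(\<lambda>u. conj_by B u) \<in> ?M" if "B \<in> UG N" for B by (rule measurable_conj_by[OF that]) simp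
  have cjk: "(\<lambda>u. conj_by (A ^\<^sub>m k) u) \<in> ?M" by (rule conj_by) (simp add: A)
  have Z: "(\<lambda>u. (conj_by A u * X) ^\<^sub>m m) \<in> ?M"
    by (intro measurable_unitary_pow measurable_unitary_mult conj_by c A X)
  have 1: "(\<lambda>u. conj_by (A ^\<^sub>m k) u * (X * (conj_by A u * X) ^\<^sub>m m)) \<in> ?M"
    "(\<lambda>u. 1\<^sub>m N * (X * (conj_by A u * X) ^\<^sub>m m)) \<in> ?M"
    by (intro measurable_unitary_mult Z c cjk X one_unitary)+
  have 2: "(\<lambda>u. conj_by (A ^\<^sub>m k) u * (X * P u)) \<in> ?M" "Q \<in> ?M"
    if "(s, P, Q) \<in> set (pow_terms (conj_by A) X N m)" for s P Q
    using pow_terms_measurable[OF that conj_by[OF A] X] by (auto intro!: measurable_unitary_mult cjk c X)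
  show ?thesis
    using x 1 2 cjk c[OF one_unitary] unfolding word_terms_def by auto
qed

text \<open>The cut in front of the whole word contributes the trace of the identity, which is 1,
  times the word. This is the term for which the contracted identity is solved.\<close>

lemma loop_equation:
  assumes A: "A \<in> UG N" and X: "X \<in> UG N" and N: "N > 0"
  defines "w \<equiv> \<lambda>k j u. norm_trace (alt_word X (conj_by A u) k j)"
  shows "(\<integral>u. w k m u \<partial>H) = norm_trace (A ^\<^sub>m k) * (\<integral>u. w 0 m u \<partial>H)
    + (\<Sum>i<m. (\<integral>u. w (Suc k) i u * w 0 (m - 1 - i) u \<partial>H) - (\<integral>u. w k i u * w 1 (m - 1 - i) u \<partial>H))"
proof -
  have b: "bounded_fun (w k j)" for k j unfolding w_def by (rule bounded_fun_word[OF A X])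
  have one: "norm_trace (1\<^sub>m N) = 1" using N by (simp add: norm_trace_def)
  have "0 = (\<integral>u. (\<Sum>(s, P, Q)\<leftarrow>word_terms A X N k m. s * norm_trace (P u) * norm_trace (Q u)) \<partial>H)"
    by (rule loop_contraction[symmetric, OF mat_expansion_word[OF _ A X] measurable_word[OF A X] word_terms_measurable[OF _ A X]])
  also have "\<dots> = (\<integral>u. (w k m u - norm_trace (A ^\<^sub>m k) * w 0 m u)
      - (\<Sum>i<m. w (Suc k) i u * w 0 (m - 1 - i) u - w k i u * w 1 (m - 1 - i) u) \<partial>H)"
    by (rule Bochner_Integration.integral_cong[OF refl])
      (simp only: contract_word_terms[OF A X] space_H w_def one mult_1)
  also have "\<dots> = (\<integral>u. w k m u - norm_trace (A ^\<^sub>m k) * w 0 m u \<partial>H)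
      - (\<integral>u. (\<Sum>i<m. w (Suc k) i u * w 0 (m - 1 - i) u - w k i u * w 1 (m - 1 - i) u) \<partial>H)"
    by (intro Bochner_Integration.integral_diff bounded_fun_integrable bounded_fun_sum bounded_fun_diff bounded_fun_mult bounded_fun_const b)
  also have "(\<integral>u. w k m u - norm_trace (A ^\<^sub>m k) * w 0 m u \<partial>H)
      = (\<integral>u. w k m u \<partial>H) - (\<integral>u. norm_trace (A ^\<^sub>m k) * w 0 m u \<partial>H)"
    by (intro Bochner_Integration.integral_diff bounded_fun_integrable bounded_fun_mult bounded_fun_const b)
  also have "(\<integral>u. norm_trace (A ^\<^sub>m k) * w 0 m u \<partial>H) = norm_trace (A ^\<^sub>m k) * (\<integral>u. w 0 m u \<partial>H)"
    by simp
  also have "(\<integral>u. (\<Sum>i<m. w (Suc k) i u * w 0 (m - 1 - i) u - w k i u * w 1 (m - 1 - i) u) \<partial>H)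
      = (\<Sum>i<m. \<integral>u. w (Suc k) i u * w 0 (m - 1 - i) u - w k i u * w 1 (m - 1 - i) u \<partial>H)"
    by (intro Bochner_Integration.integral_sum bounded_fun_integrable bounded_fun_diff bounded_fun_mult b)
  also have "\<dots> = (\<Sum>i<m. (\<integral>u. w (Suc k) i u * w 0 (m - 1 - i) u \<partial>H) - (\<integral>u. w k i u * w 1 (m - 1 - i) u \<partial>H))"
    by (intro sum.cong refl Bochner_Integration.integral_diff bounded_fun_integrable bounded_fun_mult b)
  finally show ?thesis by (simp add: algebra_simps)
qed

section \<open>Factorisation of the loop equations by concentration\<close>

lemma trace_close_conj_by:
  assumes A: "A \<in> UG N" and U: "U \<in> UG N" and R: "trace_close N c R (1\<^sub>m N)"
  shows "trace_close N (c + c) (conj_by A (U * R)) (conj_by A U)"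
proof -
  have Ru: "R \<in> UG N" using R by (simp add: trace_close_def)
  have UR: "trace_close N c (U * R) U"
    using trace_close_mult[OF trace_close_refl[OF U] R] U by (simp add: right_mult_one_mat[of _ N N])
  from trace_close_mult[OF trace_close_mult[OF UR trace_close_refl[OF A]] trace_close_adjoint[OF UR]]
  show ?thesis by (simp add: conj_by_def)
qed

text \<open>A conjugated matrix moves by 2/N through \<open>U\<close> and by 2/N through its
  adjoint. The block Y^k counts as one such matrix and (Y X)^m as m of them, so the total is 4 (m +
  1)/N, independent of \<open>k\<close>.\<close>

lemma trace_word_lipschitz:
  assumes A: "A \<in> UG N" and X: "X \<in> UG N" and U: "U \<in> UG N" and R: "trace_close N (2 / real N) R (1\<^sub>m N)"
    and mp: "Suc m \<le> p"
  shows "cmod (norm_trace (alt_word X (conj_by A (U * R)) k m) - norm_trace (alt_word X (conj_by A U) k m)) \<le> 4 * real p / real N"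
proof -
  have Ru: "R \<in> UG N" using R by (simp add: trace_close_def)
  have UR: "U * R \<in> UG N" by (rule unitary_group_mult[OF U Ru])
  let ?c = "2 / real N + 2 / real N"
  have k: "trace_close N ?c (conj_by (A ^\<^sub>m k) (U * R)) (conj_by (A ^\<^sub>m k) U)"
    by (rule trace_close_conj_by[OF unitary_pow[OF A] U R])
  have Z: "trace_close N (?c + 0) (conj_by A (U * R) * X) (conj_by A U * X)"
    by (rule trace_close_mult[OF trace_close_conj_by[OF A U R] trace_close_refl[OF X]])
  have "trace_close N (?c + (0 + real m * (?c + 0))) (alt_word X (conj_by A (U * R)) k m) (alt_word X (conj_by A U) k m)"
    unfolding alt_word_def conj_by_pow[OF A UR] conj_by_pow[OF A U]
    by (rule trace_close_mult[OF k trace_close_mult[OF trace_close_refl[OF X] trace_close_pow[OF Z]]])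
  then have "cmod (norm_trace (alt_word X (conj_by A (U * R)) k m) - norm_trace (alt_word X (conj_by A U) k m))
      \<le> ?c + (0 + real m * (?c + 0))"
    by (rule trace_close_norm_trace)
  also have "\<dots> = 4 * real (Suc m) / real N" by (simp add: algebra_simps add_divide_distrib)
  also have "\<dots> \<le> 4 * real p / real N" using mp by (intro divide_right_mono) auto
  finally show ?thesis .
qed

definition moment :: "complex mat \<Rightarrow> complex mat \<Rightarrow> nat \<Rightarrow> nat \<Rightarrow> complex" where
  "moment A X k j = (\<integral>u. norm_trace (alt_word X (conj_by A u) k j) \<partial>H)"

lemma moment_covariance:
  assumes A: "A \<in> UG N" and X: "X \<in> UG N" and N: "N > 0" and p: "Suc i \<le> p" "Suc j \<le> p"
  shows "cmod ((\<integral>u. norm_trace (alt_word X (conj_by A u) k i) * norm_trace (alt_word X (conj_by A u) l j) \<partial>H)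
     - moment A X k i * moment A X l j) \<le> 16 * (real p)\<^sup>2 / real N"
proof -
  have "cmod ((\<integral>u. norm_trace (alt_word X (conj_by A u) k i) * norm_trace (alt_word X (conj_by A u) l j) \<partial>H)
     - moment A X k i * moment A X l j) \<le> real N * (4 * real p / real N)\<^sup>2"
    unfolding moment_def
    by (rule covariance_bound[OF bounded_fun_word[OF A X] bounded_fun_word[OF A X]
        trace_word_lipschitz[OF A X _ _ p(1)] trace_word_lipschitz[OF A X _ _ p(2)]])
  also have "\<dots> = 16 * (real p)\<^sup>2 / real N" using N by (simp add: power2_eq_square field_simps)
  finally show ?thesis .
qed

lemma moment_loop:
  assumes A: "A \<in> UG N" and X: "X \<in> UG N" and N: "N > 0" and mp: "m < p"
  shows "cmod (moment A X k m - norm_trace (A ^\<^sub>m k) * moment A X 0 m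
     - (\<Sum>i<m. moment A X (Suc k) i * moment A X 0 (m - 1 - i) - moment A X k i * moment A X 1 (m - 1 - i)))
    \<le> 32 * real p ^ 3 / real N"
proof -
  let ?w = "\<lambda>k j u. norm_trace (alt_word X (conj_by A u) k j)" and ?e = "moment A X"
  let ?I = "\<lambda>k i l j. \<integral>u. ?w k i u * ?w l j u \<partial>H"
  have cov: "cmod (?I k i l j - ?e k i * ?e l j) \<le> 16 * (real p)\<^sup>2 / real N" if "i < p" "j < p" for k i l j
    using moment_covariance[OF A X N] that by simp
  have e: "?e k m - norm_trace (A ^\<^sub>m k) * ?e 0 m
     - (\<Sum>i<m. ?e (Suc k) i * ?e 0 (m - 1 - i) - ?e k i * ?e 1 (m - 1 - i))
    = (\<Sum>i<m. (?I (Suc k) i 0 (m - 1 - i) - ?e (Suc k) i * ?e 0 (m - 1 - i))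
        - (?I k i 1 (m - 1 - i) - ?e k i * ?e 1 (m - 1 - i)))"
    using loop_equation[OF A X N, of k m] by (simp add: moment_def sum_subtractf)
  have "cmod (\<Sum>i<m. (?I (Suc k) i 0 (m - 1 - i) - ?e (Suc k) i * ?e 0 (m - 1 - i))
        - (?I k i 1 (m - 1 - i) - ?e k i * ?e 1 (m - 1 - i))) \<le> (\<Sum>i<m. 16 * (real p)\<^sup>2 / real N + 16 * (real p)\<^sup>2 / real N)"
  proof (rule order_trans[OF norm_sum sum_mono])
    fix i assume "i \<in> {..<m}"
    then have ij: "i < p" "m - 1 - i < p" using mp by auto
    show "cmod ((?I (Suc k) i 0 (m - 1 - i) - ?e (Suc k) i * ?e 0 (m - 1 - i))
        - (?I k i 1 (m - 1 - i) - ?e k i * ?e 1 (m - 1 - i))) \<le> 16 * (real p)\<^sup>2 / real N + 16 * (real p)\<^sup>2 / real N"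
      by (rule order_trans[OF norm_triangle_ineq4 add_mono]) (intro cov ij)+
  qed
  also have "\<dots> = real m * (16 * (real p)\<^sup>2 / real N + 16 * (real p)\<^sup>2 / real N)"
    by (simp only: sum_constant card_lessThan)
  also have "\<dots> \<le> real p * (16 * (real p)\<^sup>2 / real N + 16 * (real p)\<^sup>2 / real N)"
    by (rule mult_right_mono) (use mp in simp_all)
  also have "\<dots> = 32 * real p ^ 3 / real N"
    by (simp only: power3_eq_cube power2_eq_square add_divide_distrib[symmetric]) simp
  finally show ?thesis unfolding e .
qed

text \<open>Inversion invariance replaces u by u^*. Conjugating the whole word by u, which the trace
  does not see, then moves the rotation from one matrix to the other.\<close>

lemma moment_swap:
  assumes A: "A \<in> UG N" and X: "X \<in> UG N"
  shows "moment X A k j = (\<integral>u. norm_trace (alt_word (conj_by A u) X k j) \<partial>H)"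
proof -
  have "moment X A k j = (\<integral>u. norm_trace (alt_word A (conj_by X (mat_adjoint u)) k j) \<partial>H)"
    unfolding moment_def by (rule inverse_invariant[OF bounded_fun_word[OF X A], symmetric])
  also have "\<dots> = (\<integral>u. norm_trace (alt_word (conj_by A u) X k j) \<partial>H)"
  proof (rule Bochner_Integration.integral_cong[OF refl])
    fix u assume "u \<in> space H"
    then have u: "u \<in> UG N" by (simp add: space_H)
    let ?B = "conj_by X (mat_adjoint u)"
    have B: "?B \<in> UG N" using X unitary_group_adjoint[OF u] by simp
    have "norm_trace (alt_word A ?B k j) = norm_trace (conj_by (alt_word A ?B k j) u)"
      by (rule norm_trace_conj_by[symmetric, OF alt_word_unitary[OF A B] u])
    also have "conj_by (alt_word A ?B k j) u = alt_word (conj_by A u) (conj_by ?B u) k j"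
      by (rule alt_word_conj_by[symmetric, OF A B u])
    also have "conj_by ?B u = X" by (rule conj_by_adjoint_cancel[OF X u])
    finally show "norm_trace (alt_word A ?B k j) = norm_trace (alt_word (conj_by A u) X k j)" .
  qed
  finally show ?thesis .
qed

lemma moment_zero_zero:
  assumes A: "A \<in> UG N" and X: "X \<in> UG N"
  shows "moment A X 0 0 = norm_trace (X ^\<^sub>m 1)"
proof -
  have "moment A X 0 0 = (\<integral>u. norm_trace (X ^\<^sub>m 1) \<partial>H)"
    unfolding moment_def
    by (rule Bochner_Integration.integral_cong[OF refl])
      (rule norm_trace_alt_word_zero_zero[OF X conj_by_unitary[OF A]], simp add: space_H)
  then show ?thesis by (simp add: prob_space)
qed

lemma moment_zero_Suc:
  assumes A: "A \<in> UG N" and X: "X \<in> UG N"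
  shows "moment A X 0 (Suc j) = moment X A 2 j"
  unfolding moment_swap[OF A X] unfolding moment_def
  by (rule Bochner_Integration.integral_cong[OF refl])
    (rule norm_trace_alt_word_zero_Suc[OF X conj_by_unitary[OF A]], simp add: space_H)

lemma moment_one:
  assumes A: "A \<in> UG N" and X: "X \<in> UG N"
  shows "moment X A 1 j = moment A X 1 j"
  unfolding moment_swap[OF A X] unfolding moment_def
  by (rule Bochner_Integration.integral_cong[OF refl])
    (rule norm_trace_alt_word_one[OF conj_by_unitary[OF A] X], simp add: space_H)

lemma norm_moment_le_1:
  assumes A: "A \<in> UG N" and X: "X \<in> UG N"
  shows "cmod (moment A X k j) \<le> 1"
  unfolding moment_def
  by (rule norm_integral_le[OF bounded_fun_word[OF A X]])
    (intro norm_trace_unitary_le_1[of _ N] alt_word_unitary conj_by_unitary A X)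

lemma moment_product_bound:
  assumes A: "A \<in> UG N" and X: "X \<in> UG N" and N: "N > 0" and p: "1 \<le> p"
    and small: "(\<Sum>k = 1..p. cmod (norm_trace (A ^\<^sub>m k))) \<le> 1/4"
      "(\<Sum>k = 1..p. cmod (norm_trace (X ^\<^sub>m k))) \<le> 1/4"
  shows "cmod (moment A X 1 (p - 1))
    \<le> (cmod (norm_trace A) + cmod (norm_trace X)) / 2 + 1536 * real p ^ 4 / real N"
proof (cases "real p * (32 * real p ^ 3 / real N) \<le> 1/48")
  case True
  interpret loop_system "moment A X" "moment X A" "\<lambda>k. norm_trace (A ^\<^sub>m k)" "\<lambda>k. norm_trace (X ^\<^sub>m k)"
    p "32 * real p ^ 3 / real N"
  proof
    fix k j assume "1 \<le> k" "k + j \<le> p"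
    then have j: "j < p" by simp
    show "cmod (moment A X k j - norm_trace (A ^\<^sub>m k) * moment A X 0 j -
      (\<Sum>i<j. moment A X (Suc k) i * moment A X 0 (j - 1 - i) - moment A X k i * moment A X 1 (j - 1 - i)))
      \<le> 32 * real p ^ 3 / real N" by (rule moment_loop[OF A X N j])
    show "cmod (moment X A k j - norm_trace (X ^\<^sub>m k) * moment X A 0 j -
      (\<Sum>i<j. moment X A (Suc k) i * moment X A 0 (j - 1 - i) - moment X A k i * moment X A 1 (j - 1 - i)))
      \<le> 32 * real p ^ 3 / real N" by (rule moment_loop[OF X A N j])
  qed (use True small in \<open>simp_all only: moment_zero_zero[OF A X] moment_zero_zero[OF X A]
      moment_zero_Suc[OF A X] moment_zero_Suc[OF X A] moment_one[OF A X]\<close>, simp)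
  \<comment> \<open>The stability argument costs only \<open>8 * 32 = 256\<close> here; the larger
    constant 1536 comes from the case in which the trivial bound is used.\<close>
  have "8 * (real p * (32 * real p ^ 3 / real N)) \<le> 1536 * real p ^ 4 / real N"
    using N by (simp add: field_simps power4_eq_xxxx power3_eq_cube)
  moreover have "B ^\<^sub>m 1 = B" if "B \<in> UG N" for B
    using that by (simp add: left_mult_one_mat[of _ N N])
  ultimately show ?thesis using moment_bound[OF p] A X by simp
next
  case False
  then have "1 \<le> 1536 * real p ^ 4 / real N"
    using N by (simp add: field_simps power4_eq_xxxx power3_eq_cube)
  then have "cmod (moment A X 1 (p - 1)) \<le> 1536 * real p ^ 4 / real N"
    by (rule order_trans[OF norm_moment_le_1[OF A X]])
  then show ?thesis by (rule add_increasing[rotated]) simp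
qed

text \<open>Conjugating by \<open>U\<close> and absorbing \<open>U\<^sup>*\<close> into \<open>V\<close> leaves a single Haar unitary.\<close>

lemma rotated_moment:
  assumes A: "A \<in> UG N" and X: "X \<in> UG N" and U: "U \<in> UG N" and p: "1 \<le> p"
  shows "(\<integral>V. norm_trace ((conj_by X U * conj_by A V) ^\<^sub>m p) \<partial>H) = moment A X 1 (p - 1)"
proof -
  obtain m where m: "p = Suc m" using p by (cases p) auto
  note a = unitary_group_adjoint[OF U]
  have "(\<integral>V. norm_trace ((conj_by X U * conj_by A V) ^\<^sub>m p) \<partial>H)
      = (\<integral>V. norm_trace (alt_word X (conj_by A (mat_adjoint U * V)) 1 m) \<partial>H)"
  proof (rule Bochner_Integration.integral_cong[OF refl])
    fix V assume "V \<in> space H"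
    then have V: "V \<in> UG N" by (simp add: space_H)
    let ?Y = "conj_by A (mat_adjoint U * V)"
    have Y: "?Y \<in> UG N" by (rule conj_by_unitary[OF A unitary_group_mult[OF a V]])
    have "conj_by ?Y U = conj_by A (U * (mat_adjoint U * V))"
      using conj_by_mult[OF A unitary_group_mult[OF a V] U] by (simp add: conj_by_def)
    then have "conj_by ?Y U = conj_by A V" using unitary_adjoint_cancel(2)[OF U V] by simp
    then have "conj_by X U * conj_by A V = conj_by (X * ?Y) U" using conj_by_hom[OF X Y U] by simp
    then have "(conj_by X U * conj_by A V) ^\<^sub>m p = conj_by ((X * ?Y) ^\<^sub>m p) U"
      by (simp only: conj_by_pow[OF unitary_group_mult[OF X Y] U])
    then have "norm_trace ((conj_by X U * conj_by A V) ^\<^sub>m p) = norm_trace ((X * ?Y) ^\<^sub>m p)"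
      by (simp only: norm_trace_conj_by[OF unitary_pow[OF unitary_group_mult[OF X Y]] U])
    then show "norm_trace ((conj_by X U * conj_by A V) ^\<^sub>m p) = norm_trace (alt_word X ?Y 1 m)"
      by (simp only: m norm_trace_pow_swap[OF X Y] alt_word_one[OF X Y])
  qed
  also have "\<dots> = moment A X 1 m"
    unfolding moment_def by (rule left_invariant[OF a bounded_fun_word[OF A X]])
  finally show ?thesis by (simp add: m)
qed

text \<open>For a fixed pair and fixed U the integral over V does not depend on U, so only the law
  of the pair remains after Fubini. The second matrix of the pair is the one that stays
  rotated.\<close>

lemma rotated_product_moment:
  assumes \<mu>: "unitary_pair_law N \<mu>" and p: "1 \<le> p"
  shows "(\<integral>W. norm_trace (W ^\<^sub>m p) \<partial>(rotated_product_law N H \<mu>))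
    = (\<integral>x. moment (snd x) (fst x) 1 (p - 1) \<partial>\<mu>)"
    and "integrable \<mu> (\<lambda>x. moment (snd x) (fst x) 1 (p - 1))"
proof -
  interpret m: prob_space \<mu> using \<mu> by (simp add: unitary_pair_law_def)
  interpret HH: pair_prob_space H H ..
  interpret P: pair_prob_space "H \<Otimes>\<^sub>M H" \<mu> ..
  let ?B = "unitary_borel N"
  have s\<mu>: "sets \<mu> = sets (?B \<Otimes>\<^sub>M ?B)" using \<mu> by (simp add: unitary_pair_law_def)
  have sp\<mu>: "space \<mu> = UG N \<times> UG N"
    using sets_eq_imp_space_eq[OF s\<mu>] by (simp add: space_pair_measure)
  have spHH: "space (H \<Otimes>\<^sub>M H) = UG N \<times> UG N" by (simp add: space_pair_measure space_H)
  let ?f = "\<lambda>x. (fst (fst x) * fst (snd x) * mat_adjoint (fst (fst x)))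
      * (snd (fst x) * snd (snd x) * mat_adjoint (snd (fst x)))"
  let ?g = "\<lambda>x. norm_trace (?f x ^\<^sub>m p)"
  have f: "?f \<in> measurable ((H \<Otimes>\<^sub>M H) \<Otimes>\<^sub>M \<mu>) ?B"
    using measurable_rotated_product[OF haar \<mu>] by (simp add: case_prod_unfold)
  have g: "?g \<in> borel_measurable ((H \<Otimes>\<^sub>M H) \<Otimes>\<^sub>M \<mu>)"
    by (rule measurable_norm_trace[OF measurable_unitary_pow[OF f]])
  have "cmod (?g x) \<le> 1" if "x \<in> space ((H \<Otimes>\<^sub>M H) \<Otimes>\<^sub>M \<mu>)" for x
    by (rule norm_trace_unitary_le_1[of _ N]) (use measurable_space[OF f that] in simp)
  then have ig: "integrable ((H \<Otimes>\<^sub>M H) \<Otimes>\<^sub>M \<mu>) ?g"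
    by (intro P.P.integrable_const_bound[of _ 1] AE_I2 g) auto
  have snd_integral: "(\<integral>x. G x \<partial>((H \<Otimes>\<^sub>M H) \<Otimes>\<^sub>M \<mu>)) = (\<integral>D. (\<integral>y. G (y, D) \<partial>(H \<Otimes>\<^sub>M H)) \<partial>\<mu>)"
    "integrable \<mu> (\<lambda>D. \<integral>y. G (y, D) \<partial>(H \<Otimes>\<^sub>M H))"
    if "integrable ((H \<Otimes>\<^sub>M H) \<Otimes>\<^sub>M \<mu>) G"
    for G :: "(complex mat \<times> complex mat) \<times> (complex mat \<times> complex mat) \<Rightarrow> complex"
    using P.integral_snd[of "\<lambda>y D. G (y, D)"] P.integrable_snd[of "\<lambda>y D. G (y, D)"] that
    by (simp_all only: case_prod_eta)
  have inner: "(\<integral>y. ?g (y, D) \<partial>(H \<Otimes>\<^sub>M H)) = moment (snd D) (fst D) 1 (p - 1)" if D: "D \<in> space \<mu>" for D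
  proof -
    have Du: "fst D \<in> UG N" "snd D \<in> UG N"
      using D unfolding sp\<mu> mem_Times_iff by blast+
    have "(\<lambda>y. (y, D)) \<in> measurable (H \<Otimes>\<^sub>M H) ((H \<Otimes>\<^sub>M H) \<Otimes>\<^sub>M \<mu>)"
      by (rule measurable_Pair2'[OF D])
    from measurable_compose[OF this g]
    have gm: "(\<lambda>y. ?g (y, D)) \<in> borel_measurable (H \<Otimes>\<^sub>M H)" .
    have "cmod (?g (y, D)) \<le> 1" if "y \<in> space (H \<Otimes>\<^sub>M H)" for y
      by (rule norm_trace_unitary_le_1[of _ N])
        (use measurable_space[OF f, of "(y, D)"] that D in \<open>simp add: space_pair_measure\<close>)
    then have "integrable (H \<Otimes>\<^sub>M H) (\<lambda>y. ?g (y, D))"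
      by (intro HH.P.integrable_const_bound[of _ 1] AE_I2 gm) auto
    from HH.integral_fst'[OF this]
    have "(\<integral>y. ?g (y, D) \<partial>(H \<Otimes>\<^sub>M H)) = (\<integral>U. (\<integral>V. ?g ((U, V), D) \<partial>H) \<partial>H)" by simp
    also have "\<dots> = (\<integral>U. moment (snd D) (fst D) 1 (p - 1) \<partial>H)"
      by (rule Bochner_Integration.integral_cong[OF refl])
        (use rotated_moment[OF Du(2,1) _ p] in \<open>simp add: conj_by_def space_H\<close>)
    finally show ?thesis by (simp add: prob_space)
  qed
  have "(\<integral>W. norm_trace (W ^\<^sub>m p) \<partial>(rotated_product_law N H \<mu>)) = (\<integral>x. ?g x \<partial>((H \<Otimes>\<^sub>M H) \<Otimes>\<^sub>M \<mu>))"
    unfolding rotated_product_law_def case_prod_unfold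
    by (rule integral_distr[OF f measurable_norm_trace[OF measurable_unitary_pow[OF measurable_ident_sets[OF refl]]]])
  also have "\<dots> = (\<integral>D. (\<integral>y. ?g (y, D) \<partial>(H \<Otimes>\<^sub>M H)) \<partial>\<mu>)"
    by (rule snd_integral(1)[OF ig])
  also have "\<dots> = (\<integral>D. moment (snd D) (fst D) 1 (p - 1) \<partial>\<mu>)"
    by (rule Bochner_Integration.integral_cong[OF refl inner])
  finally show "(\<integral>W. norm_trace (W ^\<^sub>m p) \<partial>(rotated_product_law N H \<mu>))
      = (\<integral>D. moment (snd D) (fst D) 1 (p - 1) \<partial>\<mu>)" .
  have "integrable \<mu> (\<lambda>D. \<integral>y. ?g (y, D) \<partial>(H \<Otimes>\<^sub>M H))"
    by (rule snd_integral(2)[OF ig])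
  then show "integrable \<mu> (\<lambda>D. moment (snd D) (fst D) 1 (p - 1))"
    by (subst Bochner_Integration.integrable_cong[OF refl inner[symmetric]])
qed

end

text \<open>The left side is the right side times p^(1/4) / sqrt N, and this factor is at most 1 in
  the given range of \<open>N\<close>.\<close>

lemma error_rate:
  assumes p: "1 \<le> p" and N: "real N > 97 / 2 * real p powr (7 / 2)"
  shows "real p ^ 4 / real N \<le> real p powr (15 / 4) / sqrt (real N)"
proof -
  have p0: "0 < real p" using p by simp
  have "real p powr (1 / 2) \<le> real p powr (7 / 2)" using p by (intro powr_mono) auto
  also have "\<dots> \<le> real N" using N p0 powr_gt_zero[of "real p" "7/2"] by linarith
  finally have "sqrt (real p powr (1 / 2)) \<le> sqrt (real N)" by (rule real_sqrt_le_mono)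
  then have q: "real p powr (1 / 4) \<le> sqrt (real N)"
    using p0 by (simp add: powr_half_sqrt[symmetric] powr_powr)
  have N0: "0 < real N" using N p0 powr_gt_zero[of "real p" "7/2"] by linarith
  have "real p ^ 4 = real p powr (15 / 4) * real p powr (1 / 4)"
    using powr_realpow[OF p0, of 4] powr_add[of "real p" "15/4" "1/4"] by simp
  also have "\<dots> \<le> real p powr (15 / 4) * sqrt (real N)" using q by (intro mult_left_mono) auto
  finally have "real p ^ 4 / real N \<le> real p powr (15 / 4) * sqrt (real N) / real N"
    using N0 by (intro divide_right_mono) auto
  also have "\<dots> = real p powr (15 / 4) / sqrt (real N)"
    using N0 by (simp add: field_simps)
  finally show ?thesis .
qed

theorem mainTheorem5:
  shows "\<exists>C::real. \<forall>(p::nat) (N::nat) (H :: complex mat measure)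
      (\<mu> :: (complex mat \<times> complex mat) measure) (\<omega> :: complex mat measure).
    p \<ge> 1 \<longrightarrow>
    real N > 97 / 2 * real p powr (7 / 2) \<longrightarrow>
    haar_unitary N H \<longrightarrow>
    unitary_pair_law N \<mu> \<longrightarrow>
    (AE (D1, D2) in \<mu>. (\<Sum>k = 1..p. cmod (norm_trace (D1 ^\<^sub>m k))) \<le> 1 / 4 \<and>
                       (\<Sum>k = 1..p. cmod (norm_trace (D2 ^\<^sub>m k))) \<le> 1 / 4) \<longrightarrow>
    \<omega> = rotated_product_law N H \<mu> \<longrightarrow>
    cmod (\<integral>W. norm_trace (W ^\<^sub>m p) \<partial>\<omega>)
      \<le> C * (real p powr (15 / 4) / sqrt (real N))
        + real p * (\<integral>(D1, D2). (cmod (norm_trace D1) + cmod (norm_trace D2)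
            + cmod (norm_trace D1) * cmod (norm_trace D2)) \<partial>\<mu>)"
proof (intro exI[of _ 1536] allI impI)
  fix p N :: nat and H :: "complex mat measure" and \<mu> :: "(complex mat \<times> complex mat) measure"
    and \<omega> :: "complex mat measure"
  assume p: "1 \<le> p" and Np: "real N > 97 / 2 * real p powr (7 / 2)"
    and H: "haar_unitary N H" and \<mu>: "unitary_pair_law N \<mu>"
    and small: "AE (D1, D2) in \<mu>. (\<Sum>k = 1..p. cmod (norm_trace (D1 ^\<^sub>m k))) \<le> 1 / 4 \<and>
                       (\<Sum>k = 1..p. cmod (norm_trace (D2 ^\<^sub>m k))) \<le> 1 / 4"
    and \<omega>: "\<omega> = rotated_product_law N H \<mu>"
  interpret haar H N
    using H by (simp add: haar_def haar_axioms_def haar_unitary_def)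
  interpret m: prob_space \<mu> using \<mu> by (simp add: unitary_pair_law_def)
  let ?B = "unitary_borel N"
  have s\<mu>: "sets \<mu> = sets (?B \<Otimes>\<^sub>M ?B)" using \<mu> by (simp add: unitary_pair_law_def)
  have sp\<mu>: "space \<mu> = UG N \<times> UG N"
    using sets_eq_imp_space_eq[OF s\<mu>] by (simp add: space_pair_measure)
  have N0: "N > 0" using Np powr_gt_zero[of "real p" "7/2"] p by (cases "N = 0") auto
  let ?M = "\<lambda>x. moment (snd x) (fst x) 1 (p - 1)"
  let ?a = "\<lambda>x. cmod (norm_trace (fst x))" and ?b = "\<lambda>x. cmod (norm_trace (snd x))"
  let ?E = "1536 * real p ^ 4 / real N"
  have meas: "(\<lambda>x. fst x) \<in> measurable \<mu> ?B" "(\<lambda>x. snd x) \<in> measurable \<mu> ?B"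
    unfolding measurable_cong_sets[OF s\<mu> refl] by auto
  have le1: "?a x \<le> 1" "?b x \<le> 1" if "x \<in> space \<mu>" for x
    using that norm_trace_unitary_le_1[of _ N] by (auto simp: sp\<mu>)
  have im: "integrable \<mu> ?a" "integrable \<mu> ?b" "integrable \<mu> (\<lambda>x. ?a x * ?b x)"
    using le1 by (intro m.integrable_const_bound[of _ 1] AE_I2 borel_measurable_norm borel_measurable_times
        measurable_compose[OF measurable_norm_trace[OF meas(1)]] measurable_compose[OF measurable_norm_trace[OF meas(2)]];
      auto intro: mult_le_one)+
  have bound: "AE x in \<mu>. cmod (?M x) \<le> real p * (?a x + ?b x + ?a x * ?b x) + ?E"
    using small AE_space
  proof eventually_elim
    case (elim x)
    then have u: "fst x \<in> UG N" "snd x \<in> UG N"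
      and sm: "(\<Sum>k = 1..p. cmod (norm_trace (snd x ^\<^sub>m k))) \<le> 1/4"
        "(\<Sum>k = 1..p. cmod (norm_trace (fst x ^\<^sub>m k))) \<le> 1/4"
      by (auto simp: sp\<mu> case_prod_unfold)
    have "cmod (?M x) \<le> (?b x + ?a x) / 2 + ?E"
      by (rule moment_product_bound[OF u(2,1) N0 p sm])
    also have "(?b x + ?a x) / 2 \<le> 1 * (?a x + ?b x + ?a x * ?b x)" by simp
    also have "\<dots> \<le> real p * (?a x + ?b x + ?a x * ?b x)" using p by (intro mult_right_mono) auto
    finally show ?case by simp
  qed
  have "cmod (\<integral>W. norm_trace (W ^\<^sub>m p) \<partial>\<omega>) = cmod (\<integral>x. ?M x \<partial>\<mu>)"
    by (simp only: \<omega> rotated_product_moment(1)[OF \<mu> p])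
  also have "\<dots> \<le> (\<integral>x. cmod (?M x) \<partial>\<mu>)" by (rule integral_norm_bound)
  also have "\<dots> \<le> (\<integral>x. real p * (?a x + ?b x + ?a x * ?b x) + ?E \<partial>\<mu>)"
    using rotated_product_moment(2)[OF \<mu> p] im bound by (intro integral_mono_AE) auto
  also have "\<dots> = real p * (\<integral>x. ?a x + ?b x + ?a x * ?b x \<partial>\<mu>) + ?E"
    using im by (simp add: m.prob_space)
  also have "?E \<le> 1536 * (real p powr (15 / 4) / sqrt (real N))"
    using error_rate[OF p Np] by simp
  finally show "cmod (\<integral>W. norm_trace (W ^\<^sub>m p) \<partial>\<omega>)
      \<le> 1536 * (real p powr (15 / 4) / sqrt (real N))
        + real p * (\<integral>(D1, D2). (cmod (norm_trace D1) + cmod (norm_trace D2)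
            + cmod (norm_trace D1) * cmod (norm_trace D2)) \<partial>\<mu>)"
    by (simp add: case_prod_unfold)
qed

end
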